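(* Assume conditions (D), (K), (G) and (H) hold. Then the SDE $\mathrm{d}X_t = AX_t\,\mathrm{d}t + F(X_t)\,\mathrm{d}t + B\,\mathrm{d}W_t$ admits a unique invariant (stationary) probability measure $\mu^{\mathrm{inv}}$ on $\mathbb{R}^d$. Moreover, $V$ is integrable with respect to $\mu^{\mathrm{inv}}$, and there exist constants $c,C>0$ such that $$\Big|\int_{\mathbb{R}^d} f(y)\,P^F_t(x,\mathrm{d}y) - \int_{\mathbb{R}^d} f(y)\,\mu^{\mathrm{inv}}(\mathrm{d}y)\Big| \le C\,(1+V(x))\,e^{-ct}$$ for all $x\in\mathbb{R}^d$, all $t\ge 0$ and all measurable $f:\mathbb{R}^d\to\mathbb{R}$ with $|f|\le 1+V$.
   Context: Let $d,n$ be positive integers with $n\le d$, let $A:\mathbb{R}^d\to\mathbb{R}^d$ and $B:\mathbb{R}^n\to\mathbb{R}^d$ be linear maps, let $F:\mathbb{R}^d\to\mathbb{R}^d$ be a smooth, globally Lipschitz vector field, and let $(W_t)_{t\ge0}$ be a standard Wiener process in $\mathbb{R}^n$. For $x\in\mathbb{R}^d$, $X_t(x)$ denotes the solution of $X_t = x + \int_0^t (AX_s + F(X_s))\,\mathrm{d}s + BW_t$, and $P^F_t(x,\Gamma)=\mathbf{P}(X_t(x)\in\Gamma)$ for Borel $\Gamma\subseteq\mathbb{R}^d$. Let $e_1,\dots,e_n$ be the standard basis of $\mathbb{R}^n$ and $V(x)=\int_0^\infty |e^{sA}x|^2\,\mathrm{d}s$. Conditions: (D) every eigenvalue of $A$ (over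 $\mathbb{C}$) has strictly negative real part. (K) (Kalman condition) the columns of $B, AB, A^2B, \dots$ span $\mathbb{R}^d$; $d_*$ denotes the smallest positive integer such that $\operatorname{span}\{A^jBe_i: 0\le j\le d_*-1,\ 1\le i\le n\}=\mathbb{R}^d$ (so $d_*\le d$). (G) there is $a\in[0,\frac{1}{2d_*})$ with $\sup_{x\in\mathbb{R}^d}|F(x)|/(1+|x|)^a<\infty$. (H) (weak Hörmander condition) there is a point $x_0\in\mathbb{R}^d$ at which the vector fields $V_0$, $\mathcal{L}_{V_2}V_1$, $\mathcal{L}_{V_3}\mathcal{L}_{V_2}V_1,\dots$ with $V_0\in\mathcal{B}$ and $V_1,V_2,V_3,\dots\in\mathcal{B}\cup\{A+F\}$ span $\mathbb{R}^d$, where $\mathcal{B}=\{Be_1,\dots,Be_n\}$ (constant vector fields), $A+F$ is the vector field $x\mapsto Ax+F(x)$, and $\mathcal{L}_G H = DH[G]-DG[H]$ is the Lie derivative of the vector field $H$ along $G$. *)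

theory Defs
  imports "HOL-Probability.Probability"
begin

definition smooth_field :: "(real^'d \<Rightarrow> real^'d) \<Rightarrow> bool" where
  "smooth_field F \<longleftrightarrow> (\<exists>S :: (real^'d \<Rightarrow> real) set.
      (\<forall>i. (\<lambda>x. F x $ i) \<in> S) \<and>
      (\<forall>g\<in>S. (\<forall>x. g differentiable (at x)) \<and>
               (\<forall>j. (\<lambda>x. frechet_derivative g (at x) (axis j 1)) \<in> S)))"

definition lie_deriv :: "(real^'d \<Rightarrow> real^'d) \<Rightarrow> (real^'d \<Rightarrow> real^'d) \<Rightarrow> (real^'d \<Rightarrow> real^'d)" where
  "lie_deriv G H = (\<lambda>x. frechet_derivative H (at x) (G x) - frechet_derivative G (at x) (H x))"

definition Bfields :: "(real^'n \<Rightarrow> real^'d) \<Rightarrow> (real^'d \<Rightarrow> real^'d) set" where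
  "Bfields B = {(\<lambda>_. B (axis i 1)) | i. True}"

inductive_set brackets :: "(real^'d \<Rightarrow> real^'d) set \<Rightarrow> (real^'d \<Rightarrow> real^'d) set"
  for G0 :: "(real^'d \<Rightarrow> real^'d) set" where
  base: "V1 \<in> G0 \<Longrightarrow> V2 \<in> G0 \<Longrightarrow> lie_deriv V2 V1 \<in> brackets G0"
| step: "H \<in> brackets G0 \<Longrightarrow> V \<in> G0 \<Longrightarrow> lie_deriv V H \<in> brackets G0"

definition weak_hoermander ::
  "(real^'d \<Rightarrow> real^'d) \<Rightarrow> (real^'d \<Rightarrow> real^'d) \<Rightarrow> (real^'n \<Rightarrow> real^'d) \<Rightarrow> bool" where
  "weak_hoermander A F B \<longleftrightarrow> (\<exists>x0. span ((\<lambda>V. V x0) ` (Bfields B \<union>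
       brackets (Bfields B \<union> {(\<lambda>x. A x + F x)}))) = UNIV)"

definition cmatrix :: "(real^'d \<Rightarrow> real^'d) \<Rightarrow> complex^'d^'d" where
  "cmatrix A = (\<chi> i j. complex_of_real (matrix A $ i $ j))"

definition hurwitz :: "(real^'d \<Rightarrow> real^'d) \<Rightarrow> bool" where
  "hurwitz A \<longleftrightarrow> (\<forall>lam::complex. (\<exists>v::complex^'d. v \<noteq> 0 \<and> cmatrix A *v v = lam *s v) \<longrightarrow> Re lam < 0)"

definition kalman_span :: "(real^'d \<Rightarrow> real^'d) \<Rightarrow> (real^'n \<Rightarrow> real^'d) \<Rightarrow> nat \<Rightarrow> (real^'d) set" where
  "kalman_span A B k = span {(A ^^ j) (B (axis i 1)) | j i. j < k}"

definition kalman :: "(real^'d \<Rightarrow> real^'d) \<Rightarrow> (real^'n \<Rightarrow> real^'d) \<Rightarrow> bool" where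
  "kalman A B \<longleftrightarrow> span {(A ^^ j) (B (axis i 1)) | j i. True} = UNIV"

definition dstar :: "(real^'d \<Rightarrow> real^'d) \<Rightarrow> (real^'n \<Rightarrow> real^'d) \<Rightarrow> nat" where
  "dstar A B = (LEAST k. 0 < k \<and> kalman_span A B k = UNIV)"

definition expA :: "(real^'d \<Rightarrow> real^'d) \<Rightarrow> real \<Rightarrow> real^'d \<Rightarrow> real^'d" where
  "expA A s x = (\<Sum>k. (s ^ k / fact k) *\<^sub>R (A ^^ k) x)"

definition Vfun :: "(real^'d \<Rightarrow> real^'d) \<Rightarrow> real^'d \<Rightarrow> real" where
  "Vfun A x = integral {0..} (\<lambda>s. (norm (expA A s x))\<^sup>2)"

definition wiener :: "'w measure \<Rightarrow> (real \<Rightarrow> 'w \<Rightarrow> real^'n) \<Rightarrow> bool" where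
  "wiener M W \<longleftrightarrow> prob_space M \<and>
     (\<forall>t. W t \<in> borel_measurable M) \<and>
     (\<forall>\<omega>\<in>space M. W 0 \<omega> = 0 \<and> continuous_on {0..} (\<lambda>t. W t \<omega>)) \<and>
     (\<forall>(ts::nat \<Rightarrow> real) k. (\<forall>j<k. 0 \<le> ts j \<and> ts j < ts (Suc j)) \<longrightarrow>
        prob_space.indep_vars M (\<lambda>_. borel)
           (\<lambda>(j, i) \<omega>. (W (ts (Suc j)) \<omega> - W (ts j) \<omega>) $ i) ({..<k} \<times> UNIV) \<and>
        (\<forall>j<k. \<forall>i. distributed M lborel (\<lambda>\<omega>. (W (ts (Suc j)) \<omega> - W (ts j) \<omega>) $ i)
                      (normal_density 0 (sqrt (ts (Suc j) - ts j)))))"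

definition transP :: "'w measure \<Rightarrow> (real \<Rightarrow> real^'d \<Rightarrow> 'w \<Rightarrow> real^'d) \<Rightarrow> real \<Rightarrow> real^'d \<Rightarrow> (real^'d) measure" where
  "transP M X t x = distr M borel (X t x)"

definition invariant_measure :: "'w measure \<Rightarrow> (real \<Rightarrow> real^'d \<Rightarrow> 'w \<Rightarrow> real^'d) \<Rightarrow> (real^'d) measure \<Rightarrow> bool" where
  "invariant_measure M X \<mu> \<longleftrightarrow> prob_space \<mu> \<and> sets \<mu> = sets borel \<and>
     (\<forall>t\<ge>0. \<forall>\<Gamma>\<in>sets borel. (\<integral>x. measure (transP M X t x) \<Gamma> \<partial>\<mu>) = measure \<mu> \<Gamma>)"

end

(* Exponential Euler steps y -> exp(hA)(y + h F(y) + B dW), driven by the Brownian increments, converge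
   pathwise to the solution, so everything can be read off from finitely many independent Gaussian
   increments.  For the quadratic form V one step contracts V(exp(hA)x), the noise only adds a multiple
   of h, and the sublinear drift F is absorbed; Fatou turns this into a drift inequality for V.

   The local Doeblin condition needs no hypoellipticity theory.  Shift the increments by the controls
   u_k = B^T exp((N-k)hA)^T v, with v in R^d.  The linear part of the end point then moves by the
   (discrete) Gramian applied to v, which is uniformly positive definite by the Kalman condition, and F
   perturbs this only sublinearly in v.  By Brouwer the end-point map of some ball of R^d covers the
   unit ball, and since it is Lipschitz, the push-forward of Lebesgue measure on the ball dominates a
   multiple of Lebesgue measure on the unit ball.  The Cameron-Martin density of the shift is bounded
   below on an event of probability at least 1/2, uniformly in the mesh and for starting points in a
   bounded set.  Harris' theorem, in the contraction form of Hairer and Mattingly, concludes. *)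
theory Submission
  imports Defs "HOL-Computational_Algebra.Fundamental_Theorem_Algebra"
begin

section \<open>The flow \<open>exp(sT)\<close>: semigroup law and short-time Taylor bounds\<close>

section \<open>Exponential of a linear operator\<close>

text \<open>\<open>X\<close> is given only as a family of paths, one for each \<open>x\<close> and
  \<open>\<omega>\<close>: joint measurability, the Markov property and the moment bound all have to
  be produced, and the Euler scheme is their common source. Everything crosses the mesh limit
  through continuous test functions, so each discrete estimate must come with constants independent
  of the mesh. This shapes the scheme: the exact flow closes every step, so the decay of
  \<open>V\<close> is inherited at a rate proportional to \<open>h\<close>, and the control is the
  exact adjoint of the discrete propagation. By this adjointness the stochastic integral in the
  Cameron-Martin density is \<open>v\<close> tested against the end value of the linear noise, and
  bounding one random vector bounds the density. The parameter \<open>v\<close> lives in the state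
  space: for a fixed good noise path the end point is a map of R^d into itself, which is where
  volumes can be compared. (G) gives \<open>a <= 1/2\<close>, hence
  \<open>norm (F x) <= e * norm x + C\<close> for every \<open>e > 0\<close>; the freedom in
  \<open>e\<close> is spent against the dissipation of \<open>V\<close> and against the lower bound
  of the Gramian.\<close>

definition opexp :: "('a::euclidean_space \<Rightarrow> 'a) \<Rightarrow> real \<Rightarrow> 'a \<Rightarrow> 'a" where
  "opexp T s x = (\<Sum>k. (s ^ k / fact k) *\<^sub>R (T ^^ k) x)"

lemma linear_funpow:
  assumes "linear (T :: 'a::real_vector \<Rightarrow> 'a)"
  shows "linear (T ^^ k)"
proof (induction k)
  case 0
  show ?case by (simp add: linear_id[unfolded id_def] id_def)
next
  case (Suc k)
  then show ?case using linear_compose[OF Suc assms] by (simp add: o_def)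
qed

lemma norm_funpow_le:
  fixes T :: "'a::real_normed_vector \<Rightarrow> 'a"
  assumes "\<And>x. norm (T x) \<le> K * norm x" "0 \<le> K"
  shows "norm ((T ^^ k) x) \<le> K ^ k * norm x"
proof (induction k)
  case (Suc k)
  have "norm ((T ^^ Suc k) x) \<le> K * norm ((T ^^ k) x)" using assms(1) by simp
  also have "\<dots> \<le> K * (K ^ k * norm x)" by (intro mult_left_mono Suc assms)
  finally show ?case by simp
qed simp

lemma linear_norm_bound:
  fixes T :: "'a::euclidean_space \<Rightarrow> 'b::real_normed_vector"
  assumes "linear T"
  obtains K where "1 \<le> K" "\<And>x. norm (T x) \<le> K * norm x"
proof -
  obtain K where K: "\<And>x. norm (T x) \<le> norm x * K"
    using assms linear_conv_bounded_linear bounded_linear.bounded by blast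
  have "norm (T x) \<le> max 1 K * norm x" for x
    using K[of x] mult_left_mono[of K "max 1 K" "norm x"] by (simp add: mult.commute)
  then show ?thesis using that[of "max 1 K"] by simp
qed

text \<open>Kept abstract because the flow is needed on \<open>real^'d\<close> and also on
  \<open>complex^'d\<close>, where the spectral argument takes place. A bound of at least 1 keeps
  step sizes such as \<open>1 / (4 * K)\<close> positive for every operator.\<close>

locale linop =
  fixes T :: "'a::euclidean_space \<Rightarrow> 'a" and K :: real
  assumes lin: "linear T" and K1: "1 \<le> K" and bnd: "\<And>x. norm (T x) \<le> K * norm x"
begin

lemma K0: "0 \<le> K" using K1 by simp

lemma summable_norm_opexp: "summable (\<lambda>k. norm ((s ^ k / fact k) *\<^sub>R (T ^^ k) x))"
proof (rule summable_comparison_test')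
  show "summable (\<lambda>k. ((\<bar>s\<bar> * K) ^ k / fact k) * norm x)"
    using summable_exp[of "\<bar>s\<bar> * K"] by (intro summable_mult2) (simp add: field_simps)
  show "norm (norm ((s ^ k / fact k) *\<^sub>R (T ^^ k) x)) \<le> ((\<bar>s\<bar> * K) ^ k / fact k) * norm x" for k
    using mult_left_mono[OF norm_funpow_le[OF bnd K0, of k x], of "\<bar>s\<bar> ^ k / fact k"]
    by (simp add: power_abs power_mult_distrib field_simps)
qed

lemma summable_opexp: "summable (\<lambda>k. (s ^ k / fact k) *\<^sub>R (T ^^ k) x)"
  by (rule summable_norm_cancel[OF summable_norm_opexp])

lemma opexp_add: "opexp T s (x + y) = opexp T s x + opexp T s y"
  unfolding opexp_def
  by (subst suminf_add[OF summable_opexp summable_opexp])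
    (simp add: linear_add[OF linear_funpow[OF lin]] scaleR_add_right)

lemma opexp_scale: "opexp T s (c *\<^sub>R x) = c *\<^sub>R opexp T s x"
  unfolding opexp_def
  by (subst suminf_scaleR_right[OF summable_opexp])
    (simp add: linear_cmul[OF linear_funpow[OF lin]] mult.commute)

lemma linear_opexp: "linear (opexp T s)"
  by (intro linearI opexp_add opexp_scale)

lemma opexp_0 [simp]: "opexp T 0 x = x"
proof -
  have "(\<lambda>k. (0 ^ k / fact k) *\<^sub>R (T ^^ k) x) sums (\<Sum>k\<in>{0}. (0 ^ k / fact k) *\<^sub>R (T ^^ k) x)"
    by (rule sums_finite) auto
  then show ?thesis unfolding opexp_def by (simp add: sums_iff)
qed

lemma norm_opexp_le: "norm (opexp T s x) \<le> exp (K * \<bar>s\<bar>) * norm x"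
proof -
  have "norm (opexp T s x) \<le> (\<Sum>k. norm ((s ^ k / fact k) *\<^sub>R (T ^^ k) x))"
    unfolding opexp_def by (rule summable_norm[OF summable_norm_opexp])
  also have "\<dots> \<le> (\<Sum>k. ((K * \<bar>s\<bar>) ^ k /\<^sub>R fact k) * norm x)"
  proof (rule suminf_le[OF _ summable_norm_opexp])
    show "norm ((s ^ k / fact k) *\<^sub>R (T ^^ k) x) \<le> ((K * \<bar>s\<bar>) ^ k /\<^sub>R fact k) * norm x" for k
      using mult_left_mono[OF norm_funpow_le[OF bnd K0, of k x], of "\<bar>s\<bar> ^ k / fact k"]
      by (simp add: power_abs power_mult_distrib field_simps)
    show "summable (\<lambda>k. ((K * \<bar>s\<bar>) ^ k /\<^sub>R fact k) * norm x)"
      by (intro summable_mult2 summable_exp_generic)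
  qed
  also have "\<dots> = exp (K * \<bar>s\<bar>) * norm x"
    unfolding exp_def by (intro suminf_mult2[symmetric] summable_exp_generic)
  finally show ?thesis .
qed

lemma opexp_comm: "opexp T s (T x) = T (opexp T s x)"
proof -
  have "T (opexp T s x) = (\<Sum>k. T ((s ^ k / fact k) *\<^sub>R (T ^^ k) x))"
    unfolding opexp_def using lin linear_conv_bounded_linear
    by (intro bounded_linear.suminf[OF _ summable_opexp]) auto
  then show ?thesis unfolding opexp_def by (simp add: linear_cmul[OF lin] funpow_swap1)
qed

text \<open>Each coordinate is an everywhere convergent scalar power series in \<open>s\<close>, so
  it may be differentiated termwise; the coefficient shift \<open>diffs\<close> amounts to one
  application of \<open>T\<close>.\<close>

lemma has_vector_derivative_opexp:
  "((\<lambda>s. opexp T s x) has_vector_derivative opexp T s (T x)) (at s within S)"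
proof -
  have "((\<lambda>s. opexp T s x) has_derivative (\<lambda>h. h *\<^sub>R opexp T s (T x))) (at s within S)"
  proof (subst has_derivative_componentwise_within, intro ballI)
    fix b :: 'a assume "b \<in> Basis"
    define c where "c k = ((T ^^ k) x \<bullet> b) / fact k" for k
    have eq: "opexp T r y \<bullet> b = (\<Sum>k. (((T ^^ k) y \<bullet> b) / fact k) * r ^ k)" for r y
      unfolding opexp_def
      by (subst bounded_linear.suminf[OF bounded_linear_inner_left summable_opexp]) (simp add: field_simps)
    have sm: "summable (\<lambda>k. c k * r ^ k)" for r
      using bounded_linear.summable[OF bounded_linear_inner_left[of b] summable_opexp[of r x]]
      by (simp add: c_def field_simps)
    have "((\<lambda>r. \<Sum>k. c k * r ^ k) has_field_derivative (\<Sum>k. diffs c k * s ^ k)) (at s)"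
      by (rule termdiffs_strong_converges_everywhere[OF sm])
    moreover have "diffs c k = ((T ^^ k) (T x) \<bullet> b) / fact k" for k
      by (simp add: diffs_def c_def funpow_swap1 divide_simps)
    ultimately have "((\<lambda>r. opexp T r x \<bullet> b) has_field_derivative (opexp T s (T x) \<bullet> b)) (at s)"
      by (simp add: eq c_def)
    then show "((\<lambda>r. opexp T r x \<bullet> b) has_derivative (\<lambda>h. (h *\<^sub>R opexp T s (T x)) \<bullet> b)) (at s within S)"
      by (simp add: has_field_derivative_def mult_commute_abs has_derivative_at_withinI)
  qed
  then show ?thesis by (simp add: has_vector_derivative_def)
qed

lemma continuous_on_opexp [continuous_intros]: "continuous_on S (\<lambda>s. opexp T s x)"
  by (rule continuous_on_vector_derivative[OF has_vector_derivative_opexp])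

text \<open>Gronwall in energy form: the weight \<open>exp (-2 * K * s)\<close> makes the squared
  norm of a solution nonincreasing. The argument runs forward in time, hence
  \<open>0 <= s\<close>.\<close>

lemma linear_ode_zero:
  assumes f: "\<And>s. (f has_vector_derivative T (f s)) (at s)" and "f 0 = 0" "0 \<le> s"
  shows "f s = 0"
proof -
  let ?g = "\<lambda>s. exp (-2 * K * s) * (f s \<bullet> f s)"
  have "?g s \<le> ?g 0"
  proof (rule DERIV_nonpos_imp_nonincreasing[OF \<open>0 \<le> s\<close>])
    fix r
    have "((\<lambda>r. f r \<bullet> f r) has_derivative (\<lambda>h. f r \<bullet> (h *\<^sub>R T (f r)) + (h *\<^sub>R T (f r)) \<bullet> f r)) (at r)"
      using f[of r] unfolding has_vector_derivative_def by (intro has_derivative_inner)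
    then have d: "((\<lambda>r. f r \<bullet> f r) has_field_derivative 2 * (f r \<bullet> T (f r))) (at r)"
      by (simp add: has_field_derivative_def inner_commute mult_commute_abs mult.left_commute)
    have "(?g has_field_derivative (exp (-2 * K * r) * (-2 * K)) * (f r \<bullet> f r) + exp (-2 * K * r) * (2 * (f r \<bullet> T (f r)))) (at r)"
      by (rule derivative_eq_intros d refl | simp)+
    moreover have "f r \<bullet> T (f r) \<le> K * (f r \<bullet> f r)"
    proof -
      have "f r \<bullet> T (f r) \<le> norm (f r) * norm (T (f r))" by (rule norm_cauchy_schwarz)
      also have "\<dots> \<le> norm (f r) * (K * norm (f r))" by (intro mult_left_mono bnd) simp
      finally show ?thesis by (simp add: dot_square_norm power2_eq_square mult_ac)
    qed
    then have "exp (-2 * K * r) * (f r \<bullet> T (f r)) \<le> exp (-2 * K * r) * (K * (f r \<bullet> f r))"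
      by (intro mult_left_mono) auto
    ultimately show "\<exists>y. (?g has_field_derivative y) (at r) \<and> y \<le> 0"
      by (intro exI[of _ "(exp (-2 * K * r) * (-2 * K)) * (f r \<bullet> f r) + exp (-2 * K * r) * (2 * (f r \<bullet> T (f r)))"])
        (auto simp: algebra_simps)
  qed
  then have "exp (-2 * K * s) * (f s \<bullet> f s) \<le> 0" using assms by simp
  then have "f s \<bullet> f s \<le> 0" by (simp add: mult_le_0_iff)
  then show ?thesis by (metis inner_gt_zero_iff not_less)
qed

text \<open>Both sides solve the same linear equation in \<open>s\<close> and agree at
  \<open>s = 0\<close>.\<close>

lemma opexp_plus:
  assumes "0 \<le> s"
  shows "opexp T (s + t) x = opexp T s (opexp T t x)"
proof -
  let ?f = "\<lambda>s. opexp T (s + t) x - opexp T s (opexp T t x)"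
  have "((\<lambda>s. opexp T (s + t) x) has_vector_derivative opexp T (s + t) (T x)) (at s)" for s
  proof -
    have "((\<lambda>s. s + t) has_vector_derivative 1) (at s)"
      by (auto intro!: derivative_eq_intros)
    from vector_diff_chain_at[OF this has_vector_derivative_opexp] show ?thesis by (simp add: o_def)
  qed
  then have "(?f has_vector_derivative T (?f s)) (at s)" for s
    using has_vector_derivative_diff[OF _ has_vector_derivative_opexp[of "opexp T t x" s UNIV]]
    by (simp add: opexp_comm linear_diff[OF lin])
  from linear_ode_zero[OF this _ assms] show ?thesis by simp
qed

lemma opexp_first_order:
  assumes "0 \<le> h"
  shows "norm (opexp T h x - x) \<le> K * h * exp (K * h) * norm x"
proof -
  have "norm (opexp T h x - opexp T 0 x) \<le> (exp (K * h) * (K * norm x)) * norm (h - 0)"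
  proof (rule differentiable_bound[of "{0..h}" "\<lambda>s. opexp T s x" "\<lambda>s r. r *\<^sub>R opexp T s (T x)"])
    show "((\<lambda>s. opexp T s x) has_derivative (\<lambda>r. r *\<^sub>R opexp T s (T x))) (at s within {0..h})" for s
      using has_vector_derivative_opexp by (simp add: has_vector_derivative_def)
    show "onorm (\<lambda>r. r *\<^sub>R opexp T s (T x)) \<le> exp (K * h) * (K * norm x)" if "s \<in> {0..h}" for s
    proof (rule onorm_le)
      fix r
      have "norm (opexp T s (T x)) \<le> exp (K * \<bar>s\<bar>) * norm (T x)" by (rule norm_opexp_le)
      also have "\<dots> \<le> exp (K * h) * (K * norm x)"
        using that K0 by (intro mult_mono bnd) (auto intro: mult_left_mono)
      finally show "norm (r *\<^sub>R opexp T s (T x)) \<le> exp (K * h) * (K * norm x) * norm r"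
        by (simp add: mult.commute mult_left_mono)
    qed
  qed (use assms in auto)
  then show ?thesis using assms by (simp add: mult_ac)
qed

text \<open>The derivative of the remainder is \<open>opexp T s (T x) - T x\<close>, which the
  first-order bound makes O(s); the mean value inequality supplies the second factor
  \<open>h\<close>.\<close>

lemma opexp_second_order:
  assumes "0 \<le> h"
  shows "norm (opexp T h x - x - h *\<^sub>R T x) \<le> K\<^sup>2 * h\<^sup>2 * exp (K * h) * norm x"
proof -
  have "norm ((opexp T h x - h *\<^sub>R T x) - (opexp T 0 x - 0 *\<^sub>R T x)) \<le> (K * h * exp (K * h) * (K * norm x)) * norm (h - 0)"
  proof (rule differentiable_bound[of "{0..h}" "\<lambda>s. opexp T s x - s *\<^sub>R T x" "\<lambda>s r. r *\<^sub>R (opexp T s (T x) - T x)"])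
    show "((\<lambda>s. opexp T s x - s *\<^sub>R T x) has_derivative (\<lambda>r. r *\<^sub>R (opexp T s (T x) - T x))) (at s within {0..h})" for s
    proof -
      have "((\<lambda>s. s *\<^sub>R T x) has_vector_derivative T x) (at s within {0..h})"
        by (auto intro!: derivative_eq_intros simp: has_vector_derivative_def)
      from has_vector_derivative_diff[OF has_vector_derivative_opexp this] show ?thesis
        by (simp add: has_vector_derivative_def)
    qed
    show "onorm (\<lambda>r. r *\<^sub>R (opexp T s (T x) - T x)) \<le> K * h * exp (K * h) * (K * norm x)" if "s \<in> {0..h}" for s
    proof (rule onorm_le)
      fix r
      have "norm (opexp T s (T x) - T x) \<le> K * s * exp (K * s) * norm (T x)"
        using that by (intro opexp_first_order) auto
      also have "\<dots> \<le> K * h * exp (K * h) * (K * norm x)"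
        using that K0 assms by (intro mult_mono bnd) (auto intro: mult_left_mono)
      finally show "norm (r *\<^sub>R (opexp T s (T x) - T x)) \<le> K * h * exp (K * h) * (K * norm x) * norm r"
        by (simp add: mult.commute mult_left_mono)
    qed
  qed (use assms in auto)
  then show ?thesis using assms by (simp add: mult_ac power2_eq_square algebra_simps)
qed

end

section \<open>From eigenvalues with negative real part to uniform exponential decay of the
  flow\<close>

section \<open>Hurwitz stability\<close>

text \<open>Constant and rate may depend on the function; uniformity over all directions is
  recovered at the end from a finite basis.\<close>

definition exp_decay :: "(real \<Rightarrow> 'a::real_normed_vector) \<Rightarrow> bool" where
  "exp_decay y \<longleftrightarrow> (\<exists>C c. 0 \<le> C \<and> 0 < c \<and> (\<forall>s\<ge>0. norm (y s) \<le> C * exp (- c * s)))"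

lemma exp_decay_le:
  assumes "exp_decay y" "\<And>s. 0 \<le> s \<Longrightarrow> norm (z s) \<le> M * norm (y s)" "0 \<le> M"
  shows "exp_decay z"
proof -
  obtain C c where C: "0 \<le> C" "0 < c" "\<And>s. 0 \<le> s \<Longrightarrow> norm (y s) \<le> C * exp (- c * s)"
    using assms(1) unfolding exp_decay_def by blast
  have "norm (z s) \<le> (M * C) * exp (- c * s)" if "0 \<le> s" for s
    using order_trans[OF assms(2)[OF that] mult_left_mono[OF C(3)[OF that] assms(3)]] by (simp add: mult_ac)
  then show ?thesis unfolding exp_decay_def using C assms(3)
    by (intro exI[of _ "M * C"] exI[of _ c]) simp
qed

lemma exp_decay_sum:
  assumes "finite I" "\<And>i. i \<in> I \<Longrightarrow> exp_decay (y i)"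
  shows "exp_decay (\<lambda>s. \<Sum>i\<in>I. norm (y i s))"
  using assms
proof (induction I rule: finite_induct)
  case empty
  show ?case unfolding exp_decay_def by (rule exI[of _ 0], rule exI[of _ 1]) simp
next
  case (insert j I)
  have "exp_decay (\<lambda>s. \<Sum>i\<in>I. norm (y i s))" "exp_decay (y j)"
    using insert by simp_all
  then obtain C c where C: "0 \<le> C" "0 < c" "\<And>s. 0 \<le> s \<Longrightarrow> norm (\<Sum>i\<in>I. norm (y i s)) \<le> C * exp (- c * s)"
    unfolding exp_decay_def by blast
  obtain C' c' where C': "0 \<le> C'" "0 < c'" "\<And>s. 0 \<le> s \<Longrightarrow> norm (y j s) \<le> C' * exp (- c' * s)"
    using \<open>exp_decay (y j)\<close> unfolding exp_decay_def by blast
  have "norm (\<Sum>i\<in>insert j I. norm (y i s)) \<le> (C + C') * exp (- min c c' * s)" if "0 \<le> s" for s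
  proof -
    have "norm (\<Sum>i\<in>insert j I. norm (y i s)) \<le> norm (y j s) + norm (\<Sum>i\<in>I. norm (y i s))"
      using insert by (simp add: sum_nonneg)
    also have "\<dots> \<le> C' * exp (- c' * s) + C * exp (- c * s)" using C C' that by (intro add_mono) auto
    also have "\<dots> \<le> C' * exp (- min c c' * s) + C * exp (- min c c' * s)"
      using C C' that by (intro add_mono mult_left_mono) (auto intro: mult_right_mono)
    finally show ?thesis by (simp add: algebra_simps)
  qed
  then show ?case unfolding exp_decay_def using C C'
    by (intro exI[of _ "C + C'"] exI[of _ "min c c'"]) simp
qed

text \<open>Variation of constants: \<open>exp (- l s) g\<close> has derivative
  \<open>exp (- l s) w\<close>, whose norm is at most the derivative of the explicit comparison
  function \<open>\<phi>\<close>.\<close>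

lemma exp_decay_scalar_ode:
  fixes g w :: "real \<Rightarrow> complex"
  assumes g: "\<And>s. (g has_vector_derivative (l * g s + w s)) (at s)"
    and w: "exp_decay w" and l: "Re l < 0"
  shows "exp_decay g"
proof -
  obtain C c where C: "0 \<le> C" "0 < c" "\<And>s. 0 \<le> s \<Longrightarrow> norm (w s) \<le> C * exp (- c * s)"
    using w unfolding exp_decay_def by blast
  define b where "b = - Re l"
  \<comment> \<open>A rate strictly below \<open>b\<close> excludes the resonance
    \<open>c = b\<close>, where a factor \<open>s\<close> would appear; a rate at most
    \<open>c\<close> is what the forcing allows.\<close>
  define e where "e = min c (b / 2)"
  have b: "0 < b" and e: "0 < e" "e \<le> c" "e < b" using l C by (auto simp: b_def e_def min_def)
  define \<phi> where "\<phi> s = C / (b - e) * exp ((b - e) * s)" for s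
  have bound: "norm (g s) \<le> (norm (g 0) + C / (b - e)) * exp (- e * s)" if s: "0 \<le> s" for s
  proof (cases "s = 0")
    case True
    then show ?thesis using C e by simp
  next
    case False
    then have s: "0 < s" using s by simp
    have "norm (exp (- l * of_real s) * g s - exp (- l * of_real 0) * g 0) \<le> \<phi> s - \<phi> 0"
    proof (rule differentiable_bound_general[OF s])
      have dg: "((\<lambda>s. exp (- l * of_real s) * g s) has_vector_derivative exp (- l * of_real x) * w x) (at x)" for x
      proof -
        have "((\<lambda>s. exp (- l * of_real s)) has_vector_derivative (- l * exp (- l * of_real x))) (at x)"
          by (rule field_vector_diff_chain_at[where f = "\<lambda>s. - l * of_real s" and g = exp, unfolded o_def])
            (auto intro!: derivative_eq_intros has_vector_derivative_mult_right)
        from has_vector_derivative_mult[OF this g] show ?thesis by (simp add: algebra_simps)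
      qed
      have dphi: "(\<phi> has_vector_derivative C * exp ((b - e) * x)) (at x)" for x
        unfolding \<phi>_def has_real_derivative_iff_has_vector_derivative[symmetric]
        using e by (auto intro!: derivative_eq_intros)
      show "continuous_on {0..s} \<phi>" unfolding \<phi>_def by (intro continuous_intros)
      show "continuous_on {0..s} (\<lambda>s. exp (- l * of_real s) * g s)"
        by (rule continuous_on_vector_derivative[OF has_vector_derivative_at_within[OF dg]])
      show "((\<lambda>s. exp (- l * of_real s) * g s) has_vector_derivative exp (- l * of_real x) * w x) (at x)"
        "(\<phi> has_vector_derivative C * exp ((b - e) * x)) (at x)" for x by fact+
      fix x assume x: "0 < x" "x < s"
      have "norm (exp (- l * of_real x) * w x) = exp (b * x) * norm (w x)"
        by (simp add: norm_mult b_def)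
      also have "\<dots> \<le> exp (b * x) * (C * exp (- e * x))"
      proof (intro mult_left_mono)
        have "norm (w x) \<le> C * exp (- c * x)" using C x by simp
        also have "\<dots> \<le> C * exp (- e * x)" using C e x by (intro mult_left_mono) (auto intro: mult_right_mono)
        finally show "norm (w x) \<le> C * exp (- e * x)" .
      qed simp
      finally show "norm (exp (- l * of_real x) * w x) \<le> C * exp ((b - e) * x)"
        using mult_exp_exp[of "b * x" "- e * x"] by (simp add: algebra_simps)
    qed
    moreover have "0 \<le> \<phi> 0" using C e by (simp add: \<phi>_def)
    ultimately have "norm (exp (- l * of_real s) * g s) \<le> norm (g 0) + \<phi> s"
      using norm_triangle_ineq2[of "exp (- l * of_real s) * g s" "g 0"] by simp
    then have "exp (b * s) * norm (g s) \<le> norm (g 0) + \<phi> s"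
      by (simp add: norm_mult b_def)
    then have "exp (- b * s) * (exp (b * s) * norm (g s)) \<le> exp (- b * s) * (norm (g 0) + \<phi> s)"
      by (intro mult_left_mono) auto
    then have "exp (- b * s + b * s) * norm (g s) \<le> norm (g 0) * exp (- b * s) + C / (b - e) * exp (- b * s + (b - e) * s)"
      unfolding \<phi>_def exp_add by (simp only: mult_ac distrib_left)
    then have "norm (g s) \<le> norm (g 0) * exp (- b * s) + C / (b - e) * exp (- e * s)"
      by (simp add: left_diff_distrib)
    also have "\<dots> \<le> norm (g 0) * exp (- e * s) + C / (b - e) * exp (- e * s)"
      using e s C by (intro add_mono mult_left_mono) auto
    finally show ?thesis by (simp add: algebra_simps)
  qed
  show ?thesis unfolding exp_decay_def
    using bound e C by (intro exI[of _ "norm (g 0) + C / (b - e)"] exI[of _ e]) simp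
qed

text \<open>There is one vector more than the dimension. Repeated values are treated apart, since
  linear dependence of a set does not see multiplicities.\<close>

lemma linear_relation_exists:
  fixes f :: "nat \<Rightarrow> 'a::euclidean_space"
  shows "\<exists>u. (\<exists>k\<le>DIM('a). u k \<noteq> 0) \<and> (\<Sum>k\<le>DIM('a). u k *\<^sub>R f k) = 0"
proof (cases "inj_on f {..DIM('a)}")
  case True
  then have "dependent (f ` {..DIM('a)})"
    by (intro dependent_biggerset) (simp add: card_image)
  then obtain u where u: "\<exists>v\<in>f ` {..DIM('a)}. u v \<noteq> 0" "(\<Sum>v\<in>f ` {..DIM('a)}. u v *\<^sub>R v) = 0"
    using dependent_finite[of "f ` {..DIM('a)}"] by auto
  then show ?thesis
    by (intro exI[of _ "u \<circ> f"]) (auto simp: sum.reindex[OF True])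
next
  case False
  then obtain k l where kl: "k \<le> DIM('a)" "l \<le> DIM('a)" "k \<noteq> l" "f k = f l"
    by (auto simp: inj_on_def)
  have "(\<Sum>i\<le>DIM('a). (if i = k then 1 else if i = l then - 1 else 0) *\<^sub>R f i)
      = (\<Sum>i\<le>DIM('a). (if i = k then f i else 0) + (if i = l then - f i else 0))"
    using kl by (intro sum.cong) auto
  also have "\<dots> = 0" using kl by (simp add: sum.distrib)
  finally show ?thesis using kl
    by (intro exI[of _ "\<lambda>i. if i = k then 1 else if i = l then - 1 else 0"]) auto
qed

lemma scaleR_vec_complex: "r *\<^sub>R v = complex_of_real r *s (v :: complex^'d)"
  by (simp add: vec_eq_iff scaleR_conv_of_real[where 'a = complex])

lemma bounded_linear_vector_scalar_mult: "bounded_linear (\<lambda>v::complex^'d. c *s v)"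
  by (subst linear_conv_bounded_linear[symmetric])
    (auto intro!: linearI simp: vec_eq_iff algebra_simps)

text \<open>The vector p(T)v.\<close>

definition poly_app :: "(complex^'d \<Rightarrow> complex^'d) \<Rightarrow> complex poly \<Rightarrow> complex^'d \<Rightarrow> complex^'d" where
  "poly_app T p v = (\<Sum>i\<le>degree p. coeff p i *s (T ^^ i) v)"

lemma poly_app_bound:
  assumes "degree p \<le> n"
  shows "poly_app T p v = (\<Sum>i\<le>n. coeff p i *s (T ^^ i) v)"
  unfolding poly_app_def
  by (rule sum.mono_neutral_left) (use assms in \<open>auto simp: coeff_eq_0\<close>)

lemma poly_app_smult_add:
  "poly_app T (smult c p + q) v = c *s poly_app T p v + poly_app T q v"
proof -
  let ?n = "max (degree p) (degree q)"
  have "degree (smult c p + q) \<le> ?n"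
    by (intro degree_add_le) (auto intro: order_trans[OF degree_smult_le])
  then show ?thesis
    by (subst (1 2 3) poly_app_bound[of _ ?n])
      (auto simp: vec.scale_sum_right sum.distrib[symmetric] vec.scale_left_distrib)
qed

lemma poly_app_pCons: "poly_app T (pCons a p) v = a *s v + poly_app T p (T v)"
  by (subst poly_app_bound[of "pCons a p" "Suc (degree p)"])
    (auto simp: degree_pCons_le poly_app_def sum.atMost_Suc_shift funpow_swap1 simp del: sum.atMost_Suc)

text \<open>\<open>linear\<close> refers to real scalars, so homogeneity over the complex numbers is
  a separate assumption.\<close>

locale complex_linop = linop T K for T :: "complex^'d \<Rightarrow> complex^'d" and K +
  assumes cscale: "\<And>c v. T (c *s v) = c *s T v"
begin

lemma funpow_cscale: "(T ^^ k) (c *s v) = c *s (T ^^ k) v"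
  by (induction k) (auto simp: cscale)

lemma opexp_cscale: "opexp T s (c *s v) = c *s opexp T s v"
  unfolding opexp_def
  by (subst bounded_linear.suminf[OF bounded_linear_vector_scalar_mult summable_opexp])
    (simp add: funpow_cscale scaleR_vec_complex mult_ac)

lemma poly_app_shift: "poly_app T p (T v - l *s v) = T (poly_app T p v) - l *s poly_app T p v"
proof -
  have "poly_app T p (T v - l *s v) = (\<Sum>i\<le>degree p. coeff p i *s (T ((T ^^ i) v)) - coeff p i *s (l *s (T ^^ i) v))"
    unfolding poly_app_def
    by (simp add: linear_diff[OF linear_funpow[OF lin]] funpow_cscale funpow_swap1 vec.scale_right_diff_distrib)
  also have "\<dots> = T (poly_app T p v) - l *s poly_app T p v"
    unfolding poly_app_def
    by (simp add: linear_sum[OF lin] cscale sum_subtractf vec.scale_sum_right mult.commute)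
  finally show ?thesis .
qed

text \<open>With \<open>w = T v - l *s v\<close>, each coordinate of the flow of \<open>v\<close>
  solves a scalar equation with coefficient \<open>l\<close> and forcing given by the flow of
  \<open>w\<close>, so decay passes from \<open>w\<close> to \<open>v\<close>.\<close>

lemma exp_decay_opexp_step:
  assumes "exp_decay (\<lambda>s. opexp T s (T v - l *s v))" "Re l < 0"
  shows "exp_decay (\<lambda>s. opexp T s v)"
proof -
  let ?w = "T v - l *s v"
  have "exp_decay (\<lambda>s. opexp T s v $ i)" for i
  proof (rule exp_decay_scalar_ode[OF _ _ assms(2)])
    show "exp_decay (\<lambda>s. opexp T s ?w $ i)"
      by (rule exp_decay_le[OF assms(1), of _ 1]) (simp_all add: component_le_norm_cart Finite_Cartesian_Product.norm_nth_le)
    have "opexp T s (T v) = opexp T s (l *s v + ?w)" for s by simp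
    then have "opexp T s (T v) $ i = l * opexp T s v $ i + opexp T s ?w $ i" for s
      by (simp only: opexp_add opexp_cscale) simp
    moreover have "((\<lambda>s. opexp T s v $ i) has_vector_derivative opexp T s (T v) $ i) (at s)" for s
      by (rule bounded_linear.has_vector_derivative[OF bounded_linear_vec_nth has_vector_derivative_opexp])
    ultimately show "((\<lambda>s. opexp T s v $ i) has_vector_derivative l * opexp T s v $ i + opexp T s ?w $ i) (at s)" for s
      by simp
  qed
  then have "exp_decay (\<lambda>s. \<Sum>i\<in>UNIV. norm (opexp T s v $ i))" by (intro exp_decay_sum) auto
  then show ?thesis
    by (rule exp_decay_le[of _ _ 1]) (auto simp: norm_vec_def intro: order_trans[OF L2_set_le_sum])
qed

text \<open>Split off a root \<open>l\<close> of the annihilating polynomial: either it is an eigenvalue, hence stable,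
  or the remaining factor already annihilates \<open>v\<close>.\<close>
lemma exp_decay_opexp_poly:
  assumes eig: "\<And>l v. v \<noteq> 0 \<Longrightarrow> T v = l *s v \<Longrightarrow> Re l < 0"
  shows "degree p = n \<Longrightarrow> p \<noteq> 0 \<Longrightarrow> poly_app T p v = 0 \<Longrightarrow> exp_decay (\<lambda>s. opexp T s v)"
proof (induction n arbitrary: p v)
  case 0
  obtain a where a: "p = [:a:]" using degree_eq_zeroE[OF 0(1)] by blast
  then have "v = 0" using 0 by (simp add: poly_app_def)
  then show ?case
    unfolding exp_decay_def by (intro exI[of _ 0] exI[of _ "1::real"]) (simp add: linear_0[OF linear_opexp])
next
  case (Suc n)
  have "\<not> constant (poly p)" using Suc.prems by (simp add: constant_degree)
  then obtain l where "poly p l = 0" using fundamental_theorem_of_algebra by blast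
  then obtain q where q: "p = [:- l, 1:] * q" by (auto simp: poly_eq_0_iff_dvd)
  then have q0: "q \<noteq> 0" using Suc.prems by auto
  have dq: "degree q = n" using Suc.prems(1) q0 unfolding q by (subst (asm) degree_mult_eq) auto
  have "p = smult (- l) q + pCons 0 q" unfolding q by simp
  then have "poly_app T p v = - l *s poly_app T q v + poly_app T q (T v)"
    using poly_app_smult_add[of T "- l" q "pCons 0 q" v] by (simp only: poly_app_pCons) simp
  \<comment> \<open>The factorisation p = (X - l) q is read in both orders: q(T) kills (T - l)v, and
    (T - l) kills q(T)v.\<close>
  then have eq: "poly_app T q (T v - l *s v) = 0" "T (poly_app T q v) = l *s poly_app T q v"
    using Suc.prems(3) poly_app_shift[of q v l] poly_app_shift[of q v 0] by simp_all
  show ?case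
  proof (cases "poly_app T q v = 0")
    case True
    then show ?thesis by (rule Suc.IH[OF dq q0])
  next
    case False
    then have "Re l < 0" using eig eq(2) by blast
    then show ?thesis using exp_decay_opexp_step[OF Suc.IH[OF dq q0 eq(1)]] by blast
  qed
qed

text \<open>The iterates of \<open>T\<close> on \<open>v\<close> up to the real dimension of
  \<open>complex^'d\<close> are linearly dependent, which yields a nonzero polynomial annihilating
  \<open>v\<close>.\<close>

lemma exp_decay_opexp:
  assumes eig: "\<And>l v. v \<noteq> 0 \<Longrightarrow> T v = l *s v \<Longrightarrow> Re l < 0"
  shows "exp_decay (\<lambda>s. opexp T s v)"
proof -
  let ?N = "DIM(complex^'d)"
  obtain u where u: "\<exists>k\<le>?N. u k \<noteq> 0" "(\<Sum>k\<le>?N. u k *\<^sub>R (T ^^ k) v) = 0"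
    using linear_relation_exists[of "\<lambda>k. (T ^^ k) v"] by blast
  define p where "p = (\<Sum>k\<le>?N. monom (complex_of_real (u k)) k)"
  have c: "coeff p i = (if i \<le> ?N then of_real (u i) else 0)" for i
    by (simp add: p_def coeff_sum)
  have "degree p \<le> ?N" by (rule degree_le) (simp add: c)
  then have "poly_app T p v = (\<Sum>k\<le>?N. u k *\<^sub>R (T ^^ k) v)"
    by (simp add: poly_app_bound[of _ ?N] c scaleR_vec_complex)
  moreover have "p \<noteq> 0" using u(1) c by (metis coeff_0 of_real_eq_0_iff)
  ultimately show ?thesis using exp_decay_opexp_poly[OF eig refl] u(2) by simp
qed

end

definition cvec :: "real^'d \<Rightarrow> complex^'d" where
  "cvec x = (\<chi> i. complex_of_real (x $ i))"

lemma norm_cvec: "norm (cvec x) = norm x"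
  by (simp add: cvec_def norm_vec_def)

lemma bounded_linear_cvec: "bounded_linear cvec"
  by (subst linear_conv_bounded_linear[symmetric])
    (auto intro!: linearI simp: cvec_def vec_eq_iff scaleR_vec_complex)

lemma cmatrix_cvec:
  assumes "linear A"
  shows "cmatrix A *v cvec x = cvec (A x)"
proof -
  have "A x = matrix A *v x" using matrix_works[OF assms[folded linear_matrix_vector_mul_eq]] by simp
  then show ?thesis
    by (simp add: cmatrix_def cvec_def matrix_vector_mult_def vec_eq_iff)
qed

text \<open>\<open>cvec\<close> is isometric and intertwines \<open>A\<close> with its
  complexification, so the decay found there descends to \<open>A\<close>. Summing the bounds over a
  basis makes constant and rate uniform in \<open>x\<close>.\<close>

lemma hurwitz_imp_exp_decay:
  fixes A :: "real^'d \<Rightarrow> real^'d"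
  assumes A: "linear A" and D: "hurwitz A"
  shows "\<exists>C c. 0 \<le> C \<and> 0 < c \<and> (\<forall>s\<ge>0. \<forall>x. norm (opexp A s x) \<le> C * exp (- c * s) * norm x)"
proof -
  let ?T = "\<lambda>v. cmatrix A *v v"
  have linT: "linear ?T"
    by (intro linearI)
      (auto simp: matrix_vector_right_distrib scaleR_vec_complex vec_eq_iff matrix_vector_mult_def
        sum_distrib_left mult.left_commute distrib_left sum.distrib)
  obtain K where "1 \<le> K" "\<And>v. norm (?T v) \<le> K * norm v" using linear_norm_bound[OF linT] by blast
  then interpret C: complex_linop ?T K
    by (intro complex_linop.intro linop.intro linT complex_linop_axioms.intro)
      (auto simp: vec_eq_iff matrix_vector_mult_def sum_distrib_left mult.left_commute)
  obtain K' where "1 \<le> K'" "\<And>v. norm (A v) \<le> K' * norm v" using linear_norm_bound[OF A] by blast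
  then interpret R: linop A K' by (intro linop.intro A) auto
  have "(?T ^^ k) (cvec x) = cvec ((A ^^ k) x)" for k x
    by (induction k) (simp_all add: cmatrix_cvec[OF A])
  then have eq: "opexp ?T s (cvec x) = cvec (opexp A s x)" for s x
    unfolding opexp_def
    by (subst bounded_linear.suminf[OF bounded_linear_cvec R.summable_opexp])
      (simp add: linear_cmul[OF bounded_linear.linear[OF bounded_linear_cvec]])
  have "exp_decay (\<lambda>s. opexp ?T s v)" for v
    using D unfolding hurwitz_def by (intro C.exp_decay_opexp) auto
  then have ec: "exp_decay (\<lambda>s. cvec (opexp A s b))" for b
    unfolding eq[symmetric] .
  have "exp_decay (\<lambda>s. opexp A s b)" for b
    using exp_decay_le[OF ec[of b], of "\<lambda>s. opexp A s b" 1] by (simp add: norm_cvec)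
  then have "exp_decay (\<lambda>s. \<Sum>b\<in>Basis. norm (opexp A s b))"
    by (intro exp_decay_sum) auto
  then obtain C c where C: "0 \<le> C" "0 < c" "\<And>s. 0 \<le> s \<Longrightarrow> norm (\<Sum>b\<in>Basis. norm (opexp A s b)) \<le> C * exp (- c * s)"
    unfolding exp_decay_def by blast
  have "norm (opexp A s x) \<le> C * exp (- c * s) * norm x" if s: "0 \<le> s" for s x
  proof -
    have "opexp A s x = opexp A s (\<Sum>b\<in>Basis. (x \<bullet> b) *\<^sub>R b)" by (simp add: euclidean_representation)
    also have "\<dots> = (\<Sum>b\<in>Basis. (x \<bullet> b) *\<^sub>R opexp A s b)"
      by (simp add: linear_sum[OF R.linear_opexp] R.opexp_scale)
    also have "norm \<dots> \<le> (\<Sum>b\<in>Basis. norm x * norm (opexp A s b))"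
      by (intro sum_norm_le) (auto intro: mult_right_mono Basis_le_norm)
    also have "\<dots> = norm (\<Sum>b\<in>Basis. norm (opexp A s b)) * norm x"
      by (simp add: sum_distrib_left[symmetric] sum_nonneg mult.commute)
    also have "\<dots> \<le> C * exp (- c * s) * norm x" using C(3)[OF s] by (intro mult_right_mono) auto
    finally show ?thesis .
  qed
  then show ?thesis using C by blast
qed

section \<open>\<open>V\<close> as a quadratic form: equivalence with the squared norm, loss along
  the flow, drift\<close>

section \<open>The quadratic Lyapunov function\<close>

locale stable_linop = linop T K for T :: "'a::euclidean_space \<Rightarrow> 'a" and K +
  fixes C0 c0 :: real
  assumes C0: "0 \<le> C0" and c0: "0 < c0"
    and decay: "\<And>s x. 0 \<le> s \<Longrightarrow> norm (opexp T s x) \<le> C0 * exp (- c0 * s) * norm x"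
begin

text \<open>\<open>Vfun\<close> written with the Lebesgue integral, whose linearity, translation and
  comparison rules are used below; \<open>Vfun_eq_V\<close> identifies the two.\<close>

definition V :: "'a \<Rightarrow> real" where
  "V x = (\<integral>s. indicator {0..} s * (norm (opexp T s x))\<^sup>2 \<partial>lborel)"

text \<open>The symmetric bilinear form polarising \<open>V\<close>.\<close>

definition Q :: "'a \<Rightarrow> 'a \<Rightarrow> real" where
  "Q x y = (\<integral>s. indicator {0..} s * (opexp T s x \<bullet> opexp T s y) \<partial>lborel)"

lemma integrable_exp_half_line:
  assumes "0 < a"
  shows "integrable lborel (\<lambda>s. indicator {0..} s * exp (- a * s) :: real)"
proof -
  have "(\<lambda>s::real. exp (- a * s)) absolutely_integrable_on {0..}"
    using integrable_on_exp_minus_to_infinity[OF assms] by (intro nonnegative_absolutely_integrable_1) auto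
  then show ?thesis
    by (subst (asm) set_integrable_def) (simp add: integrable_completion)
qed

lemma opexp_measurable [measurable]: "(\<lambda>s. opexp T s x) \<in> borel_measurable borel"
  by (intro borel_measurable_continuous_onI continuous_intros)

lemma integrable_Q: "integrable lborel (\<lambda>s. indicator {0..} s * (opexp T s x \<bullet> opexp T s y))"
proof (rule Bochner_Integration.integrable_bound)
  show "integrable lborel (\<lambda>s. (C0\<^sup>2 * norm x * norm y) * (indicator {0..} s * exp (- (2 * c0) * s)))"
    by (intro integrable_mult_right integrable_exp_half_line) (simp add: c0)
  show "AE s in lborel. norm (indicator {0..} s * (opexp T s x \<bullet> opexp T s y))
      \<le> norm ((C0\<^sup>2 * norm x * norm y) * (indicator {0..} s * exp (- (2 * c0) * s)))"
  proof (rule AE_I2)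
    fix s :: real
    show "norm (indicator {0..} s * (opexp T s x \<bullet> opexp T s y))
      \<le> norm ((C0\<^sup>2 * norm x * norm y) * (indicator {0..} s * exp (- (2 * c0) * s)))"
    proof (cases "0 \<le> s")
      case True
      have "\<bar>opexp T s x \<bullet> opexp T s y\<bar> \<le> norm (opexp T s x) * norm (opexp T s y)"
        by (rule Cauchy_Schwarz_ineq2)
      also have "\<dots> \<le> (C0 * exp (- c0 * s) * norm x) * (C0 * exp (- c0 * s) * norm y)"
        using C0 by (intro mult_mono decay True) auto
      also have "\<dots> = (C0\<^sup>2 * norm x * norm y) * (exp (- c0 * s) * exp (- c0 * s))"
        by (simp add: power2_eq_square)
      also have "\<dots> = (C0\<^sup>2 * norm x * norm y) * exp (- (2 * c0) * s)"
        unfolding exp_add[symmetric] by (simp add: algebra_simps)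
      finally show ?thesis using True by (simp add: abs_mult)
    qed simp
  qed
qed measurable

lemma V_eq_Q: "V x = Q x x"
  unfolding V_def Q_def by (simp add: power2_norm_eq_inner)

lemma integrable_V: "integrable lborel (\<lambda>s. indicator {0..} s * (norm (opexp T s x))\<^sup>2)"
  using integrable_Q[of x x] by (simp add: power2_norm_eq_inner)

lemma Q_add_left: "Q (x + y) z = Q x z + Q y z"
proof -
  have "Q (x + y) z = (\<integral>s. indicator {0..} s * (opexp T s x \<bullet> opexp T s z) + indicator {0..} s * (opexp T s y \<bullet> opexp T s z) \<partial>lborel)"
    unfolding Q_def by (simp add: opexp_add inner_add_left distrib_left)
  then show ?thesis unfolding Q_def by (subst (asm) Bochner_Integration.integral_add[OF integrable_Q integrable_Q])
qed

lemma Q_scale_left: "Q (c *\<^sub>R x) z = c * Q x z"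
proof -
  have "Q (c *\<^sub>R x) z = (\<integral>s. c * (indicator {0..} s * (opexp T s x \<bullet> opexp T s z)) \<partial>lborel)"
    unfolding Q_def by (simp add: opexp_scale mult.left_commute)
  then show ?thesis unfolding Q_def by simp
qed

lemma Q_commute: "Q x y = Q y x"
  unfolding Q_def by (simp add: inner_commute)

lemma Q_add_right: "Q z (x + y) = Q z x + Q z y"
  by (metis Q_add_left Q_commute)

lemma Q_scale_right: "Q z (c *\<^sub>R x) = c * Q z x"
  by (metis Q_scale_left Q_commute)

lemma linear_Q: "linear (Q z)"
  by (intro linearI) (simp_all add: Q_add_right Q_scale_right)

lemma V_add: "V (x + y) = V x + 2 * Q x y + V y"
  by (simp add: V_eq_Q Q_add_left Q_add_right Q_commute[of y x])

lemma V_scale: "V (c *\<^sub>R x) = c\<^sup>2 * V x"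
  by (simp add: V_eq_Q Q_scale_left Q_scale_right power2_eq_square)

lemma V_nonneg: "0 \<le> V x"
  unfolding V_def by (intro Bochner_Integration.integral_nonneg) simp

text \<open>Expand \<open>V >= 0\<close> at \<open>sqrt e * x - y / sqrt e\<close>.\<close>

lemma Q_young: "0 < e \<Longrightarrow> 2 * Q x y \<le> e * V x + V y / e"
proof -
  assume e: "0 < e"
  have "0 \<le> V (sqrt e *\<^sub>R x + (- (1 / sqrt e)) *\<^sub>R y)" by (rule V_nonneg)
  also have "\<dots> = e * V x - 2 * Q x y + V y / e"
    unfolding V_add V_scale Q_scale_left Q_scale_right using e
    by (simp add: power2_eq_square field_simps)
  finally show ?thesis by simp
qed

lemma V_upper: obtains cV where "0 < cV" "\<And>x. V x \<le> cV * (norm x)\<^sup>2"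
proof -
  define I where "I = (\<integral>s. indicator {0..} s * exp (- (2 * c0) * s) \<partial>lborel)"
  have "V x \<le> (C0\<^sup>2 * I) * (norm x)\<^sup>2" for x
  proof -
    have "V x \<le> (\<integral>s. (C0\<^sup>2 * (norm x)\<^sup>2) * (indicator {0..} s * exp (- (2 * c0) * s)) \<partial>lborel)"
      unfolding V_def
    proof (rule integral_mono[OF integrable_V])
      show "integrable lborel (\<lambda>s. (C0\<^sup>2 * (norm x)\<^sup>2) * (indicator {0..} s * exp (- (2 * c0) * s)))"
        by (intro integrable_mult_right integrable_exp_half_line) (simp add: c0)
      fix s :: real
      show "indicator {0..} s * (norm (opexp T s x))\<^sup>2 \<le> (C0\<^sup>2 * (norm x)\<^sup>2) * (indicator {0..} s * exp (- (2 * c0) * s))"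
      proof (cases "0 \<le> s")
        case True
        have "(norm (opexp T s x))\<^sup>2 \<le> (C0 * exp (- c0 * s) * norm x)\<^sup>2"
          using decay[OF True] by (intro power_mono) auto
        also have "\<dots> = (C0\<^sup>2 * (norm x)\<^sup>2) * exp (- (2 * c0) * s)"
          by (simp add: power_mult_distrib exp_double[symmetric] algebra_simps)
        finally show ?thesis using True by simp
      qed simp
    qed
    also have "\<dots> = (C0\<^sup>2 * (norm x)\<^sup>2) * I" unfolding I_def by (rule integral_mult_right_zero)
    finally show ?thesis by (simp add: mult_ac)
  qed
  then have "V x \<le> (\<bar>C0\<^sup>2 * I\<bar> + 1) * (norm x)\<^sup>2" for x
    using mult_right_mono[of "C0\<^sup>2 * I" "\<bar>C0\<^sup>2 * I\<bar> + 1" "(norm x)\<^sup>2"] order_trans by fastforce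
  then show ?thesis by (intro that[of "\<bar>C0\<^sup>2 * I\<bar> + 1"]) auto
qed

text \<open>\<open>K * s <= 1/4\<close> gives \<open>K * s * exp (K * s) <= 1/2\<close>, so the flow
  displaces \<open>x\<close> by at most half its norm.\<close>

lemma norm_opexp_lower:
  assumes "0 \<le> s" "s \<le> 1 / (4 * K)"
  shows "norm x / 2 \<le> norm (opexp T s x)"
proof -
  have Ks: "0 \<le> K * s" "K * s \<le> 1 / 4" using assms K1 by (auto simp: field_simps)
  have "exp (K * s) \<le> exp (1 / 2)" using Ks by simp
  also have "\<dots> \<le> 2"
    using exp_bound_half[of "1 / 2 :: real"] by simp
  finally have "K * s * exp (K * s) \<le> 1 / 4 * 2" using Ks by (intro mult_mono) auto
  then have "K * s * exp (K * s) * norm x \<le> 1 / 2 * norm x" by (intro mult_right_mono) auto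
  then have "norm (opexp T s x - x) \<le> norm x / 2"
    using opexp_first_order[OF assms(1), of x] by simp
  then show ?thesis using norm_triangle_ineq2[of x "opexp T s x"] by (simp add: norm_minus_commute)
qed

text \<open>By the semigroup law, flowing for time \<open>h\<close> cuts the piece up to
  \<open>h\<close> off the defining integral. The half-open interval is the exact complement of
  \<open>{h..}\<close> in the half line.\<close>

lemma V_opexp_eq:
  assumes "0 \<le> h"
  shows "V (opexp T h x) = V x - (\<integral>s. indicator {0..<h} s * (norm (opexp T s x))\<^sup>2 \<partial>lborel)"
    and "integrable lborel (\<lambda>s. indicator {0..<h} s * (norm (opexp T s x))\<^sup>2)"
proof -
  let ?f = "\<lambda>s. indicator {h..} s * (norm (opexp T s x))\<^sup>2"
  have "V (opexp T h x) = (\<integral>s. ?f (h + 1 * s) \<partial>lborel)"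
    unfolding V_def using assms
    by (intro Bochner_Integration.integral_cong) (auto simp: opexp_plus add.commute split: split_indicator)
  also have "\<dots> = (\<integral>s. ?f s \<partial>lborel)"
    using lborel_integral_real_affine[of 1 ?f h] by simp
  finally have 1: "V (opexp T h x) = (\<integral>s. ?f s \<partial>lborel)" .
  have int1: "integrable lborel ?f"
    by (rule Bochner_Integration.integrable_bound[OF integrable_V[of x]])
      (use assms in \<open>auto split: split_indicator\<close>)
  show int2: "integrable lborel (\<lambda>s. indicator {0..<h} s * (norm (opexp T s x))\<^sup>2)"
    by (rule Bochner_Integration.integrable_bound[OF integrable_V[of x]])
      (use assms in \<open>auto split: split_indicator\<close>)
  have "V x = (\<integral>s. ?f s + indicator {0..<h} s * (norm (opexp T s x))\<^sup>2 \<partial>lborel)"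
    unfolding V_def using assms
    by (intro Bochner_Integration.integral_cong) (auto split: split_indicator)
  then show "V (opexp T h x) = V x - (\<integral>s. indicator {0..<h} s * (norm (opexp T s x))\<^sup>2 \<partial>lborel)"
    using 1 by (simp add: Bochner_Integration.integral_add[OF int1 int2])
qed

lemma V_opexp_le: "0 \<le> h \<Longrightarrow> V (opexp T h x) \<le> V x"
  by (subst V_opexp_eq) (auto intro!: Bochner_Integration.integral_nonneg)

text \<open>On the piece cut off, the integrand is at least \<open>(norm x / 2)^2\<close>.\<close>

lemma V_opexp_drop:
  assumes "0 \<le> h" "h \<le> 1 / (4 * K)"
  shows "V (opexp T h x) + h / 4 * (norm x)\<^sup>2 \<le> V x"
proof -
  have "h / 4 * (norm x)\<^sup>2 = (\<integral>s. indicator {0..<h} s * ((norm x)\<^sup>2 / 4) \<partial>lborel)"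
    using assms by simp
  also have "\<dots> \<le> (\<integral>s. indicator {0..<h} s * (norm (opexp T s x))\<^sup>2 \<partial>lborel)"
  proof (rule integral_mono[OF _ V_opexp_eq(2)[OF assms(1)]])
    show "integrable lborel (\<lambda>s. indicator {0..<h} s * ((norm x)\<^sup>2 / 4))"
      using assms by (intro integrable_mult_left integrable_real_indicator) auto
    fix s :: real
    show "indicator {0..<h} s * ((norm x)\<^sup>2 / 4) \<le> indicator {0..<h} s * (norm (opexp T s x))\<^sup>2"
    proof (cases "s \<in> {0..<h}")
      case True
      then have "(norm x / 2)\<^sup>2 \<le> (norm (opexp T s x))\<^sup>2"
        using assms by (intro power_mono norm_opexp_lower) auto
      then show ?thesis using True by (simp add: power_divide)
    qed simp
  qed
  finally show ?thesis using V_opexp_eq(1)[OF assms(1), of x] by simp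
qed

text \<open>\<open>V_opexp_drop\<close> at the longest admissible time \<open>1 / (4 * K)\<close>,
  combined with nonnegativity of \<open>V\<close> at the image point.\<close>

lemma V_lower: obtains c1 where "0 < c1" "\<And>x. c1 * (norm x)\<^sup>2 \<le> V x"
proof
  show "0 < 1 / (16 * K)" using K1 by simp
  show "1 / (16 * K) * (norm x)\<^sup>2 \<le> V x" for x
    using V_opexp_drop[of "1 / (4 * K)" x] V_nonneg[of "opexp T (1 / (4 * K)) x"] K1 by simp
qed

lemma continuous_on_V: "continuous_on S V"
proof -
  have eq: "V x = (\<Sum>b\<in>Basis. (x \<bullet> b) * (\<Sum>b'\<in>Basis. (x \<bullet> b') * Q b' b))" for x
  proof -
    have "V x = Q x (\<Sum>b\<in>Basis. (x \<bullet> b) *\<^sub>R b)" by (simp add: V_eq_Q euclidean_representation)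
    also have "\<dots> = (\<Sum>b\<in>Basis. (x \<bullet> b) * Q x b)"
      by (simp add: linear_sum[OF linear_Q] Q_scale_right)
    also have "\<dots> = (\<Sum>b\<in>Basis. (x \<bullet> b) * Q b x)" by (simp add: Q_commute)
    also have "\<dots> = (\<Sum>b\<in>Basis. (x \<bullet> b) * Q b (\<Sum>b'\<in>Basis. (x \<bullet> b') *\<^sub>R b'))"
      by (simp add: euclidean_representation)
    finally show ?thesis by (simp add: linear_sum[OF linear_Q] Q_scale_right Q_commute)
  qed
  show ?thesis by (subst eq[abs_def]) (intro continuous_intros)
qed

lemma V_measurable [measurable]: "V \<in> borel_measurable borel"
  by (intro borel_measurable_continuous_onI continuous_on_V)

text \<open>Loss \<open>m * h\<close> from the flow competes with gain \<open>2 * d * h\<close> from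
  the perturbation. The constants are fixed in the order \<open>m\<close>, \<open>d\<close>,
  \<open>e\<close>, so that the loss wins by a factor of two and the rate \<open>m / 2\<close>
  remains.\<close>

lemma V_drift:
  assumes F: "\<And>e. 0 < e \<Longrightarrow> \<exists>C. \<forall>x. norm (F x) \<le> e * norm x + C"
  obtains k h0 C where "0 < k" "0 < h0" "0 \<le> C" "k * h0 \<le> 1"
    "\<And>h x. 0 \<le> h \<Longrightarrow> h \<le> h0 \<Longrightarrow> V (opexp T h (x + h *\<^sub>R F x)) \<le> (1 - k * h) * V x + C * h"
proof -
  obtain cV where cV: "0 < cV" "\<And>x. V x \<le> cV * (norm x)\<^sup>2" using V_upper by blast
  obtain c1 where c1: "0 < c1" "\<And>x. c1 * (norm x)\<^sup>2 \<le> V x" using V_lower by blast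
  \<comment> \<open>The flow loses \<open>h / 4\<close> times the squared norm, which is at least
    \<open>m * h * V\<close> because \<open>V\<close> is at most \<open>cV\<close> times the squared
    norm.\<close>
  define m where "m = 1 / (4 * cV)"
  have m: "0 < m" using cV by (simp add: m_def)
  \<comment> \<open>\<open>d <= m / 4\<close> keeps the gain below half of the loss;
    \<open>d <= 1\<close> is used to absorb the quadratic term, see \<open>hd\<close>.\<close>
  define d where "d = min 1 (m / 4)"
  have d: "0 < d" "d \<le> 1" "d \<le> m / 4" using m by (auto simp: d_def)
  \<comment> \<open>Tuned so that \<open>V (F x)\<close> is at most \<open>d^2 / 2 * V x\<close>
    plus a constant; the division by \<open>d\<close> in Young's inequality then leaves only
    \<open>d / 2 * V x\<close>.\<close>
  define e where "e = sqrt (c1 * d\<^sup>2 / (4 * cV))"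
  have e: "0 < e" "2 * cV * e\<^sup>2 = c1 * (d\<^sup>2 / 2)" using c1 cV d by (auto simp: e_def)
  obtain C where C: "\<And>x. norm (F x) \<le> e * norm x + C" using F[OF e(1)] by blast
  define h0 where "h0 = min (min 1 (1 / (4 * K))) (1 / m)"
  have h0: "0 < h0" "h0 \<le> 1 / (4 * K)" "h0 \<le> 1 / m" using K1 m by (auto simp: h0_def)
  have h01: "h0 \<le> 1" unfolding h0_def by linarith
  have mh0: "m * h0 \<le> 1" using h0(3) m by (simp add: field_simps)
  define C' where "C' = (2 / d) * (2 * cV * C\<^sup>2)"
  have C': "0 \<le> C'" using d cV by (simp add: C'_def)
  have VF: "V (F x) \<le> d\<^sup>2 / 2 * V x + 2 * cV * C\<^sup>2" for x
  proof -
    have "V (F x) \<le> cV * (norm (F x))\<^sup>2" by (rule cV(2))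
    also have "(norm (F x))\<^sup>2 \<le> (e * norm x + C)\<^sup>2" using C[of x] by (intro power_mono) auto
    also have "(e * norm x + C)\<^sup>2 \<le> 2 * (e * norm x)\<^sup>2 + 2 * C\<^sup>2"
      using sum_squares_bound[of "e * norm x" C] by (simp add: power2_sum)
    finally have "V (F x) \<le> (2 * cV * e\<^sup>2) * (norm x)\<^sup>2 + 2 * cV * C\<^sup>2"
      using cV(1) by (simp add: algebra_simps power_mult_distrib)
    also have "(2 * cV * e\<^sup>2) * (norm x)\<^sup>2 = d\<^sup>2 / 2 * (c1 * (norm x)\<^sup>2)" unfolding e(2) by simp
    also have "\<dots> \<le> d\<^sup>2 / 2 * V x" by (intro mult_left_mono c1(2)) simp
    finally show ?thesis by simp
  qed
  have "V (opexp T h (x + h *\<^sub>R F x)) \<le> (1 - m / 2 * h) * V x + C' * h" if h: "0 \<le> h" "h \<le> h0" for h x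
  proof -
    let ?y = "x + h *\<^sub>R F x"
    have "m * V ?y \<le> m * (cV * (norm ?y)\<^sup>2)" using m by (intro mult_left_mono cV(2)) auto
    also have "\<dots> = (norm ?y)\<^sup>2 / 4" using cV(1) by (simp add: m_def)
    finally have "h * (m * V ?y) \<le> h * ((norm ?y)\<^sup>2 / 4)" using h by (intro mult_left_mono) auto
    then have 1: "V (opexp T h ?y) \<le> (1 - m * h) * V ?y"
      using V_opexp_drop[of h ?y] h h0 by (simp add: algebra_simps)
    have "m * h \<le> m * h0" "0 \<le> m * h" using h m by simp_all
    then have mh: "0 \<le> 1 - m * h" "1 - m * h \<le> 1" using mh0 by linarith+
    have hd: "h * h \<le> h / d"
    proof -
      have "h * h \<le> h * 1" using h h01 by (intro mult_left_mono) auto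
      also have "\<dots> \<le> h / d" using h d by (simp add: field_simps mult_left_le_one_le)
      finally show ?thesis .
    qed
    have "V ?y = V x + h * (2 * Q x (F x)) + (h * h) * V (F x)"
      by (simp add: V_add V_scale Q_scale_right power2_eq_square)
    also have "\<dots> \<le> V x + h * (d * V x + V (F x) / d) + (h / d) * V (F x)"
      using h hd by (intro add_mono mult_left_mono mult_right_mono Q_young d V_nonneg) auto
    also have "\<dots> = (1 + d * h) * V x + (2 * h / d) * V (F x)" by (simp add: algebra_simps)
    also have "\<dots> \<le> (1 + d * h) * V x + (2 * h / d) * (d\<^sup>2 / 2 * V x + 2 * cV * C\<^sup>2)"
      using h d by (intro add_left_mono mult_left_mono VF) auto
    also have "\<dots> = (1 + 2 * d * h) * V x + C' * h"
      using d by (simp add: C'_def field_simps power2_eq_square)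
    finally have 2: "V ?y \<le> (1 + 2 * d * h) * V x + C' * h" .
    have "V (opexp T h ?y) \<le> (1 - m * h) * ((1 + 2 * d * h) * V x + C' * h)"
      using 1 mult_left_mono[OF 2 mh(1)] by simp
    also have "\<dots> = ((1 - m * h) * (1 + 2 * d * h)) * V x + (1 - m * h) * (C' * h)"
      by (simp add: algebra_simps)
    also have "\<dots> \<le> (1 - m / 2 * h) * V x + 1 * (C' * h)"
    proof (intro add_mono mult_right_mono V_nonneg mh)
      have "0 \<le> m * h * (2 * d * h)" using m h d by simp
      moreover have "2 * d * h \<le> m / 2 * h" using d h by (intro mult_right_mono) auto
      ultimately show "(1 - m * h) * (1 + 2 * d * h) \<le> 1 - m / 2 * h"
        by (simp add: algebra_simps)
    qed (use C' h in auto)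
    finally show ?thesis by simp
  qed
  then show ?thesis using m h0 C' mh0 by (intro that[of "m / 2" h0 C']) auto
qed

end

lemma Vfun_eq_V:
  fixes A :: "real^'d \<Rightarrow> real^'d"
  assumes "stable_linop A K C0 c0"
  shows "Vfun A = stable_linop.V A"
proof
  interpret stable_linop A K C0 c0 by fact
  fix x
  have eq: "expA A = opexp A" by (simp add: expA_def opexp_def fun_eq_iff)
  have "set_integrable lborel {0..} (\<lambda>s. (norm (opexp A s x))\<^sup>2)"
    using integrable_V[of x] by (simp add: set_integrable_def)
  from set_borel_integral_eq_integral(2)[OF this] show "Vfun A x = V x"
    by (simp add: Vfun_def V_def eq set_lebesgue_integral_def)
qed

section \<open>Stability, local error and pathwise convergence of the scheme\<close>

section \<open>An exponential Euler scheme\<close>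

text \<open>Drift and noise are added before the flow acts. Each step thus ends with the flow that
  contracts \<open>V\<close>, and in \<open>euler_mild\<close> the input of step \<open>j\<close> is
  propagated over the whole remaining time including its own step.\<close>

definition euler_step :: "('a::euclidean_space \<Rightarrow> 'a) \<Rightarrow> ('a \<Rightarrow> 'a) \<Rightarrow> ('b \<Rightarrow> 'a) \<Rightarrow> real \<Rightarrow> 'a \<Rightarrow> 'b \<Rightarrow> 'a" where
  "euler_step T F B h y z = opexp T h (y + h *\<^sub>R F y + B z)"

primrec euler :: "('a::euclidean_space \<Rightarrow> 'a) \<Rightarrow> ('a \<Rightarrow> 'a) \<Rightarrow> ('b \<Rightarrow> 'a) \<Rightarrow> real \<Rightarrow> 'a \<Rightarrow> (nat \<Rightarrow> 'b) \<Rightarrow> nat \<Rightarrow> 'a" where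
  "euler T F B h x w 0 = x"
| "euler T F B h x w (Suc k) = euler_step T F B h (euler T F B h x w k) (w k)"

context linop
begin

lemma euler_step_lipschitz:
  assumes F: "L-lipschitz_on UNIV F" and h: "0 \<le> h"
  shows "norm (euler_step T F B h y z - euler_step T F B h y' z) \<le> exp ((K + L) * h) * norm (y - y')"
proof -
  have "euler_step T F B h y z - euler_step T F B h y' z = opexp T h ((y - y') + h *\<^sub>R (F y - F y'))"
    by (simp add: euler_step_def linear_diff[OF linear_opexp, symmetric] algebra_simps)
  also have "norm \<dots> \<le> exp (K * h) * norm ((y - y') + h *\<^sub>R (F y - F y'))"
    using norm_opexp_le[of h] h by simp
  also have "\<dots> \<le> exp (K * h) * ((1 + h * L) * norm (y - y'))"
  proof (intro mult_left_mono)
    have "norm (F y - F y') \<le> L * norm (y - y')" using lipschitz_onD[OF F, of y y'] by (simp add: dist_norm)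
    then have "h * norm (F y - F y') \<le> h * (L * norm (y - y'))" using h by (intro mult_left_mono) auto
    then show "norm ((y - y') + h *\<^sub>R (F y - F y')) \<le> (1 + h * L) * norm (y - y')"
      using norm_triangle_ineq[of "y - y'" "h *\<^sub>R (F y - F y')"] h by (simp add: distrib_right mult.assoc)
  qed simp
  also have "\<dots> \<le> exp (K * h) * (exp (h * L) * norm (y - y'))"
    using exp_ge_add_one_self[of "h * L"] by (intro mult_left_mono mult_right_mono) auto
  finally show ?thesis by (simp add: exp_add algebra_simps)
qed

text \<open>The increment \<open>B z\<close> is rough and of no useful size, so it is eliminated:
  through the integral equation the input of the step equals the exact end value
  \<open>Y (a + h)\<close> plus a drift mismatch \<open>d\<close>. The flow is expanded around that
  end value.\<close>

lemma euler_step_local_error: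
  assumes F: "L-lipschitz_on UNIV F" and h: "0 \<le> h"
    and Y: "continuous_on {a..a + h} Y"
    and eq: "Y (a + h) = Y a + integral {a..a + h} (\<lambda>s. T (Y s) + F (Y s)) + B z"
    and M: "\<And>s. s \<in> {a..a + h} \<Longrightarrow> norm (Y s) \<le> M" "\<And>s. s \<in> {a..a + h} \<Longrightarrow> norm (F (Y s)) \<le> M'"
    and osc: "\<And>r s. r \<in> {a..a + h} \<Longrightarrow> s \<in> {a..a + h} \<Longrightarrow> norm (Y r - Y s) \<le> e"
  shows "norm (euler_step T F B h (Y a) z - Y (a + h))
    \<le> h * (h * (exp (K * h) * (K\<^sup>2 * M + K * (K * M + 2 * M'))) + (K + L) * e)"
proof -
  let ?g = "\<lambda>s. T (Y s) + F (Y s)"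
  define J where "J = integral {a..a + h} ?g"
  have contT: "continuous_on S T" for S
    using lin linear_conv_bounded_linear linear_continuous_on by blast
  have contF: "continuous_on UNIV F" using F by (rule lipschitz_on_continuous_on)
  have contg: "continuous_on {a..a + h} ?g"
    by (intro continuous_intros continuous_on_compose2[OF contT Y] continuous_on_compose2[OF contF Y]) auto
  have Ma: "norm (Y a) \<le> M" "norm (F (Y a)) \<le> M'" "norm (Y (a + h)) \<le> M" using M h by auto
  have J: "norm J \<le> (K * M + M') * h"
  proof -
    have "norm J \<le> (K * M + M') * (a + h - a)" unfolding J_def
    proof (rule integral_bound[OF _ contg])
      fix s assume s: "s \<in> {a..a + h}"
      have "norm (?g s) \<le> K * norm (Y s) + norm (F (Y s))"
        using norm_triangle_ineq[of "T (Y s)" "F (Y s)"] bnd[of "Y s"] by simp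
      also have "\<dots> \<le> K * M + M'" using M s K0 by (intro add_mono mult_left_mono) auto
      finally show "norm (?g s) \<le> K * M + M'" .
    qed (use h in auto)
    then show ?thesis by simp
  qed
  \<comment> \<open>Frozen drift minus the true integral of the full right-hand side, so of order
    \<open>h\<close> only.\<close>
  define d where "d = h *\<^sub>R F (Y a) - J"
  have d: "norm d \<le> h * (K * M + 2 * M')"
  proof -
    have "norm d \<le> h * norm (F (Y a)) + norm J"
      unfolding d_def using norm_triangle_ineq4[of "h *\<^sub>R F (Y a)" J] h by simp
    also have "\<dots> \<le> h * M' + (K * M + M') * h" using J Ma h by (intro add_mono mult_left_mono) auto
    finally show ?thesis by (simp add: algebra_simps)
  qed
  \<comment> \<open>The first-order term of the flow cancels the linear part of \<open>d\<close> up
    to the oscillation of \<open>Y\<close> over the step.\<close>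
  have 3: "norm (h *\<^sub>R T (Y (a + h)) + d) \<le> h * ((K + L) * e)"
  proof -
    have "h *\<^sub>R T (Y (a + h)) + d = integral {a..a + h} (\<lambda>s. (T (Y (a + h)) + F (Y a)) - ?g s)"
      using h integrable_continuous_real[OF contg]
      by (subst Henstock_Kurzweil_Integration.integral_diff)
        (auto simp: d_def J_def scaleR_add_right intro: integrable_const_ivl)
    also have "norm \<dots> \<le> ((K + L) * e) * (a + h - a)"
    proof (rule integral_bound)
      fix s assume s: "s \<in> {a..a + h}"
      have "(T (Y (a + h)) + F (Y a)) - ?g s = T (Y (a + h) - Y s) + (F (Y a) - F (Y s))"
        by (simp add: linear_diff[OF lin])
      also have "norm \<dots> \<le> K * norm (Y (a + h) - Y s) + L * norm (Y a - Y s)"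
        using norm_triangle_ineq[of "T (Y (a + h) - Y s)" "F (Y a) - F (Y s)"] bnd[of "Y (a + h) - Y s"]
          lipschitz_onD[OF F, of "Y a" "Y s"] by (simp add: dist_norm)
      also have "\<dots> \<le> K * e + L * e"
        using osc[of "a + h" s] osc[of a s] s h K0 lipschitz_on_nonneg[OF F]
        by (intro add_mono mult_left_mono) auto
      finally show "norm ((T (Y (a + h)) + F (Y a)) - ?g s) \<le> (K + L) * e" by (simp add: algebra_simps)
    qed (use h in \<open>auto intro!: continuous_intros contg continuous_on_diff[OF continuous_on_const contg]\<close>)
    finally show ?thesis by (simp add: mult_ac)
  qed
  have "Y a + h *\<^sub>R F (Y a) + B z = Y (a + h) + d" using eq by (simp add: d_def J_def)
  then have "euler_step T F B h (Y a) z - Y (a + h)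
      = (opexp T h (Y (a + h)) - Y (a + h) - h *\<^sub>R T (Y (a + h))) + (opexp T h d - d) + (h *\<^sub>R T (Y (a + h)) + d)"
    by (simp add: euler_step_def opexp_add)
  also have "norm \<dots> \<le> K\<^sup>2 * h\<^sup>2 * exp (K * h) * M + K * h * exp (K * h) * (h * (K * M + 2 * M')) + h * ((K + L) * e)"
  proof (intro order_trans[OF norm_triangle_ineq add_mono[OF order_trans[OF norm_triangle_ineq add_mono] 3]])
    show "norm (opexp T h (Y (a + h)) - Y (a + h) - h *\<^sub>R T (Y (a + h))) \<le> K\<^sup>2 * h\<^sup>2 * exp (K * h) * M"
      using K0 by (intro order_trans[OF opexp_second_order[OF h]] mult_left_mono Ma) auto
    show "norm (opexp T h d - d) \<le> K * h * exp (K * h) * (h * (K * M + 2 * M'))"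
      using K0 h by (intro order_trans[OF opexp_first_order[OF h]] mult_left_mono d) auto
  qed
  also have "\<dots> = h * (h * (exp (K * h) * (K\<^sup>2 * M + K * (K * M + 2 * M'))) + (K + L) * e)"
    by (simp add: algebra_simps power2_eq_square)
  finally show ?thesis .
qed

text \<open>Deterministic: \<open>N\<close> is any noise path for which \<open>Y\<close> solves the
  integral equation. Local errors are \<open>h * q\<close> with \<open>q\<close> small for fine
  meshes, by uniform continuity of \<open>Y\<close>; the Lipschitz stability of a step accumulates
  them to at most \<open>G * q\<close>.\<close>

lemma euler_converges:
  assumes F: "L-lipschitz_on UNIV F" and t: "0 \<le> t"
    and Y: "continuous_on {0..t} Y"
    and eq: "\<And>s. s \<in> {0..t} \<Longrightarrow> Y s = Y 0 + integral {0..s} (\<lambda>s. T (Y s) + F (Y s)) + N s"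
    and w: "\<And>n k. k < n \<Longrightarrow> B (w n k) = N (real (Suc k) * (t / n)) - N (real k * (t / n))"
  shows "(\<lambda>n. euler T F B (t / n) (Y 0) (w n) n) \<longlonglongrightarrow> Y t"
proof (rule LIMSEQ_I)
  have contF: "continuous_on UNIV F" using F by (rule lipschitz_on_continuous_on)
  have L0: "0 \<le> L" using lipschitz_on_nonneg[OF F] .
  have contFY: "continuous_on {0..t} (\<lambda>s. F (Y s))"
    by (rule continuous_on_compose2[OF contF Y]) auto
  have contT: "continuous_on S T" for S
    using lin linear_conv_bounded_linear linear_continuous_on by blast
  let ?g = "\<lambda>s. T (Y s) + F (Y s)"
  have contg: "continuous_on {0..t} ?g"
    by (intro continuous_intros continuous_on_compose2[OF contT Y] contFY) auto
  have "bounded (Y ` {0..t})" by (intro compact_imp_bounded compact_continuous_image Y) auto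
  then obtain M where M: "0 < M" "\<And>s. s \<in> {0..t} \<Longrightarrow> norm (Y s) \<le> M"
    unfolding bounded_pos by auto
  have "bounded ((\<lambda>s. F (Y s)) ` {0..t})" by (intro compact_imp_bounded compact_continuous_image contFY) auto
  then obtain M' where M': "0 < M'" "\<And>s. s \<in> {0..t} \<Longrightarrow> norm (F (Y s)) \<le> M'"
    unfolding bounded_pos by auto
  fix r :: real assume r: "0 < r"
  define G where "G = exp ((K + L) * t) * t"
  have G: "0 \<le> G" using t by (simp add: G_def)
  \<comment> \<open>The oscillation part of the final error is \<open>G * (K + L) * e\<close>, kept
    at most \<open>r / 2\<close>; the summand 1 keeps the denominator positive.\<close>
  define e where "e = r / (2 * (G * (K + L) + 1))"
  have GKL: "0 \<le> G * (K + L)" using G K0 L0 by simp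
  then have e: "0 < e" using r by (simp add: e_def)
  define C where "C = exp (K * t) * (K\<^sup>2 * M + K * (K * M + 2 * M'))"
  have C: "0 \<le> C" using M M' K0 by (simp add: C_def)
  have "uniformly_continuous_on {0..t} Y" by (intro compact_uniformly_continuous Y) auto
  then obtain d where d: "0 < d" "\<And>r s. r \<in> {0..t} \<Longrightarrow> s \<in> {0..t} \<Longrightarrow> dist r s < d \<Longrightarrow> dist (Y r) (Y s) < e"
    unfolding uniformly_continuous_on_def using e by (metis dist_commute)
  \<comment> \<open>Brings the mesh below the modulus of continuity \<open>d\<close> and the part of
    the error proportional to \<open>h\<close> below \<open>r / 2\<close>.\<close>
  obtain n0 :: nat where n0: "1 \<le> n0" "t < d * n0" "G * C * t * 2 < r * n0"
  proof -
    obtain a b :: nat where "t / d < a" "G * C * t * 2 / r < b" using reals_Archimedean2 by meson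
    then have "t / d < real (a + b + 1)" "G * C * t * 2 / r < real (a + b + 1)" by auto
    then show ?thesis using d(1) r by (intro that[of "a + b + 1"]) (auto simp: field_simps)
  qed
  have "norm (euler T F B (t / n) (Y 0) (w n) n - Y t) < r" if n: "n0 \<le> n" for n
  proof -
    define h where "h = t / n"
    have n1: "1 \<le> n" using n n0 by simp
    have h: "0 \<le> h" "h \<le> t" "n * h = t"
      using t n1 mult_left_mono[of 1 "real n" t] by (auto simp: h_def field_simps)
    have "d * n0 \<le> d * n" "r * n0 \<le> r * n" using n d(1) r by auto
    then have "t < d * n" "G * C * t * 2 < r * n" using n0 by auto
    then have hd: "h < d" and hr: "G * C * h < r / 2"
      using n1 by (auto simp: h_def field_simps)
    define q where "q = h * C + (K + L) * e"
    have q: "0 \<le> q" using h C K0 L0 e by (simp add: q_def)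
    have kh: "real k * h \<le> t" if "k \<le> n" for k
      using mult_right_mono[of "real k" "real n" h] that h by simp
    have local: "norm (euler_step T F B h (Y (k * h)) (w n k) - Y (Suc k * h)) \<le> h * q" if k: "k < n" for k
    proof -
      have Skh: "Suc k * h = k * h + h" by (simp add: algebra_simps)
      have sub: "{k * h..k * h + h} \<subseteq> {0..t}" using kh[of "Suc k"] k h by (auto simp: algebra_simps)
      have "norm (euler_step T F B h (Y (k * h)) (w n k) - Y (k * h + h))
        \<le> h * (h * (exp (K * h) * (K\<^sup>2 * M + K * (K * M + 2 * M'))) + (K + L) * e)"
      proof (rule euler_step_local_error[OF F h(1)])
        show "continuous_on {k * h..k * h + h} Y" using Y sub by (rule continuous_on_subset)
        show "norm (Y s) \<le> M" "norm (F (Y s)) \<le> M'" if "s \<in> {k * h..k * h + h}" for s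
          using subsetD[OF sub that] M M' by blast+
        show "norm (Y r - Y s) \<le> e" if "r \<in> {k * h..k * h + h}" "s \<in> {k * h..k * h + h}" for r s
        proof -
          have "\<bar>r - s\<bar> < d" using that hd by auto
          then show ?thesis using d(2)[OF subsetD[OF sub that(1)] subsetD[OF sub that(2)]]
            by (simp add: dist_norm)
        qed
        have "integral {0..k * h} ?g + integral {k * h..k * h + h} ?g = integral {0..k * h + h} ?g"
          using sub h by (intro Henstock_Kurzweil_Integration.integral_combine
              integrable_continuous_real continuous_on_subset[OF contg]) auto
        moreover have "B (w n k) = N (k * h + h) - N (k * h)"
          using w[OF k] Skh by (simp add: h_def)
        moreover have "k * h \<in> {0..t}" "k * h + h \<in> {0..t}" using sub h by auto
        ultimately show "Y (k * h + h) = Y (k * h) + integral {k * h..k * h + h} ?g + B (w n k)"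
          using eq[of "k * h"] eq[of "k * h + h"] by (simp add: algebra_simps)
      qed
      also have "\<dots> \<le> h * q"
      proof -
        have "exp (K * h) \<le> exp (K * t)" using h(2) K0 by (simp add: mult_left_mono)
        then show ?thesis unfolding q_def C_def
          using h(1) K0 M(1) M'(1) by (intro mult_left_mono add_right_mono mult_right_mono) auto
      qed
      finally show ?thesis by (simp only: Skh)
    qed
    \<comment> \<open>Discrete Gronwall: \<open>k\<close> local errors, each amplified by no more
      than the full exponential growth up to step \<open>k\<close>.\<close>
    have "k \<le> n \<Longrightarrow> norm (euler T F B h (Y 0) (w n) k - Y (k * h)) \<le> exp ((K + L) * (k * h)) * (k * h * q)" for k
    proof (induction k)
      case (Suc k)
      let ?E = "euler T F B h (Y 0) (w n) k"
      have "norm (euler T F B h (Y 0) (w n) (Suc k) - Y (Suc k * h))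
        \<le> norm (euler_step T F B h ?E (w n k) - euler_step T F B h (Y (k * h)) (w n k))
          + norm (euler_step T F B h (Y (k * h)) (w n k) - Y (Suc k * h))"
        using norm_triangle_ineq[of "euler_step T F B h ?E (w n k) - euler_step T F B h (Y (k * h)) (w n k)"
            "euler_step T F B h (Y (k * h)) (w n k) - Y (Suc k * h)"] by simp
      also have "\<dots> \<le> exp ((K + L) * h) * (exp ((K + L) * (k * h)) * (k * h * q)) + h * q"
        using Suc by (intro add_mono local order_trans[OF euler_step_lipschitz[OF F h(1)]] mult_left_mono) auto
      also have "\<dots> = exp ((K + L) * (Suc k * h)) * (k * h * q) + 1 * (h * q)"
      proof -
        have "exp ((K + L) * h) * exp ((K + L) * (k * h)) = exp ((K + L) * (Suc k * h))"
          unfolding mult_exp_exp by (rule arg_cong[of _ _ exp]) (simp add: algebra_simps)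
        then show ?thesis by (simp only: mult.assoc[symmetric] mult_1_left)
      qed
      also have "\<dots> \<le> exp ((K + L) * (Suc k * h)) * (k * h * q) + exp ((K + L) * (Suc k * h)) * (h * q)"
        using h q K0 L0 by (intro add_left_mono mult_right_mono) auto
      also have "\<dots> = exp ((K + L) * (Suc k * h)) * (Suc k * h * q)" by (simp add: algebra_simps)
      finally show ?case .
    qed simp
    from this[of n] have "norm (euler T F B h (Y 0) (w n) n - Y t) \<le> G * q"
      unfolding h(3) G_def by (simp add: mult.assoc)
    also have "\<dots> = G * C * h + (G * (K + L)) * e" by (simp add: q_def algebra_simps)
    finally have A: "norm (euler T F B h (Y 0) (w n) n - Y t) \<le> G * C * h + (G * (K + L)) * e" .
    have "(G * (K + L)) * e \<le> r / 2"
    proof -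
      have "(G * (K + L)) * e \<le> (G * (K + L) + 1) * e" using e by simp
      also have "\<dots> = r / 2"
      proof -
        have "a * (r / (2 * a)) = r / 2" if "a \<noteq> 0" for a :: real using that by simp
        from this[of "G * (K + L) + 1"] show ?thesis using GKL unfolding e_def by linarith
      qed
      finally show ?thesis .
    qed
    then have "norm (euler T F B h (Y 0) (w n) n - Y t) < r" using A hr by linarith
    then show ?thesis by (simp only: h_def)
  qed
  then show "\<exists>n0. \<forall>n\<ge>n0. norm (euler T F B (t / n) (Y 0) (w n) n - Y t) < r" by blast
qed

end

section \<open>Cameron-Martin formula for finite products of Gaussians; law of Wiener
  increments\<close>

section \<open>Gaussian increments and their translation\<close>

text \<open>Induction on \<open>I\<close>, peeling off one factor by Tonelli. It serves twice: for
  the coordinates of one Gaussian vector and for the sequence of time steps.\<close>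

lemma nn_integral_PiM_change:
  fixes M :: "'i \<Rightarrow> 'a measure"
  assumes I: "finite I" and M: "\<And>i. sigma_finite_measure (M i)"
    and \<tau> [measurable]: "\<And>i. \<tau> i \<in> measurable (M i) (M i)"
    and D [measurable]: "\<And>i. D i \<in> borel_measurable (M i)"
    and change: "\<And>i f. f \<in> borel_measurable (M i) \<Longrightarrow> (\<integral>\<^sup>+z. f z \<partial>M i) = (\<integral>\<^sup>+z. f (\<tau> i z) * D i z \<partial>M i)"
    and f: "f \<in> borel_measurable (PiM I M)"
  shows "(\<integral>\<^sup>+w. f w \<partial>PiM I M) = (\<integral>\<^sup>+w. f (\<lambda>i\<in>I. \<tau> i (w i)) * (\<Prod>i\<in>I. D i (w i)) \<partial>PiM I M)"
  using I f
proof (induction I arbitrary: f rule: finite_induct)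
  case empty
  show ?case by (simp add: PiM_empty nn_integral_count_space_finite)
next
  case (insert j I)
  interpret product_sigma_finite M by (simp add: product_sigma_finite_def M)
  note [measurable] = insert.prems
  have [measurable]: "(\<lambda>w. \<lambda>i\<in>J. \<tau> i (w i)) \<in> measurable (PiM J M) (PiM J M)" for J
    by measurable
  have [measurable]: "(\<lambda>w. \<Prod>i\<in>J. D i (w i)) \<in> borel_measurable (PiM J M)" for J
    by measurable
  interpret Mj: sigma_finite_measure "M j" by (rule M)
  have "(\<integral>\<^sup>+w. f w \<partial>PiM (insert j I) M) = (\<integral>\<^sup>+x. (\<integral>\<^sup>+y. f (x(j := y)) \<partial>M j) \<partial>PiM I M)"
    by (rule product_nn_integral_insert) (use insert in auto)
  also have "\<dots> = (\<integral>\<^sup>+x. (\<integral>\<^sup>+y. f (x(j := \<tau> j y)) * D j y \<partial>M j) \<partial>PiM I M)"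
    by (intro nn_integral_cong change) measurable
  also have "\<dots> = (\<integral>\<^sup>+x. (\<integral>\<^sup>+y. f ((\<lambda>i\<in>I. \<tau> i (x i))(j := \<tau> j y)) * D j y \<partial>M j) * (\<Prod>i\<in>I. D i (x i)) \<partial>PiM I M)"
    by (rule insert.IH) measurable
  also have "\<dots> = (\<integral>\<^sup>+x. (\<integral>\<^sup>+y. f ((\<lambda>i\<in>I. \<tau> i (x i))(j := \<tau> j y)) * D j y * (\<Prod>i\<in>I. D i (x i)) \<partial>M j) \<partial>PiM I M)"
    by (intro nn_integral_cong nn_integral_multc[symmetric]) measurable
  also have "\<dots> = (\<integral>\<^sup>+x. (\<integral>\<^sup>+y. f (\<lambda>i\<in>insert j I. \<tau> i ((x(j := y)) i)) * (\<Prod>i\<in>insert j I. D i ((x(j := y)) i)) \<partial>M j) \<partial>PiM I M)"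
  proof (intro nn_integral_cong)
    fix x y
    have "(\<lambda>i\<in>I. \<tau> i (x i))(j := \<tau> j y) = (\<lambda>i\<in>insert j I. \<tau> i ((x(j := y)) i))"
      using insert(2) by (auto simp: fun_eq_iff restrict_def)
    moreover have "(\<Prod>i\<in>insert j I. D i ((x(j := y)) i)) = D j y * (\<Prod>i\<in>I. D i (x i))"
      using insert(1,2) by (subst prod.insert) (auto intro!: arg_cong2[where f = "(*)"] prod.cong)
    ultimately show "f ((\<lambda>i\<in>I. \<tau> i (x i))(j := \<tau> j y)) * D j y * (\<Prod>i\<in>I. D i (x i))
      = f (\<lambda>i\<in>insert j I. \<tau> i ((x(j := y)) i)) * (\<Prod>i\<in>insert j I. D i ((x(j := y)) i))"
      by (simp add: mult.assoc)
  qed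
  also have "\<dots> = (\<integral>\<^sup>+w. f (\<lambda>i\<in>insert j I. \<tau> i (w i)) * (\<Prod>i\<in>insert j I. D i (w i)) \<partial>PiM (insert j I) M)"
    by (rule product_nn_integral_insert[symmetric]) (use insert in auto)
  finally show ?case .
qed

text \<open>\<open>h\<close> is the variance, that is, the length of a time step.\<close>

definition gauss1 :: "real \<Rightarrow> real measure" where
  "gauss1 h = density lborel (normal_density 0 (sqrt h))"

lemma sets_gauss1 [simp, measurable_cong]: "sets (gauss1 h) = sets borel"
  by (simp add: gauss1_def)

lemma space_gauss1 [simp]: "space (gauss1 h) = UNIV"
  by (simp add: gauss1_def)

lemma prob_space_gauss1: "0 < h \<Longrightarrow> prob_space (gauss1 h)"
  unfolding gauss1_def by (rule prob_space_normal_density) simp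

text \<open>Substitute \<open>a + z\<close> in the Lebesgue integral and expand the square; the
  exponential is the ratio of the translated density to the original one.\<close>

lemma gauss1_shift:
  assumes h: "0 < h" and [measurable]: "f \<in> borel_measurable borel"
  shows "(\<integral>\<^sup>+z. f z \<partial>gauss1 h) = (\<integral>\<^sup>+z. f (z + a) * ennreal (exp (- (a * z / h) - a\<^sup>2 / (2 * h))) \<partial>gauss1 h)"
proof -
  have "(\<integral>\<^sup>+z. f z \<partial>gauss1 h) = (\<integral>\<^sup>+z. ennreal (normal_density 0 (sqrt h) z) * f z \<partial>lborel)"
    unfolding gauss1_def by (rule nn_integral_density) auto
  also have "\<dots> = (\<integral>\<^sup>+z. ennreal (normal_density 0 (sqrt h) (a + z)) * f (a + z) \<partial>lborel)"
    by (subst nn_integral_real_affine[where c = 1 and t = a]) auto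
  also have "\<dots> = (\<integral>\<^sup>+z. ennreal (normal_density 0 (sqrt h) z) * (f (z + a) * ennreal (exp (- (a * z / h) - a\<^sup>2 / (2 * h)))) \<partial>lborel)"
  proof (intro nn_integral_cong)
    fix z
    have "normal_density 0 (sqrt h) (a + z) = normal_density 0 (sqrt h) z * exp (- (a * z / h) - a\<^sup>2 / (2 * h))"
      using h by (simp add: normal_density_def exp_add[symmetric] field_simps power2_eq_square)
    then show "ennreal (normal_density 0 (sqrt h) (a + z)) * f (a + z)
      = ennreal (normal_density 0 (sqrt h) z) * (f (z + a) * ennreal (exp (- (a * z / h) - a\<^sup>2 / (2 * h))))"
      by (simp add: ennreal_mult' mult_ac add.commute)
  qed
  also have "\<dots> = (\<integral>\<^sup>+z. f (z + a) * ennreal (exp (- (a * z / h) - a\<^sup>2 / (2 * h))) \<partial>gauss1 h)"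
    unfolding gauss1_def by (rule nn_integral_density[symmetric]) auto
  finally show ?thesis .
qed

lemma gauss1_mean: "0 < h \<Longrightarrow> integrable (gauss1 h) (\<lambda>z. z)" "0 < h \<Longrightarrow> (\<integral>z. z \<partial>gauss1 h) = 0"
proof -
  assume h: "0 < h"
  have *: "has_bochner_integral lborel (\<lambda>x. normal_density 0 (sqrt h) x * x) 0"
    using normal_moment_nz_1[of "sqrt h" 0] h by simp
  then have "has_bochner_integral (gauss1 h) (\<lambda>z. z) 0"
    unfolding gauss1_def using h by (intro has_bochner_integral_density) auto
  then show "integrable (gauss1 h) (\<lambda>z. z)" "(\<integral>z. z \<partial>gauss1 h) = 0"
    by (auto simp: has_bochner_integral_iff)
qed

lemma gauss1_variance: "0 < h \<Longrightarrow> integrable (gauss1 h) (\<lambda>z. z\<^sup>2)" "0 < h \<Longrightarrow> (\<integral>z. z\<^sup>2 \<partial>gauss1 h) = h"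
proof -
  assume h: "0 < h"
  have *: "has_bochner_integral lborel (\<lambda>x. normal_density 0 (sqrt h) x * x\<^sup>2) h"
    using normal_moment_even[of "sqrt h" 0 1] h by (simp add: fact_numeral)
  then have "has_bochner_integral (gauss1 h) (\<lambda>z. z\<^sup>2) h"
    unfolding gauss1_def using h by (intro has_bochner_integral_density) auto
  then show "integrable (gauss1 h) (\<lambda>z. z\<^sup>2)" "(\<integral>z. z\<^sup>2 \<partial>gauss1 h) = h"
    by (auto simp: has_bochner_integral_iff)
qed

text \<open>The centred Gaussian on \<open>real^'n\<close> with covariance \<open>h\<close> times
  the identity, obtained from independent coordinates.\<close>

definition gauss :: "real \<Rightarrow> (real^'n) measure" where
  "gauss h = distr (PiM UNIV (\<lambda>_. gauss1 h)) borel (\<lambda>g. \<chi> i. g i)"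

lemma vec_lambda_measurable [measurable (raw)]:
  fixes f :: "'n::finite \<Rightarrow> 'a \<Rightarrow> real"
  assumes "\<And>i. f i \<in> borel_measurable M"
  shows "(\<lambda>x. \<chi> i. f i x) \<in> borel_measurable M"
proof (subst borel_measurable_euclidean_space, intro ballI)
  fix b :: "real^'n" assume "b \<in> Basis"
  then obtain i where "b = axis i 1" by (auto simp: Basis_vec_def)
  then show "(\<lambda>x. (\<chi> i. f i x) \<bullet> b) \<in> borel_measurable M"
    using assms by (simp add: inner_axis)
qed

lemma sets_gauss [simp, measurable_cong]: "sets (gauss h) = sets borel"
  by (simp add: gauss_def)

lemma space_gauss [simp]: "space (gauss h) = UNIV"
  by (simp add: gauss_def)

lemma chi_measurable_PiM: "(\<lambda>g. \<chi> i. g i) \<in> measurable (PiM UNIV (\<lambda>_. gauss1 h)) borel"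
  by measurable

lemma product_prob_gauss1: "0 < h \<Longrightarrow> product_prob_space (\<lambda>_::'n. gauss1 h)"
  by (intro product_prob_spaceI prob_space_gauss1)

lemma prob_space_gauss: "0 < h \<Longrightarrow> prob_space (gauss h :: (real^'n) measure)"
proof -
  assume h: "0 < h"
  interpret product_prob_space "\<lambda>_::'n. gauss1 h" UNIV by (rule product_prob_gauss1[OF h])
  show ?thesis unfolding gauss_def by (intro prob_space.prob_space_distr chi_measurable_PiM P.prob_space_axioms)
qed

lemma gauss_component:
  assumes h: "0 < h"
  shows "distr (gauss h :: (real^'n) measure) borel (\<lambda>z. z $ i) = gauss1 h"
proof -
  interpret product_prob_space "\<lambda>_::'n. gauss1 h" UNIV by (rule product_prob_gauss1[OF h])
  have "distr (gauss h) borel (\<lambda>z. z $ i) = distr (PiM UNIV (\<lambda>_. gauss1 h)) borel (\<lambda>g. g i)"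
    unfolding gauss_def by (subst distr_distr[OF _ chi_measurable_PiM]) (auto simp: o_def)
  also have "\<dots> = distr (PiM UNIV (\<lambda>_. gauss1 h)) (gauss1 h) (\<lambda>g. g i)"
    by (rule distr_cong) auto
  also have "\<dots> = gauss1 h" using PiM_component[of i] by simp
  finally show ?thesis .
qed

lemma gauss_mean:
  assumes h: "0 < h"
  shows "integrable (gauss h :: (real^'n) measure) (\<lambda>z. z $ i)" "(\<integral>z. z $ i \<partial>(gauss h :: (real^'n) measure)) = 0"
proof -
  have m: "(\<lambda>z::real^'n. z $ i) \<in> measurable (gauss h) borel" by measurable
  show "integrable (gauss h :: (real^'n) measure) (\<lambda>z. z $ i)"
    by (subst integrable_distr_eq[OF m, of "\<lambda>z. z", symmetric])
      (simp_all only: gauss_component[OF h] gauss1_mean(1)[OF h], simp)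
  show "(\<integral>z. z $ i \<partial>(gauss h :: (real^'n) measure)) = 0"
    by (subst integral_distr[OF m, of "\<lambda>z. z", symmetric])
      (simp_all only: gauss_component[OF h] gauss1_mean(2)[OF h], simp)
qed

lemma norm_sq_sum: "(norm z)\<^sup>2 = (\<Sum>i\<in>UNIV. (z $ i)\<^sup>2)" for z :: "real^'n"
  unfolding power2_norm_eq_inner inner_vec_def by (simp add: power2_eq_square)

lemma gauss_variance:
  fixes h :: real
  assumes h: "0 < h"
  shows "integrable (gauss h :: (real^'n) measure) (\<lambda>z. (norm z)\<^sup>2)"
    "(\<integral>z. (norm z)\<^sup>2 \<partial>(gauss h :: (real^'n) measure)) = CARD('n) * h"
proof -
  have m: "(\<lambda>z::real^'n. z $ i) \<in> measurable (gauss h) borel" for i by measurable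
  have 1: "integrable (gauss h :: (real^'n) measure) (\<lambda>z. (z $ i)\<^sup>2)" for i
    by (subst integrable_distr_eq[OF m, of "\<lambda>z. z\<^sup>2", symmetric])
      (simp_all only: gauss_component[OF h] gauss1_variance(1)[OF h], simp)
  have 2: "(\<integral>z. (z $ i)\<^sup>2 \<partial>(gauss h :: (real^'n) measure)) = h" for i
    by (subst integral_distr[OF m, of "\<lambda>z. z\<^sup>2", symmetric])
      (simp_all only: gauss_component[OF h] gauss1_variance(2)[OF h], simp)
  show "integrable (gauss h :: (real^'n) measure) (\<lambda>z. (norm z)\<^sup>2)"
    unfolding norm_sq_sum by (intro Bochner_Integration.integrable_sum 1)
  show "(\<integral>z. (norm z)\<^sup>2 \<partial>(gauss h :: (real^'n) measure)) = CARD('n) * h"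
    unfolding norm_sq_sum by (subst Bochner_Integration.integral_sum) (auto simp: 1 2)
qed

lemma gauss_shift:
  fixes a :: "real^'n"
  assumes h: "0 < h" and f [measurable]: "f \<in> borel_measurable borel"
  shows "(\<integral>\<^sup>+z. f z \<partial>gauss h) = (\<integral>\<^sup>+z. f (z + a) * ennreal (exp (- (a \<bullet> z / h) - (norm a)\<^sup>2 / (2 * h))) \<partial>gauss h)"
proof -
  interpret product_prob_space "\<lambda>_::'n. gauss1 h" UNIV by (rule product_prob_gauss1[OF h])
  let ?P = "PiM UNIV (\<lambda>_::'n. gauss1 h)"
  let ?D = "\<lambda>i z. ennreal (exp (- (a $ i * z / h) - (a $ i)\<^sup>2 / (2 * h)))"
  have "(\<integral>\<^sup>+z. f z \<partial>gauss h) = (\<integral>\<^sup>+g. f (\<chi> i. g i) \<partial>?P)"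
    unfolding gauss_def by (rule nn_integral_distr[OF chi_measurable_PiM]) simp
  also have "\<dots> = (\<integral>\<^sup>+g. f (\<chi> i. (\<lambda>i\<in>UNIV. g i + a $ i) i) * (\<Prod>i\<in>UNIV. ?D i (g i)) \<partial>?P)"
    by (rule nn_integral_PiM_change[where \<tau> = "\<lambda>i z. z + a $ i"])
      (auto intro: gauss1_shift[OF h] sigma_finite_measures cong: measurable_cong_sets)
  also have "\<dots> = (\<integral>\<^sup>+g. f ((\<chi> i. g i) + a) * ennreal (exp (- (a \<bullet> (\<chi> i. g i) / h) - (norm a)\<^sup>2 / (2 * h))) \<partial>?P)"
  proof (intro nn_integral_cong arg_cong2[where f = "(*)"])
    fix g :: "'n \<Rightarrow> real"
    show "f (\<chi> i. (\<lambda>i\<in>UNIV. g i + a $ i) i) = f ((\<chi> i. g i) + a)"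
      by (rule arg_cong[of _ _ f]) (simp add: vec_eq_iff)
    have "(\<Prod>i\<in>UNIV. ?D i (g i)) = ennreal (exp (\<Sum>i\<in>UNIV. - (a $ i * g i / h) - (a $ i)\<^sup>2 / (2 * h)))"
      unfolding exp_sum[OF finite] by (rule prod_ennreal) simp
    also have "(\<Sum>i\<in>UNIV. - (a $ i * g i / h) - (a $ i)\<^sup>2 / (2 * h)) = - (a \<bullet> (\<chi> i. g i) / h) - (norm a)\<^sup>2 / (2 * h)"
      by (simp add: sum_subtractf sum_negf sum_divide_distrib inner_vec_def norm_sq_sum)
    finally show "(\<Prod>i\<in>UNIV. ?D i (g i)) = ennreal (exp (- (a \<bullet> (\<chi> i. g i) / h) - (norm a)\<^sup>2 / (2 * h)))" .
  qed
  also have "\<dots> = (\<integral>\<^sup>+z. f (z + a) * ennreal (exp (- (a \<bullet> z / h) - (norm a)\<^sup>2 / (2 * h))) \<partial>gauss h)"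
    unfolding gauss_def by (rule nn_integral_distr[OF chi_measurable_PiM, symmetric]) simp
  finally show ?thesis .
qed

text \<open>The discrete Cameron-Martin formula for a deterministic shift. The exponent is affine in
  \<open>w\<close>; for the control used later its linear part is a function of the final linear
  noise alone.\<close>

lemma gauss_PiM_shift:
  fixes a :: "nat \<Rightarrow> real^'n"
  assumes h: "0 < h" and f: "f \<in> borel_measurable (PiM {..<N} (\<lambda>_. gauss h))"
  shows "(\<integral>\<^sup>+w. f w \<partial>PiM {..<N} (\<lambda>_. gauss h))
    = (\<integral>\<^sup>+w. f (\<lambda>k\<in>{..<N}. w k + a k)
        * ennreal (exp (- ((\<Sum>k<N. a k \<bullet> w k) / h) - (\<Sum>k<N. (norm (a k))\<^sup>2) / (2 * h))) \<partial>PiM {..<N} (\<lambda>_. gauss h))"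
proof -
  let ?D = "\<lambda>k z. ennreal (exp (- (a k \<bullet> z / h) - (norm (a k))\<^sup>2 / (2 * h)))"
  have "(\<integral>\<^sup>+w. f w \<partial>PiM {..<N} (\<lambda>_. gauss h))
    = (\<integral>\<^sup>+w. f (\<lambda>k\<in>{..<N}. w k + a k) * (\<Prod>k\<in>{..<N}. ?D k (w k)) \<partial>PiM {..<N} (\<lambda>_. gauss h))"
    by (rule nn_integral_PiM_change[where \<tau> = "\<lambda>k z. z + a k"])
      (use f in \<open>auto intro: gauss_shift[OF h] prob_space_imp_sigma_finite[OF prob_space_gauss[OF h]]
        cong: measurable_cong_sets\<close>)
  also have "\<dots> = (\<integral>\<^sup>+w. f (\<lambda>k\<in>{..<N}. w k + a k)
        * ennreal (exp (- ((\<Sum>k<N. a k \<bullet> w k) / h) - (\<Sum>k<N. (norm (a k))\<^sup>2) / (2 * h))) \<partial>PiM {..<N} (\<lambda>_. gauss h))"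
  proof (intro nn_integral_cong arg_cong2[where f = "(*)"] refl)
    fix w :: "nat \<Rightarrow> real^'n"
    have "(\<Prod>k\<in>{..<N}. ?D k (w k)) = ennreal (exp (\<Sum>k<N. - (a k \<bullet> w k / h) - (norm (a k))\<^sup>2 / (2 * h)))"
      unfolding exp_sum[OF finite_lessThan] by (rule prod_ennreal) simp
    then show "(\<Prod>k\<in>{..<N}. ?D k (w k))
      = ennreal (exp (- ((\<Sum>k<N. a k \<bullet> w k) / h) - (\<Sum>k<N. (norm (a k))\<^sup>2) / (2 * h)))"
      by (simp only: sum_subtractf sum_negf sum_divide_distrib)
  qed
  finally show ?thesis .
qed

text \<open>\<open>wiener\<close> gives independence over the scalar pairs \<open>(j, i)\<close>.
  Grouping by \<open>j\<close> yields independent vector increments, while the joint law over all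
  pairs, restricted to one \<open>j\<close>, identifies the law of each of them.\<close>

lemma wiener_increments:
  fixes W :: "real \<Rightarrow> 'w \<Rightarrow> real^'n"
  assumes W: "wiener M W" and ts: "\<And>j. j < k \<Longrightarrow> 0 \<le> ts j \<and> ts j < ts (Suc j)" and k: "0 < k"
  shows "distr M (PiM {..<k} (\<lambda>_. borel)) (\<lambda>\<omega>. \<lambda>j\<in>{..<k}. W (ts (Suc j)) \<omega> - W (ts j) \<omega>)
    = PiM {..<k} (\<lambda>j. gauss (ts (Suc j) - ts j))"
proof -
  interpret prob_space M using W by (simp add: wiener_def)
  let ?Z = "\<lambda>(j, i) \<omega>. (W (ts (Suc j)) \<omega> - W (ts j) \<omega>) $ i"
  have ind: "indep_vars (\<lambda>_. borel) ?Z ({..<k} \<times> UNIV)"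
    and dens: "\<And>j i. j < k \<Longrightarrow> distributed M lborel (\<lambda>\<omega>. (W (ts (Suc j)) \<omega> - W (ts j) \<omega>) $ i)
                      (normal_density 0 (sqrt (ts (Suc j) - ts j)))"
    using W ts unfolding wiener_def by blast+
  have rv [measurable]: "W t \<in> borel_measurable M" for t using W by (simp add: wiener_def)
  have "indep_vars (\<lambda>j. PiM ({j} \<times> (UNIV :: 'n set)) (\<lambda>_. borel)) (\<lambda>j \<omega>. restrict (\<lambda>p. ?Z p \<omega>) ({j} \<times> UNIV)) {..<k}"
    by (rule indep_vars_restrict[OF ind]) (auto simp: disjoint_family_on_def)
  then have "indep_vars (\<lambda>_. borel) (\<lambda>j \<omega>. \<chi> i. (restrict (\<lambda>p. ?Z p \<omega>) ({j} \<times> UNIV)) (j, i)) {..<k}"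
    by (rule indep_vars_compose2) (intro vec_lambda_measurable measurable_component_singleton, auto)
  moreover have "(\<chi> i. (restrict (\<lambda>p. ?Z p \<omega>) ({j} \<times> UNIV)) (j, i)) = W (ts (Suc j)) \<omega> - W (ts j) \<omega>" for j \<omega>
    by (simp add: vec_eq_iff)
  ultimately have "indep_vars (\<lambda>_. borel) (\<lambda>j \<omega>. W (ts (Suc j)) \<omega> - W (ts j) \<omega>) {..<k}"
    by simp
  then have 1: "distr M (PiM {..<k} (\<lambda>_. borel)) (\<lambda>\<omega>. \<lambda>j\<in>{..<k}. W (ts (Suc j)) \<omega> - W (ts j) \<omega>)
    = PiM {..<k} (\<lambda>j. distr M borel (\<lambda>\<omega>. W (ts (Suc j)) \<omega> - W (ts j) \<omega>))"
    by (subst (asm) indep_vars_iff_distr_eq_PiM') (use k in auto)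
  let ?J = "{..<k} \<times> (UNIV :: 'n set)"
  have Zm: "?Z p \<in> borel_measurable M" for p
    unfolding split_beta by (rule measurable_compose[where N = borel and g = "\<lambda>z. z $ snd p"]) measurable
  let ?G = "\<lambda>p. gauss1 (ts (Suc (fst p)) - ts (fst p))"
  have "distr M (PiM ?J (\<lambda>_. borel)) (\<lambda>\<omega>. \<lambda>p\<in>?J. ?Z p \<omega>) = PiM ?J (\<lambda>p. distr M borel (?Z p))"
    using ind by (subst (asm) indep_vars_iff_distr_eq_PiM') (use k Zm in auto)
  also have "\<dots> = PiM ?J ?G"
  proof (rule PiM_cong[OF refl])
    fix p assume "p \<in> ?J"
    then obtain j i where p: "p = (j, i)" "j < k" by auto
    have "distr M borel (?Z p) = distr M lborel (?Z p)"
      by (rule distr_cong) auto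
    then show "distr M borel (?Z p) = ?G p"
      using distributed_distr_eq_density[OF dens[OF p(2), of i]] by (simp add: gauss1_def p(1))
  qed
  finally have 2: "distr M (PiM ?J (\<lambda>_. borel)) (\<lambda>\<omega>. \<lambda>p\<in>?J. ?Z p \<omega>) = PiM ?J ?G" .
  have "distr M borel (\<lambda>\<omega>. W (ts (Suc j)) \<omega> - W (ts j) \<omega>) = gauss (ts (Suc j) - ts j)" if j: "j < k" for j
  proof -
    let ?H = "\<lambda>_::'n. gauss1 (ts (Suc j) - ts j)"
    have "PiM UNIV ?H = distr (PiM ?J ?G) (PiM UNIV ?H) (\<lambda>w. \<lambda>i\<in>UNIV. w (j, i))"
    proof -
      have "prob_space (?G p)" if "p \<in> ?J" for p
        using that ts by (intro prob_space_gauss1) auto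
      from distr_PiM_reindex[of ?J ?G "Pair j" UNIV, OF this] show ?thesis
        using j by (simp add: inj_on_def Pi_iff)
    qed
    also have "\<dots> = distr M (PiM UNIV ?H) (\<lambda>\<omega>. \<lambda>i\<in>UNIV. ?Z (j, i) \<omega>)"
      unfolding 2[symmetric] using j
      by (subst distr_distr)
        (use Zm in \<open>auto simp: o_def cong: measurable_cong_sets sets_PiM_cong intro!: measurable_restrict\<close>)
    finally have eq: "PiM UNIV ?H = distr M (PiM UNIV ?H) (\<lambda>\<omega>. \<lambda>i\<in>UNIV. ?Z (j, i) \<omega>)" .
    show ?thesis unfolding gauss_def
      by (subst eq, subst distr_distr[OF chi_measurable_PiM])
        (use Zm in \<open>auto simp: o_def vec_eq_iff cong: measurable_cong_sets sets_PiM_cong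
          intro!: measurable_restrict distr_cong\<close>)
  qed
  then show ?thesis unfolding 1 by (intro PiM_cong) auto
qed

section \<open>Comparison of measures by test functions; transition operators and moment bound of
  the scheme\<close>

section \<open>The Euler scheme as a Markov chain\<close>

text \<open>Indicators of open sets are increasing limits of continuous functions built from the
  distance to the complement; outer regularity of \<open>\<mu>\<close> carries the inequality over
  to Borel sets. This is how estimates on the scheme reach the law of \<open>X\<close>.\<close>

lemma emeasure_le_of_continuous:
  fixes \<mu> \<nu> :: "'a::{second_countable_topology, complete_space} measure"
  assumes \<mu>: "sets \<mu> = sets borel" "finite_measure \<mu>" and \<nu>: "sets \<nu> = sets borel"
    and le: "\<And>f :: 'a \<Rightarrow> real. continuous_on UNIV f \<Longrightarrow> (\<And>x. 0 \<le> f x \<and> f x \<le> 1) \<Longrightarrow>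
      (\<integral>\<^sup>+x. ennreal (f x) \<partial>\<nu>) \<le> (\<integral>\<^sup>+x. ennreal (f x) \<partial>\<mu>)"
    and E: "E \<in> sets borel"
  shows "emeasure \<nu> E \<le> emeasure \<mu> E"
proof -
  have op: "emeasure \<nu> U \<le> emeasure \<mu> U" if U: "open U" for U
  \<comment> \<open>\<open>infdist\<close> to the empty set is 0 by convention, so the approximants
    below would vanish for the whole space.\<close>
  proof (cases "U = UNIV")
    case True
    have "space \<mu> = UNIV" "space \<nu> = UNIV" using sets_eq_imp_space_eq[OF \<mu>(1)] sets_eq_imp_space_eq[OF \<nu>] by simp_all
    then show ?thesis using le[of "\<lambda>_. 1"] True by simp
  next
    case False
    define f :: "nat \<Rightarrow> 'a \<Rightarrow> real" where "f m x = min 1 (m * infdist x (- U))" for m x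
    have cont: "continuous_on UNIV (f m)" for m
      unfolding f_def by (intro continuous_intros)
    have meas [measurable]: "f m \<in> borel_measurable borel" for m
      by (intro borel_measurable_continuous_onI cont)
    have f01: "0 \<le> f m x" "f m x \<le> 1" for m x by (auto simp: f_def infdist_nonneg)
    have sup: "(SUP m. ennreal (f m x)) = indicator U x" for x
    proof (cases "x \<in> U")
      case True
      have "0 < infdist x (- U)"
        using True U False infdist_pos_not_in_closed[of "- U" x] by (auto simp: closed_def)
      then obtain n :: nat where "1 < real n * infdist x (- U)" using reals_Archimedean3 by blast
      then have "f n x = 1" by (simp add: f_def)
      then have "1 \<le> (SUP m. ennreal (f m x))" by (metis SUP_upper UNIV_I ennreal_1)
      moreover have "(SUP m. ennreal (f m x)) \<le> 1" by (intro SUP_least) (simp add: f01)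
      ultimately show ?thesis using True by simp
    next
      case False
      then show ?thesis by (simp add: f_def)
    qed
    have inc: "incseq (\<lambda>m x. ennreal (f m x))"
      by (intro incseq_SucI le_funI ennreal_leI)
        (auto simp: f_def infdist_nonneg min_le_iff_disj intro!: mult_right_mono)
    have "(\<integral>\<^sup>+x. indicator U x \<partial>\<nu>) = (SUP m. \<integral>\<^sup>+x. ennreal (f m x) \<partial>\<nu>)"
      unfolding sup[symmetric]
      by (rule nn_integral_monotone_convergence_SUP[OF inc]) (use \<nu> in \<open>auto cong: measurable_cong_sets\<close>)
    also have "\<dots> \<le> (SUP m. \<integral>\<^sup>+x. ennreal (f m x) \<partial>\<mu>)"
      by (intro SUP_mono' le cont conjI f01)
    also have "\<dots> = (\<integral>\<^sup>+x. indicator U x \<partial>\<mu>)"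
      unfolding sup[symmetric]
      by (rule nn_integral_monotone_convergence_SUP[OF inc, symmetric]) (use \<mu> in \<open>auto cong: measurable_cong_sets\<close>)
    finally show ?thesis using U \<mu>(1) \<nu> by simp
  qed
  have "emeasure \<mu> E = (INF U \<in> {U. E \<subseteq> U \<and> open U}. emeasure \<mu> U)"
    using \<mu> E finite_measure.emeasure_finite[of \<mu> "space \<mu>"] by (intro outer_regular) auto
  moreover have "emeasure \<nu> E \<le> emeasure \<mu> U" if "E \<subseteq> U" "open U" for U
    using op[OF that(2)] that \<nu> by (intro order_trans[OF emeasure_mono[of E U \<nu>]]) auto
  ultimately show ?thesis by (auto intro!: INF_greatest)
qed

lemma measure_eq_of_continuous:
  fixes \<mu> \<nu> :: "'a::{second_countable_topology, complete_space} measure"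
  assumes "sets \<mu> = sets borel" "finite_measure \<mu>" "sets \<nu> = sets borel" "finite_measure \<nu>"
    and "\<And>f :: 'a \<Rightarrow> real. continuous_on UNIV f \<Longrightarrow> (\<And>x. 0 \<le> f x \<and> f x \<le> 1) \<Longrightarrow>
      (\<integral>\<^sup>+x. ennreal (f x) \<partial>\<nu>) = (\<integral>\<^sup>+x. ennreal (f x) \<partial>\<mu>)"
  shows "\<mu> = \<nu>"
  using assms
  by (intro measure_eqI antisym emeasure_le_of_continuous) auto

locale euler_scheme = stable_linop A K C0 c0
  for A :: "real^'d \<Rightarrow> real^'d" and K C0 c0 +
  fixes B :: "real^'n \<Rightarrow> real^'d" and F :: "real^'d \<Rightarrow> real^'d" and L :: real
  assumes linB: "linear B" and lipF: "L-lipschitz_on UNIV F"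
    and sublinear: "\<And>e. 0 < e \<Longrightarrow> \<exists>C. \<forall>x. norm (F x) \<le> e * norm x + C"
begin

abbreviation "eu \<equiv> euler A F B"
abbreviation "est \<equiv> euler_step A F B"

lemma continuous_F: "continuous_on S F"
  using lipschitz_on_continuous_on[OF lipF] continuous_on_subset by blast

lemma continuous_B: "continuous_on S B"
  using linB linear_conv_bounded_linear linear_continuous_on by blast

lemma continuous_opexp: "continuous_on S (opexp A h)"
  using linear_opexp linear_conv_bounded_linear linear_continuous_on by blast

lemma measurable_F [measurable]: "F \<in> borel_measurable borel"
  by (intro borel_measurable_continuous_onI continuous_F)

lemma measurable_B [measurable]: "B \<in> borel_measurable borel"
  by (intro borel_measurable_continuous_onI continuous_B)

lemma measurable_opexp [measurable]: "opexp A h \<in> borel_measurable borel"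
  by (intro borel_measurable_continuous_onI continuous_opexp)

lemma measurable_step [measurable (raw)]:
  assumes [measurable]: "g \<in> borel_measurable M" "u \<in> borel_measurable M"
  shows "(\<lambda>\<omega>. est h (g \<omega>) (u \<omega>)) \<in> borel_measurable M"
  unfolding euler_step_def by measurable

lemma measurable_euler:
  assumes g: "g \<in> borel_measurable M"
  shows "(\<And>j. j < k \<Longrightarrow> (\<lambda>\<omega>. u \<omega> j) \<in> borel_measurable M) \<Longrightarrow> (\<lambda>\<omega>. eu h (g \<omega>) (u \<omega>) k) \<in> borel_measurable M"
proof (induction k)
  case (Suc k)
  then show ?case using measurable_step[of "\<lambda>\<omega>. eu h (g \<omega>) (u \<omega>) k" M "\<lambda>\<omega>. u \<omega> k"] by simp
qed (use g in simp)

lemma euler_cong: "(\<And>j. j < k \<Longrightarrow> u j = u' j) \<Longrightarrow> eu h x u k = eu h x u' k"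
  by (induction k) auto

lemma continuous_euler: "continuous_on S (\<lambda>x. eu h x u k)"
proof (induction k)
  case (Suc k)
  then show ?case unfolding euler.simps euler_step_def
    by (intro continuous_on_compose2[OF continuous_opexp[of UNIV]] continuous_intros
        continuous_on_compose2[OF continuous_F[of UNIV]]) auto
qed simp

text \<open>Transition operator of one step, acting on nonnegative functions so that it can be
  iterated freely, also on the unbounded \<open>V\<close>.\<close>

definition Kop :: "real \<Rightarrow> (real^'d \<Rightarrow> ennreal) \<Rightarrow> real^'d \<Rightarrow> ennreal" where
  "Kop h f y = (\<integral>\<^sup>+z. f (est h y z) \<partial>gauss h)"

lemma Kop_measurable:
  assumes h: "0 < h" and [measurable]: "f \<in> borel_measurable borel"
  shows "Kop h f \<in> borel_measurable borel"
proof -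
  interpret prob_space "gauss h :: (real^'n) measure" by (rule prob_space_gauss[OF h])
  show ?thesis unfolding Kop_def by measurable
qed

lemma Kop_funpow_measurable:
  "0 < h \<Longrightarrow> f \<in> borel_measurable borel \<Longrightarrow> (Kop h ^^ n) f \<in> borel_measurable borel"
  by (induction n) (auto intro: Kop_measurable)

lemma Kop_mono: "(\<And>y. f y \<le> g y) \<Longrightarrow> Kop h f x \<le> Kop h g x"
  unfolding Kop_def by (intro nn_integral_mono) auto

text \<open>Induction on the number \<open>N\<close> of coordinates: the last increment either does
  not influence the first \<open>k\<close> steps and integrates to 1, or it drives the final step.
  Allowing \<open>k < N\<close> lets intermediate times be treated on the same product
  space.\<close>

lemma euler_law:
  assumes h: "0 < h" and f [measurable]: "f \<in> borel_measurable borel" and k: "k \<le> N"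
  shows "(\<integral>\<^sup>+w. f (eu h x w k) \<partial>PiM {..<N} (\<lambda>_. gauss h)) = (Kop h ^^ k) f x"
  using k f
proof (induction N arbitrary: k f)
  case 0
  then show ?case by (simp add: PiM_empty nn_integral_count_space_finite)
next
  case (Suc N)
  interpret product_prob_space "\<lambda>_::nat. gauss h :: (real^'n) measure"
    by (intro product_prob_spaceI prob_space_gauss h)
  note [measurable] = Suc.prems(2)
  let ?P = "\<lambda>N. PiM {..<N} (\<lambda>_::nat. gauss h :: (real^'n) measure)"
  have em: "(\<lambda>w. eu h x w k) \<in> borel_measurable (?P N)" if "k \<le> N" for k N
    using that by (intro measurable_euler) (auto intro!: measurable_component_singleton
      simp: measurable_cong_sets[OF refl sets_gauss, symmetric] cong: measurable_cong_sets)
  have "(\<integral>\<^sup>+w. f (eu h x w k) \<partial>?P (Suc N)) = (\<integral>\<^sup>+w. (\<integral>\<^sup>+y. f (eu h x (w(N := y)) k) \<partial>gauss h) \<partial>?P N)"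
    unfolding lessThan_Suc
    by (rule product_nn_integral_insert) (use em[OF Suc.prems(1)] in \<open>auto simp: lessThan_Suc[symmetric]\<close>)
  also have "\<dots> = (Kop h ^^ k) f x"
  proof (cases "k \<le> N")
    case True
    have "eu h x (w(N := y)) k = eu h x w k" for w y using True by (intro euler_cong) auto
    then show ?thesis using Suc.IH[OF True Suc.prems(2)] by (simp add: M.emeasure_space_1[simplified])
  next
    case False
    then have k: "k = Suc N" using Suc.prems by simp
    have "eu h x (w(N := y)) (Suc N) = est h (eu h x w N) y" for w y
      using euler_cong[of N "w(N := y)" w] by simp
    then have "(\<integral>\<^sup>+w. (\<integral>\<^sup>+y. f (eu h x (w(N := y)) k) \<partial>gauss h) \<partial>?P N) = (\<integral>\<^sup>+w. Kop h f (eu h x w N) \<partial>?P N)"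
      by (simp add: k Kop_def)
    also have "\<dots> = (Kop h ^^ N) (Kop h f) x" by (intro Suc.IH Kop_measurable h Suc.prems) simp
    finally show ?thesis by (simp add: k funpow_swap1)
  qed
  finally show ?case .
qed

text \<open>Two consecutive runs with different meshes, as required for the Chapman-Kolmogorov
  equation at times whose ratio is arbitrary.\<close>

lemma euler_law_two:
  assumes h: "0 < h" "0 < h'" and f [measurable]: "f \<in> borel_measurable borel"
  shows "(\<integral>\<^sup>+w. f (eu h' (eu h x w m) (\<lambda>j. w (m + j)) n) \<partial>PiM {..<m + n} (\<lambda>j. gauss (if j < m then h else h')))
    = (Kop h ^^ m) ((Kop h' ^^ n) f) x"
  using f
proof (induction n arbitrary: f)
  case 0
  have "PiM {..<m} (\<lambda>j. gauss (if j < m then h else h') :: (real^'n) measure) = PiM {..<m} (\<lambda>j. gauss h)"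
    by (intro PiM_cong) auto
  then show ?case using euler_law[OF h(1) 0, of m m x] by simp
next
  case (Suc n)
  interpret product_prob_space "\<lambda>j::nat. gauss (if j < m then h else h') :: (real^'n) measure"
    by (intro product_prob_spaceI prob_space_gauss) (use h in auto)
  note [measurable] = Suc.prems
  let ?P = "\<lambda>N. PiM {..<N} (\<lambda>j::nat. gauss (if j < m then h else h') :: (real^'n) measure)"
  let ?e = "\<lambda>n w. eu h' (eu h x w m) (\<lambda>j. w (m + j)) n"
  have em: "(\<lambda>w. ?e n w) \<in> borel_measurable (?P (m + n))" for n
    by (intro measurable_euler) (auto intro!: measurable_component_singleton
      simp: measurable_cong_sets[OF refl sets_gauss, symmetric] cong: measurable_cong_sets)
  have eq: "?e (Suc n) (w(m + n := y)) = est h' (?e n w) y" for w y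
  proof -
    have "eu h x (w(m + n := y)) m = eu h x w m" by (intro euler_cong) auto
    then show ?thesis using euler_cong[of n "\<lambda>j. (w(m + n := y)) (m + j)" "\<lambda>j. w (m + j)" h'] by simp
  qed
  have "(\<integral>\<^sup>+w. f (?e (Suc n) w) \<partial>?P (m + Suc n))
    = (\<integral>\<^sup>+w. (\<integral>\<^sup>+y. f (?e (Suc n) (w(m + n := y))) \<partial>gauss (if m + n < m then h else h')) \<partial>?P (m + n))"
    unfolding add_Suc_right lessThan_Suc
    by (rule product_nn_integral_insert) (use em[of "Suc n"] in \<open>auto simp: lessThan_Suc[symmetric]\<close>)
  also have "\<dots> = (\<integral>\<^sup>+w. Kop h' f (?e n w) \<partial>?P (m + n))"
    unfolding eq by (simp add: Kop_def)
  also have "\<dots> = (Kop h ^^ m) ((Kop h' ^^ n) (Kop h' f)) x"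
    by (intro Suc.IH Kop_measurable h Suc.prems)
  finally show ?case by (simp add: funpow_swap1)
qed

text \<open>\<open>V\<close> is quadratic, so the noise contributes a cross term, linear in
  \<open>z\<close> and hence centred, and a quadratic term whose mean is of the order of the
  variance, i.e. of \<open>h\<close>.\<close>

lemma V_step_bound:
  obtains k h0 C where "0 < k" "0 < h0" "0 \<le> C" "k * h0 \<le> 1"
    "\<And>h x. 0 < h \<Longrightarrow> h \<le> h0 \<Longrightarrow> Kop h (\<lambda>y. ennreal (V y)) x \<le> ennreal ((1 - k * h) * V x + C * h)"
proof -
  obtain k h0 C where kh: "0 < k" "0 < h0" "0 \<le> C" "k * h0 \<le> 1"
    "\<And>h x. 0 \<le> h \<Longrightarrow> h \<le> h0 \<Longrightarrow> V (opexp A h (x + h *\<^sub>R F x)) \<le> (1 - k * h) * V x + C * h"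
    using V_drift[of F, OF sublinear] by blast
  obtain cV where cV: "0 < cV" "\<And>x. V x \<le> cV * (norm x)\<^sup>2" using V_upper by blast
  obtain KB where KB: "1 \<le> KB" "\<And>x. norm (B x) \<le> KB * norm x" using linear_norm_bound[OF linB] by blast
  define C' where "C' = cV * KB\<^sup>2 * CARD('n)"
  have C': "0 \<le> C'" using cV by (simp add: C'_def)
  have "Kop h (\<lambda>y. ennreal (V y)) x \<le> ennreal ((1 - k * h) * V x + (C + C') * h)" if h: "0 < h" "h \<le> h0" for h x
  proof -
    interpret G: prob_space "gauss h :: (real^'n) measure" by (rule prob_space_gauss[OF h(1)])
    define y where "y = opexp A h (x + h *\<^sub>R F x)"
    define l where "l z = 2 * Q y (opexp A h (B z))" for z
    have linl: "linear l" unfolding l_def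
      by (intro linearI)
        (simp_all add: linear_add[OF linB] linear_cmul[OF linB] opexp_add opexp_scale Q_add_right Q_scale_right)
    define c where "c i = l (axis i 1)" for i
    have l: "l = (\<lambda>z. \<Sum>i\<in>UNIV. z $ i * c i)"
    proof
      fix z
      have "l z = l (\<Sum>i\<in>UNIV. z $ i *\<^sub>R axis i 1)"
        by (rule arg_cong[of _ _ l]) (simp add: vec_eq_iff axis_def if_distrib cong: if_cong)
      also have "\<dots> = (\<Sum>i\<in>UNIV. z $ i * c i)"
        by (simp add: linear_sum[OF linl] linear_cmul[OF linl] c_def)
      finally show "l z = (\<Sum>i\<in>UNIV. z $ i * c i)" .
    qed
    have int_l: "integrable (gauss h) l" and l0: "(\<integral>z. l z \<partial>gauss h) = 0"
      unfolding l
      by (auto intro!: Bochner_Integration.integrable_sum integrable_mult_left gauss_mean h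
          simp: Bochner_Integration.integral_sum gauss_mean[OF h(1)])
    have "V (est h x z) \<le> V y + l z + cV * KB\<^sup>2 * (norm z)\<^sup>2" for z
    proof -
      have "est h x z = y + opexp A h (B z)" by (simp add: euler_step_def y_def opexp_add)
      then have "V (est h x z) = V y + l z + V (opexp A h (B z))" by (simp add: V_add l_def)
      also have "V (opexp A h (B z)) \<le> V (B z)" using h by (intro V_opexp_le) auto
      also have "V (B z) \<le> cV * (norm (B z))\<^sup>2" by (rule cV)
      also have "\<dots> \<le> cV * (KB * norm z)\<^sup>2" using cV KB by (intro mult_left_mono power_mono) auto
      finally show ?thesis by (simp add: power_mult_distrib mult.assoc)
    qed
    then have "Kop h (\<lambda>y. ennreal (V y)) x \<le> (\<integral>\<^sup>+z. ennreal (V y + l z + cV * KB\<^sup>2 * (norm z)\<^sup>2) \<partial>gauss h)"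
      unfolding Kop_def by (intro nn_integral_mono ennreal_leI)
    also have "\<dots> = ennreal (\<integral>z. V y + l z + cV * KB\<^sup>2 * (norm z)\<^sup>2 \<partial>gauss h)"
    proof (rule nn_integral_eq_integral)
      show "integrable (gauss h) (\<lambda>z::real^'n. V y + l z + cV * KB\<^sup>2 * (norm z)\<^sup>2)"
        by (intro Bochner_Integration.integrable_add int_l integrable_mult_right gauss_variance h) simp
      show "AE z in gauss h. 0 \<le> V y + l z + cV * KB\<^sup>2 * (norm z)\<^sup>2"
        using order_trans[OF V_nonneg \<open>\<And>z. V (est h x z) \<le> V y + l z + cV * KB\<^sup>2 * (norm z)\<^sup>2\<close>] by simp
    qed
    also have "(\<integral>z. V y + l z + cV * KB\<^sup>2 * (norm z)\<^sup>2 \<partial>gauss h) = V y + C' * h"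
      using int_l l0 gauss_variance[OF h(1), where 'n = 'n] G.prob_space by (simp add: C'_def)
    also have "\<dots> \<le> (1 - k * h) * V x + (C + C') * h"
      using kh(5)[of h x] h by (simp add: y_def algebra_simps)
    finally show ?thesis by (simp add: ennreal_leI)
  qed
  then show ?thesis using kh C' by (intro that[of k h0 "C + C'"]) auto
qed

text \<open>The map \<open>v -> (1 - k h) v + C h\<close> has the fixed point \<open>C / k\<close>
  for every mesh, so the additive errors never sum to more than \<open>C / k\<close>, however many
  steps are made.\<close>

lemma V_euler_bound:
  obtains k h0 C where "0 < k" "0 < h0" "0 \<le> C"
    "\<And>h n x. 0 < h \<Longrightarrow> h \<le> h0 \<Longrightarrow> (Kop h ^^ n) (\<lambda>y. ennreal (V y)) x \<le> ennreal (exp (- k * (n * h)) * V x + C)"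
proof -
  obtain k h0 C where kh: "0 < k" "0 < h0" "0 \<le> C" "k * h0 \<le> 1"
    "\<And>h x. 0 < h \<Longrightarrow> h \<le> h0 \<Longrightarrow> Kop h (\<lambda>y. ennreal (V y)) x \<le> ennreal ((1 - k * h) * V x + C * h)"
    using V_step_bound by blast
  have "(Kop h ^^ n) (\<lambda>y. ennreal (V y)) x \<le> ennreal (exp (- k * (n * h)) * V x + C / k)" if h: "0 < h" "h \<le> h0" for h n x
  proof -
    interpret G: prob_space "gauss h :: (real^'n) measure" by (rule prob_space_gauss[OF h(1)])
    have kh1: "k * h \<le> 1" using order_trans[OF mult_left_mono[OF h(2)] kh(4)] kh(1) by simp
    define a where "a n = (1 - k * h) ^ n" for n
    have a: "0 \<le> a n" "a n \<le> 1" for n using kh1 kh h by (auto simp: a_def power_le_one)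
    have "(Kop h ^^ n) (\<lambda>y. ennreal (V y)) x \<le> ennreal (a n * V x + C / k * (1 - a n))" for x
    proof (induction n arbitrary: x)
      case 0
      show ?case by (simp add: a_def)
    next
      case (Suc n)
      have b: "0 \<le> C / k * (1 - a n)" using kh a[of n] by simp
      have "(Kop h ^^ Suc n) (\<lambda>y. ennreal (V y)) x \<le> Kop h (\<lambda>y. ennreal (a n * V y + C / k * (1 - a n))) x"
        using Suc by (simp, intro Kop_mono) 
      also have "\<dots> = (\<integral>\<^sup>+z. ennreal (a n) * ennreal (V (est h x z)) + ennreal (C / k * (1 - a n)) \<partial>gauss h)"
        unfolding Kop_def using a b V_nonneg by (intro nn_integral_cong) (simp add: ennreal_plus ennreal_mult)
      also have "\<dots> = ennreal (a n) * Kop h (\<lambda>y. ennreal (V y)) x + ennreal (C / k * (1 - a n))"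
        unfolding Kop_def by (subst nn_integral_add) (auto simp: nn_integral_cmult G.emeasure_space_1[simplified])
      also have "\<dots> \<le> ennreal (a n) * ennreal ((1 - k * h) * V x + C * h) + ennreal (C / k * (1 - a n))"
        by (intro add_mono mult_left_mono kh(5) h) auto
      also have "\<dots> = ennreal (a n * ((1 - k * h) * V x + C * h) + C / k * (1 - a n))"
        using a b V_nonneg kh1 kh h by (subst ennreal_plus) (auto simp: ennreal_mult)
      also have "a n * ((1 - k * h) * V x + C * h) + C / k * (1 - a n) = a (Suc n) * V x + C / k * (1 - a (Suc n))"
        using kh by (simp add: a_def field_simps)
      finally show ?case .
    qed
    also have "ennreal (a n * V x + C / k * (1 - a n)) \<le> ennreal (exp (- k * (n * h)) * V x + C / k)"
    proof (intro ennreal_leI add_mono mult_right_mono V_nonneg)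
      have "a n \<le> exp (- (k * h)) ^ n" unfolding a_def
        using exp_ge_add_one_self[of "- (k * h)"] kh1 by (intro power_mono) auto
      also have "\<dots> = exp (- k * (n * h))" by (simp add: exp_of_nat_mult[symmetric] algebra_simps)
      finally show "a n \<le> exp (- k * (n * h))" .
      have "C / k * (1 - a n) \<le> C / k * 1" using a kh by (intro mult_left_mono) auto
      then show "C / k * (1 - a n) \<le> C / k" by simp
    qed
    finally show ?thesis .
  qed
  then show ?thesis using kh by (intro that[of k h0 "C / k"]) auto
qed

end

section \<open>Measurability, Chapman-Kolmogorov equation and drift inequality for the solution
  itself\<close>

section \<open>The transition semigroup\<close>

locale sde = euler_scheme A K C0 c0 B F L
  for A :: "real^'d \<Rightarrow> real^'d" and K C0 c0 and B :: "real^'n \<Rightarrow> real^'d" and F L +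
  fixes M :: "'w measure" and W :: "real \<Rightarrow> 'w \<Rightarrow> real^'n" and X :: "real \<Rightarrow> real^'d \<Rightarrow> 'w \<Rightarrow> real^'d"
  assumes W: "wiener M W"
    and X: "\<And>x \<omega>. \<omega> \<in> space M \<Longrightarrow> continuous_on {0..} (\<lambda>t. X t x \<omega>) \<and>
              (\<forall>t\<ge>0. X t x \<omega> = x + integral {0..t} (\<lambda>s. A (X s x \<omega>) + F (X s x \<omega>)) + B (W t \<omega>))"
begin

sublocale prob_space M
  using W by (simp add: wiener_def)

definition incr :: "real \<Rightarrow> real \<Rightarrow> 'w \<Rightarrow> nat \<Rightarrow> real^'n" where
  "incr s h \<omega> k = W (s + real (Suc k) * h) \<omega> - W (s + real k * h) \<omega>"

lemma incr_measurable [measurable]: "(\<lambda>\<omega>. incr s h \<omega> k) \<in> borel_measurable M"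
proof -
  have [measurable]: "W t \<in> borel_measurable M" for t using W by (simp add: wiener_def)
  show ?thesis unfolding incr_def by measurable
qed

lemma X_0: "\<omega> \<in> space M \<Longrightarrow> X 0 x \<omega> = x"
proof -
  assume \<omega>: "\<omega> \<in> space M"
  then have "W 0 \<omega> = 0" using W by (simp add: wiener_def)
  moreover have "X 0 x \<omega> = x + integral {0..0} (\<lambda>s. A (X s x \<omega>) + F (X s x \<omega>)) + B (W 0 \<omega>)"
    using X[OF \<omega>, of x] by blast
  ultimately show ?thesis by (simp add: linear_0[OF linB])
qed

text \<open>Restarted at time \<open>s\<close>, the path solves the same integral equation from
  \<open>X s x \<omega>\<close>, driven by the increments of the Wiener path after
  \<open>s\<close>.\<close>

lemma euler_tendsto_X:
  assumes \<omega>: "\<omega> \<in> space M" and s: "0 \<le> s" and t: "0 \<le> t"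
  shows "(\<lambda>n. eu (t / n) (X s x \<omega>) (incr s (t / n) \<omega>) n) \<longlonglongrightarrow> X (s + t) x \<omega>"
proof -
  let ?Y = "\<lambda>r. X (s + r) x \<omega>"
  let ?g = "\<lambda>r. A (X r x \<omega>) + F (X r x \<omega>)"
  have cX: "continuous_on {0..} (\<lambda>t. X t x \<omega>)" and
    eX: "\<And>t. 0 \<le> t \<Longrightarrow> X t x \<omega> = x + integral {0..t} ?g + B (W t \<omega>)"
    using X[OF \<omega>] by blast+
  have contA: "continuous_on UNIV A"
    using lin linear_conv_bounded_linear linear_continuous_on by blast
  have cg: "continuous_on {0..} ?g"
    by (intro continuous_intros continuous_on_compose2[OF contA cX] continuous_on_compose2[OF continuous_F[of UNIV] cX]) auto
  have "(\<lambda>n. eu (t / n) (?Y 0) (incr s (t / n) \<omega>) n) \<longlonglongrightarrow> ?Y t"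
  proof (rule euler_converges[OF lipF t])
    show "continuous_on {0..t} ?Y"
      by (rule continuous_on_compose2[OF cX]) (use s in \<open>auto intro!: continuous_intros\<close>)
    show "?Y r = ?Y 0 + integral {0..r} (\<lambda>s. A (?Y s) + F (?Y s)) + (B (W (s + r) \<omega>) - B (W s \<omega>))"
      if r: "r \<in> {0..t}" for r
    proof -
      have "integral {0..r} (?g \<circ> (\<lambda>u. u + s)) = integral {0 + s..r + s} ?g"
        by (rule integral_shift) (use s in \<open>auto intro: continuous_on_subset[OF cg]\<close>)
      moreover have "integral {0..s} ?g + integral {s..r + s} ?g = integral {0..r + s} ?g"
        using r s by (intro Henstock_Kurzweil_Integration.integral_combine
            integrable_continuous_real continuous_on_subset[OF cg]) auto
      ultimately show ?thesis using eX[of s] eX[of "s + r"] r s by (simp add: o_def add.commute)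
    qed
    show "B (incr s (t / n) \<omega> k) = (B (W (s + real (Suc k) * (t / n)) \<omega>) - B (W s \<omega>)) - (B (W (s + real k * (t / n)) \<omega>) - B (W s \<omega>))" for n k
      by (simp add: incr_def linear_diff[OF linB])
  qed
  then show ?thesis by simp
qed

lemma euler_tendsto_X0:
  assumes "\<omega> \<in> space M" "0 \<le> t"
  shows "(\<lambda>n. eu (t / n) x (incr 0 (t / n) \<omega>) n) \<longlonglongrightarrow> X t x \<omega>"
  using euler_tendsto_X[OF assms(1) order_refl assms(2), of x] X_0[OF assms(1)] by simp

text \<open>The hypotheses on \<open>X\<close> are pathwise; joint measurability comes from the
  scheme, which is a measurable function of the starting point and of finitely many
  increments.\<close>

lemma X_measurable_pair:
  assumes t: "0 \<le> t"
  shows "(\<lambda>p. X t (fst p) (snd p)) \<in> borel_measurable (borel \<Otimes>\<^sub>M M)"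
proof (rule borel_measurable_LIMSEQ_metric)
  show "(\<lambda>p. eu (t / n) (fst p) (incr 0 (t / n) (snd p)) n) \<in> borel_measurable (borel \<Otimes>\<^sub>M M)" for n
    by (rule measurable_euler) measurable
  show "(\<lambda>n. eu (t / n) (fst p) (incr 0 (t / n) (snd p)) n) \<longlonglongrightarrow> X t (fst p) (snd p)"
    if "p \<in> space (borel \<Otimes>\<^sub>M M)" for p
    using that by (intro euler_tendsto_X0 t) (auto simp: space_pair_measure)
qed

lemma X_measurable: "0 \<le> t \<Longrightarrow> X t x \<in> borel_measurable M"
  using measurable_compose[OF measurable_Pair1' X_measurable_pair, of x t] by simp

lemma prob_space_transP: "0 \<le> t \<Longrightarrow> prob_space (transP M X t x)"
  unfolding transP_def by (intro prob_space_distr X_measurable)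

lemma sets_transP [simp, measurable_cong]: "sets (transP M X t x) = sets borel"
  by (simp add: transP_def)

lemma space_transP [simp]: "space (transP M X t x) = UNIV"
  by (simp add: transP_def)

lemma transP_measurable:
  assumes t: "0 \<le> t"
  shows "transP M X t \<in> measurable borel (subprob_algebra borel)"
proof -
  have "(\<lambda>x. distr M borel (X t x)) \<in> measurable borel (subprob_algebra borel)"
    by (rule measurable_distr2[where M = M])
      (use X_measurable_pair[OF t] in \<open>auto simp: split_beta space_subprob_algebra
        intro!: measurable_const prob_space_imp_subprob_space prob_space_axioms\<close>)
  then show ?thesis by (simp add: transP_def[abs_def])
qed

lemma nn_integral_transP:
  "0 \<le> t \<Longrightarrow> f \<in> borel_measurable borel \<Longrightarrow> (\<integral>\<^sup>+y. f y \<partial>transP M X t x) = (\<integral>\<^sup>+\<omega>. f (X t x \<omega>) \<partial>M)"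
  unfolding transP_def by (intro nn_integral_distr X_measurable) auto

lemma transP_0: "transP M X 0 x = return borel x"
proof -
  have "transP M X 0 x = distr M borel (\<lambda>_. x)"
    unfolding transP_def by (intro distr_cong) (auto simp: X_0)
  then show ?thesis by (simp add: distr_const)
qed

lemma euler_incr_law:
  assumes t: "0 < t" and n: "0 < n" and f [measurable]: "f \<in> borel_measurable borel"
  shows "(\<integral>\<^sup>+\<omega>. f (eu (t / n) x (incr 0 (t / n) \<omega>) n) \<partial>M) = (Kop (t / n) ^^ n) f x"
proof -
  let ?ts = "\<lambda>j::nat. real j * (t / n)"
  let ?inc = "\<lambda>\<omega>. \<lambda>j\<in>{..<n}. W (?ts (Suc j)) \<omega> - W (?ts j) \<omega>"
  have h: "0 < t / n" using t n by simp
  have d: "?ts (Suc j) - ?ts j = t / n" for j by (simp add: algebra_simps add_divide_distrib)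
  have ts: "0 \<le> ?ts j \<and> ?ts j < ?ts (Suc j)" for j
    using d[of j] h t by (intro conjI) (simp, linarith)
  have "distr M (PiM {..<n} (\<lambda>_. borel)) ?inc = PiM {..<n} (\<lambda>j. gauss (?ts (Suc j) - ?ts j))"
    by (rule wiener_increments[where ts = ?ts, OF W ts n])
  then have law: "distr M (PiM {..<n} (\<lambda>_. borel)) ?inc = PiM {..<n} (\<lambda>_. gauss (t / n))"
    unfolding d .
  have "(Kop (t / n) ^^ n) f x = (\<integral>\<^sup>+w. f (eu (t / n) x w n) \<partial>PiM {..<n} (\<lambda>_. gauss (t / n)))"
    by (rule euler_law[OF h f order_refl, symmetric])
  also have "\<dots> = (\<integral>\<^sup>+\<omega>. f (eu (t / n) x (?inc \<omega>) n) \<partial>M)"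
    unfolding law[symmetric]
  proof (rule nn_integral_distr, unfold measurable_distr_eq1)
    show "?inc \<in> measurable M (PiM {..<n} (\<lambda>_. borel))"
      using incr_measurable[of 0 "t / n"] by (intro measurable_restrict) (simp add: incr_def)
    show "(\<lambda>w. f (eu (t / n) x w n)) \<in> borel_measurable (PiM {..<n} (\<lambda>_. borel))"
      by (intro measurable_compose[OF measurable_euler f]) auto
  qed
  also have "\<dots> = (\<integral>\<^sup>+\<omega>. f (eu (t / n) x (incr 0 (t / n) \<omega>) n) \<partial>M)"
    by (intro nn_integral_cong arg_cong[of _ _ f] euler_cong) (simp add: incr_def)
  finally show ?thesis ..
qed

text \<open>One partition of \<open>[0, s + t]\<close> with \<open>m\<close> steps up to time
  \<open>s\<close> and \<open>n\<close> steps afterwards; independence of all its increments is the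
  discrete form of the Markov property at time \<open>s\<close>.\<close>

lemma euler_incr_law_two:
  assumes s: "0 < s" and t: "0 < t" and m: "0 < m" and n: "0 < n"
    and f [measurable]: "f \<in> borel_measurable borel"
  shows "(\<integral>\<^sup>+\<omega>. f (eu (t / n) (eu (s / m) x (incr 0 (s / m) \<omega>) m) (incr s (t / n) \<omega>) n) \<partial>M)
    = (Kop (s / m) ^^ m) ((Kop (t / n) ^^ n) f) x"
proof -
  let ?ts = "\<lambda>j::nat. if j \<le> m then real j * (s / m) else s + real (j - m) * (t / n)"
  let ?inc = "\<lambda>\<omega>. \<lambda>j\<in>{..<m + n}. W (?ts (Suc j)) \<omega> - W (?ts j) \<omega>"
  have h: "0 < s / m" "0 < t / n" using s t m n by auto
  have ms: "real m * (s / m) = s" using m by simp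
  have d: "?ts (Suc j) - ?ts j = (if j < m then s / m else t / n)" for j
  proof (cases "j < m")
    case False
    then show ?thesis using ms
      by (cases "j = m") (auto simp: Suc_diff_le algebra_simps add_divide_distrib)
  qed (simp add: algebra_simps add_divide_distrib)
  have pos: "0 \<le> ?ts j" for j using s t by simp
  have ts: "0 \<le> ?ts j \<and> ?ts j < ?ts (Suc j)" for j
    using pos[of j] d[of j] h by (metis diff_gt_0_iff_gt)
  have "distr M (PiM {..<m + n} (\<lambda>_. borel)) ?inc = PiM {..<m + n} (\<lambda>j. gauss (?ts (Suc j) - ?ts j))"
    by (rule wiener_increments[where ts = ?ts, OF W ts]) (use n in simp)
  then have law: "distr M (PiM {..<m + n} (\<lambda>_. borel)) ?inc = PiM {..<m + n} (\<lambda>j. gauss (if j < m then s / m else t / n))"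
    unfolding d .
  have "(Kop (s / m) ^^ m) ((Kop (t / n) ^^ n) f) x = (\<integral>\<^sup>+w. f (eu (t / n) (eu (s / m) x w m) (\<lambda>j. w (m + j)) n)
      \<partial>PiM {..<m + n} (\<lambda>j. gauss (if j < m then s / m else t / n)))"
    by (rule euler_law_two[OF h f, symmetric])
  also have "\<dots> = (\<integral>\<^sup>+\<omega>. f (eu (t / n) (eu (s / m) x (?inc \<omega>) m) (\<lambda>j. ?inc \<omega> (m + j)) n) \<partial>M)"
    unfolding law[symmetric]
  proof (rule nn_integral_distr, unfold measurable_distr_eq1)
    have [measurable]: "W t \<in> borel_measurable M" for t using W by (simp add: wiener_def)
    show "?inc \<in> measurable M (PiM {..<m + n} (\<lambda>_. borel))"
      by (intro measurable_restrict borel_measurable_diff) measurable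
    show "(\<lambda>w. f (eu (t / n) (eu (s / m) x w m) (\<lambda>j. w (m + j)) n)) \<in> borel_measurable (PiM {..<m + n} (\<lambda>_. borel))"
      by (intro measurable_compose[OF measurable_euler f] measurable_euler) auto
  qed
  also have "\<dots> = (\<integral>\<^sup>+\<omega>. f (eu (t / n) (eu (s / m) x (incr 0 (s / m) \<omega>) m) (incr s (t / n) \<omega>) n) \<partial>M)"
  proof (intro nn_integral_cong arg_cong[of _ _ f])
    fix \<omega>
    have 1: "eu (s / m) x (?inc \<omega>) m = eu (s / m) x (incr 0 (s / m) \<omega>) m"
      by (rule euler_cong) (auto simp: incr_def)
    have 2: "(\<lambda>j. ?inc \<omega> (m + j)) j = incr s (t / n) \<omega> j" if "j < n" for j
      using that ms by (cases j) (auto simp: incr_def)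
    show "eu (t / n) (eu (s / m) x (?inc \<omega>) m) (\<lambda>j. ?inc \<omega> (m + j)) n
      = eu (t / n) (eu (s / m) x (incr 0 (s / m) \<omega>) m) (incr s (t / n) \<omega>) n"
      unfolding 1 by (rule euler_cong[OF 2])
  qed
  finally show ?thesis ..
qed

lemma nn_integral_bounded_convergence:
  fixes u :: "nat \<Rightarrow> 'w \<Rightarrow> ennreal"
  assumes "\<And>i. u i \<in> borel_measurable M" "u' \<in> borel_measurable M" "\<And>i \<omega>. u i \<omega> \<le> 1"
    "\<And>\<omega>. \<omega> \<in> space M \<Longrightarrow> (\<lambda>i. u i \<omega>) \<longlonglongrightarrow> u' \<omega>"
  shows "(\<lambda>i. \<integral>\<^sup>+\<omega>. u i \<omega> \<partial>M) \<longlonglongrightarrow> (\<integral>\<^sup>+\<omega>. u' \<omega> \<partial>M)"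
  by (rule nn_integral_dominated_convergence[where w = "\<lambda>_. 1"]) (use assms in \<open>auto simp: emeasure_space_1\<close>)

text \<open>The mesh on \<open>[0, s]\<close> is refined first, with the mesh on \<open>[s, s + t]\<close> fixed, so that mere continuity
  of the discrete transition operators suffices.\<close>
lemma chapman_kolmogorov_pos:
  assumes s: "0 < s" and t: "0 < t"
  shows "transP M X (s + t) x = transP M X s x \<bind> transP M X t"
\<comment> \<open>Pathwise limits of the scheme pass through continuous bounded functions, so the
  two laws are compared on these.\<close>
proof (rule measure_eq_of_continuous)
  have st: "0 \<le> s" "0 \<le> t" "0 \<le> s + t" using s t by auto
  have kt: "transP M X t \<in> measurable (transP M X s x) (subprob_algebra borel)"
    using transP_measurable[OF st(2)] by (simp cong: measurable_cong_sets)
  show sb: "sets (transP M X s x \<bind> transP M X t) = sets borel"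
    by (rule sets_bind[OF _ ]) auto
  show "sets (transP M X (s + t) x) = sets borel" by simp
  show "finite_measure (transP M X (s + t) x)"
    using prob_space_transP[OF st(3)] by (simp add: prob_space_def)
  have "subprob_space (transP M X s x \<bind> transP M X t)"
    using prob_space_imp_subprob_space[OF prob_space_transP[OF st(1)]] kt by (rule subprob_space_bind)
  then show "finite_measure (transP M X s x \<bind> transP M X t)"
    by (simp add: subprob_space_def)
  fix f :: "real^'d \<Rightarrow> real" assume f: "continuous_on UNIV f" "\<And>x. 0 \<le> f x \<and> f x \<le> 1"
  define \<phi> where "\<phi> y = ennreal (f y)" for y
  have fm [measurable]: "f \<in> borel_measurable borel" by (intro borel_measurable_continuous_onI f)
  have pm [measurable]: "\<phi> \<in> borel_measurable borel" unfolding \<phi>_def by measurable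
  have p1: "\<phi> y \<le> 1" for y using f(2) by (simp add: \<phi>_def)
  have plim: "(\<lambda>i. \<phi> (y i)) \<longlonglongrightarrow> \<phi> z" if "y \<longlonglongrightarrow> z" for y z
  proof -
    have "isCont f z" using f(1) by (simp add: continuous_on_eq_continuous_at)
    then show ?thesis unfolding \<phi>_def by (intro tendsto_ennrealI isCont_tendsto_compose[OF _ that])
  qed
  have Xm [measurable]: "X s x \<in> borel_measurable M" by (rule X_measurable[OF st(1)])
  \<comment> \<open>The discrete approximation of the transition operator for time \<open>t\<close>;
    \<open>Suc i\<close> avoids the degenerate mesh \<open>t / 0\<close>.\<close>
  define g where "g i = (Kop (t / Suc i) ^^ Suc i) \<phi>" for i
  have gm [measurable]: "g i \<in> borel_measurable borel" for i
    unfolding g_def using t by (intro Kop_funpow_measurable) auto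
  have geq: "g i y = (\<integral>\<^sup>+\<omega>. \<phi> (eu (t / Suc i) y (incr 0 (t / Suc i) \<omega>) (Suc i)) \<partial>M)" for i y
    unfolding g_def by (rule euler_incr_law[symmetric]) (use t in auto)
  have g1: "g i y \<le> 1" for i y
  proof -
    have "g i y \<le> (\<integral>\<^sup>+\<omega>. 1 \<partial>M)" unfolding geq by (intro nn_integral_mono p1)
    then show ?thesis by (simp add: emeasure_space_1)
  qed
  have em [measurable]: "(\<lambda>\<omega>. eu h (u \<omega>) (incr r h' \<omega>) k) \<in> borel_measurable M" if "u \<in> borel_measurable M" for h u r h' k
    using that by (rule measurable_euler) measurable
  have glim: "(\<lambda>i. g i y) \<longlonglongrightarrow> (\<integral>\<^sup>+\<omega>. \<phi> (X t y \<omega>) \<partial>M)" for y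
    unfolding geq
  proof (rule nn_integral_bounded_convergence)
    show "(\<lambda>i. \<phi> (eu (t / Suc i) y (incr 0 (t / Suc i) \<omega>) (Suc i))) \<longlonglongrightarrow> \<phi> (X t y \<omega>)" if "\<omega> \<in> space M" for \<omega>
      using LIMSEQ_Suc[OF euler_tendsto_X0[OF that st(2), of y]] by (rule plim)
    show "(\<lambda>\<omega>. \<phi> (X t y \<omega>)) \<in> borel_measurable M"
      by (rule measurable_compose[OF X_measurable[OF st(2)] pm])
    show "(\<lambda>\<omega>. \<phi> (eu (t / Suc i) y (incr 0 (t / Suc i) \<omega>) (Suc i))) \<in> borel_measurable M" for i
      by (intro measurable_compose[OF em pm]) simp
  qed (rule p1)
  have gcont: "(\<lambda>j. g i (y j)) \<longlonglongrightarrow> g i z" if "y \<longlonglongrightarrow> z" for y z i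
    unfolding geq
  proof (rule nn_integral_bounded_convergence)
    show "(\<lambda>j. \<phi> (eu (t / Suc i) (y j) (incr 0 (t / Suc i) \<omega>) (Suc i)))
        \<longlonglongrightarrow> \<phi> (eu (t / Suc i) z (incr 0 (t / Suc i) \<omega>) (Suc i))" for \<omega>
      by (intro plim continuous_on_tendsto_compose[OF continuous_euler[of UNIV] that]) auto
  qed (auto intro!: p1 measurable_compose[OF em pm] simp del: euler.simps)
  have mid: "(\<integral>\<^sup>+\<omega>. \<phi> (eu (t / Suc i) (X s x \<omega>) (incr s (t / Suc i) \<omega>) (Suc i)) \<partial>M) = (\<integral>\<^sup>+\<omega>. g i (X s x \<omega>) \<partial>M)" for i
  proof (rule LIMSEQ_unique)
    let ?E = "\<lambda>j \<omega>. eu (s / Suc j) x (incr 0 (s / Suc j) \<omega>) (Suc j)"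
    have E: "(\<lambda>j. ?E j \<omega>) \<longlonglongrightarrow> X s x \<omega>" if "\<omega> \<in> space M" for \<omega>
      using LIMSEQ_Suc[OF euler_tendsto_X0[OF that st(1), of x]] .
    have Em: "?E j \<in> borel_measurable M" for j by (rule em) simp
    have eq: "(\<integral>\<^sup>+\<omega>. \<phi> (eu (t / Suc i) (?E j \<omega>) (incr s (t / Suc i) \<omega>) (Suc i)) \<partial>M) = (\<integral>\<^sup>+\<omega>. g i (?E j \<omega>) \<partial>M)" for j
    proof -
      have "(\<integral>\<^sup>+\<omega>. \<phi> (eu (t / Suc i) (?E j \<omega>) (incr s (t / Suc i) \<omega>) (Suc i)) \<partial>M) = (Kop (s / Suc j) ^^ Suc j) (g i) x"
        unfolding g_def by (rule euler_incr_law_two) (use s t in auto)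
      also have "\<dots> = (\<integral>\<^sup>+\<omega>. g i (?E j \<omega>) \<partial>M)"
        by (rule euler_incr_law[symmetric]) (use s in auto)
      finally show ?thesis .
    qed
    show "(\<lambda>j. \<integral>\<^sup>+\<omega>. \<phi> (eu (t / Suc i) (?E j \<omega>) (incr s (t / Suc i) \<omega>) (Suc i)) \<partial>M)
      \<longlonglongrightarrow> (\<integral>\<^sup>+\<omega>. \<phi> (eu (t / Suc i) (X s x \<omega>) (incr s (t / Suc i) \<omega>) (Suc i)) \<partial>M)"
    proof (rule nn_integral_bounded_convergence)
      show "(\<lambda>j. \<phi> (eu (t / Suc i) (?E j \<omega>) (incr s (t / Suc i) \<omega>) (Suc i)))
        \<longlonglongrightarrow> \<phi> (eu (t / Suc i) (X s x \<omega>) (incr s (t / Suc i) \<omega>) (Suc i))" if "\<omega> \<in> space M" for \<omega>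
        by (intro plim continuous_on_tendsto_compose[OF continuous_euler[of UNIV] E[OF that]]) auto
    qed (auto intro!: p1 measurable_compose[OF em pm] Em Xm simp del: euler.simps)
    show "(\<lambda>j. \<integral>\<^sup>+\<omega>. \<phi> (eu (t / Suc i) (?E j \<omega>) (incr s (t / Suc i) \<omega>) (Suc i)) \<partial>M)
      \<longlonglongrightarrow> (\<integral>\<^sup>+\<omega>. g i (X s x \<omega>) \<partial>M)"
      unfolding eq
      by (rule nn_integral_bounded_convergence)
        (auto intro!: g1 gcont E measurable_compose[OF Em gm] measurable_compose[OF Xm gm] simp del: euler.simps of_nat_Suc)
  qed
  have "(\<integral>\<^sup>+\<omega>. \<phi> (X (s + t) x \<omega>) \<partial>M) = (\<integral>\<^sup>+\<omega>. (\<integral>\<^sup>+\<omega>'. \<phi> (X t (X s x \<omega>) \<omega>') \<partial>M) \<partial>M)"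
  proof (rule LIMSEQ_unique)
    show "(\<lambda>i. \<integral>\<^sup>+\<omega>. \<phi> (eu (t / Suc i) (X s x \<omega>) (incr s (t / Suc i) \<omega>) (Suc i)) \<partial>M) \<longlonglongrightarrow> (\<integral>\<^sup>+\<omega>. \<phi> (X (s + t) x \<omega>) \<partial>M)"
    proof (rule nn_integral_bounded_convergence)
      show "(\<lambda>i. \<phi> (eu (t / Suc i) (X s x \<omega>) (incr s (t / Suc i) \<omega>) (Suc i))) \<longlonglongrightarrow> \<phi> (X (s + t) x \<omega>)"
        if "\<omega> \<in> space M" for \<omega>
        using LIMSEQ_Suc[OF euler_tendsto_X[OF that st(1,2), of x]] by (rule plim)
    qed (auto intro!: p1 measurable_compose[OF em pm] measurable_compose[OF X_measurable pm] Xm st(3) simp del: euler.simps)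
    show "(\<lambda>i. \<integral>\<^sup>+\<omega>. \<phi> (eu (t / Suc i) (X s x \<omega>) (incr s (t / Suc i) \<omega>) (Suc i)) \<partial>M)
      \<longlonglongrightarrow> (\<integral>\<^sup>+\<omega>. (\<integral>\<^sup>+\<omega>'. \<phi> (X t (X s x \<omega>) \<omega>') \<partial>M) \<partial>M)"
      unfolding mid
    proof (rule nn_integral_bounded_convergence)
      have "(\<lambda>y. \<integral>\<^sup>+z. \<phi> z \<partial>transP M X t y) \<in> borel_measurable borel"
        by (rule measurable_compose[OF transP_measurable[OF st(2)] nn_integral_measurable_subprob_algebra]) simp
      then have "(\<lambda>y. \<integral>\<^sup>+\<omega>'. \<phi> (X t y \<omega>') \<partial>M) \<in> borel_measurable borel"
        by (simp add: nn_integral_transP[OF st(2)])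
      then show "(\<lambda>\<omega>. \<integral>\<^sup>+\<omega>'. \<phi> (X t (X s x \<omega>) \<omega>') \<partial>M) \<in> borel_measurable M"
        by (rule measurable_compose[OF Xm])
    qed (auto intro!: g1 glim measurable_compose[OF Xm gm])
  qed
  then have "(\<integral>\<^sup>+y. \<phi> y \<partial>transP M X (s + t) x) = (\<integral>\<^sup>+y. \<phi> y \<partial>(transP M X s x \<bind> transP M X t))"
    using measurable_compose[OF transP_measurable[OF st(2)] nn_integral_measurable_subprob_algebra[OF pm]]
    by (simp add: nn_integral_bind[OF pm kt] nn_integral_transP st)
  then show "(\<integral>\<^sup>+y. ennreal (f y) \<partial>(transP M X s x \<bind> transP M X t)) = (\<integral>\<^sup>+y. ennreal (f y) \<partial>transP M X (s + t) x)"
    by (simp add: \<phi>_def)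
qed

lemma chapman_kolmogorov:
  assumes "0 \<le> s" "0 \<le> t"
  shows "transP M X (s + t) x = transP M X s x \<bind> transP M X t"
proof -
  consider "s = 0" | "t = 0" | "0 < s" "0 < t" using assms by linarith
  then show ?thesis
  proof cases
    case 1
    then show ?thesis using bind_return[OF transP_measurable[OF assms(2)], of x] by (simp add: transP_0)
  next
    case 2
    have "transP M X t = return borel" unfolding 2 by (rule ext) (rule transP_0)
    then show ?thesis using 2 by (simp add: bind_return'')
  next
    case 3
    then show ?thesis by (rule chapman_kolmogorov_pos)
  qed
qed

lemma V_transP_bound:
  obtains k C where "0 < k" "0 \<le> C"
    "\<And>t x. 0 \<le> t \<Longrightarrow> (\<integral>\<^sup>+y. ennreal (V y) \<partial>transP M X t x) \<le> ennreal (exp (- k * t) * V x + C)"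
proof -
  obtain k h0 C where kh: "0 < k" "0 < h0" "0 \<le> C"
    "\<And>h n x. 0 < h \<Longrightarrow> h \<le> h0 \<Longrightarrow> (Kop h ^^ n) (\<lambda>y. ennreal (V y)) x \<le> ennreal (exp (- k * (n * h)) * V x + C)"
    using V_euler_bound by blast
  have "(\<integral>\<^sup>+y. ennreal (V y) \<partial>transP M X t x) \<le> ennreal (exp (- k * t) * V x + C)" if t: "0 \<le> t" for t x
  proof (cases "t = 0")
    case True
    then show ?thesis using kh by (simp add: transP_0 nn_integral_return ennreal_leI)
  next
    case False
    then have t: "0 < t" using t by simp
    obtain n0 :: nat where n0: "t / h0 < n0" using reals_Archimedean2 by blast
    \<comment> \<open>The number of steps starts beyond \<open>t / h0\<close>, so that every mesh in
      the sequence lies in the range \<open>h <= h0\<close> of the discrete bound.\<close>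
    define N where "N i = Suc (n0 + i)" for i
    let ?E = "\<lambda>i \<omega>. eu (t / N i) x (incr 0 (t / N i) \<omega>) (N i)"
    have Em: "?E i \<in> borel_measurable M" for i
      by (rule measurable_euler) measurable
    have E: "(\<lambda>i. ?E i \<omega>) \<longlonglongrightarrow> X t x \<omega>" if "\<omega> \<in> space M" for \<omega>
      using LIMSEQ_ignore_initial_segment[OF euler_tendsto_X0[OF that, of t x], of "Suc n0"] t
      by (simp add: N_def add.commute del: euler.simps of_nat_Suc)
    have "(\<integral>\<^sup>+y. ennreal (V y) \<partial>transP M X t x) = (\<integral>\<^sup>+\<omega>. ennreal (V (X t x \<omega>)) \<partial>M)"
      using t by (intro nn_integral_transP) auto
    also have "\<dots> = (\<integral>\<^sup>+\<omega>. liminf (\<lambda>i. ennreal (V (?E i \<omega>))) \<partial>M)"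
    proof (rule nn_integral_cong)
      fix \<omega> assume "\<omega> \<in> space M"
      then have "(\<lambda>i. ennreal (V (?E i \<omega>))) \<longlonglongrightarrow> ennreal (V (X t x \<omega>))"
        by (intro tendsto_ennrealI continuous_on_tendsto_compose[OF continuous_on_V[of UNIV] E]) auto
      then show "ennreal (V (X t x \<omega>)) = liminf (\<lambda>i. ennreal (V (?E i \<omega>)))"
        by (rule lim_imp_Liminf[OF sequentially_bot, symmetric])
    qed
    also have "\<dots> \<le> liminf (\<lambda>i. \<integral>\<^sup>+\<omega>. ennreal (V (?E i \<omega>)) \<partial>M)"
      by (rule nn_integral_liminf) (auto intro!: measurable_compose[OF Em] simp del: euler.simps)
    also have "\<dots> \<le> ennreal (exp (- k * t) * V x + C)"
    proof (rule Liminf_le[OF sequentially_bot], rule always_eventually, rule allI)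
      fix i
      have "(\<integral>\<^sup>+\<omega>. ennreal (V (?E i \<omega>)) \<partial>M) = (Kop (t / N i) ^^ N i) (\<lambda>y. ennreal (V y)) x"
        by (rule euler_incr_law) (use t in \<open>auto simp: N_def\<close>)
      also have "\<dots> \<le> ennreal (exp (- k * (N i * (t / N i))) * V x + C)"
      proof (rule kh(4))
        show "0 < t / N i" using t by (simp add: N_def)
        have "t / h0 \<le> N i" using n0 by (simp add: N_def)
        then show "t / N i \<le> h0" using kh(2) by (simp add: N_def field_simps)
      qed
      also have "N i * (t / N i) = t" by (simp add: N_def)
      finally show "(\<integral>\<^sup>+\<omega>. ennreal (V (?E i \<omega>)) \<partial>M) \<le> ennreal (exp (- k * t) * V x + C)" .
    qed
    finally show ?thesis .
  qed
  then show ?thesis using kh that by blast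
qed

end

section \<open>Volume bounds for Lipschitz maps, without differentiability\<close>

section \<open>Lipschitz images and the discrete Gramian\<close>

text \<open>The image-measure bounds of \<open>HOL-Analysis.Change_Of_Vars\<close> need a well-ordered index type, hence this
  direct covering by dyadic cubes.\<close>
lemma lipschitz_image_measure_open:
  fixes \<Phi> :: "'a::euclidean_space \<Rightarrow> 'a"
  assumes lip: "\<And>v v'. norm (\<Phi> v - \<Phi> v') \<le> k * norm (v - v')" and k: "0 \<le> k"
    and S: "bounded S" "S \<subseteq> U" and U: "open U" and T: "T \<in> sets borel" "T \<subseteq> \<Phi> ` S"
  shows "emeasure lborel T \<le> ennreal ((2 * k * DIM('a)) ^ DIM('a)) * emeasure lborel U"
proof -
  define C where "C = (2 * k * DIM('a)) ^ DIM('a)"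
  have C: "0 \<le> C" using k by (simp add: C_def)
  obtain b where b: "0 < b" "\<And>x. x \<in> S \<Longrightarrow> norm x \<le> b" using S(1) unfolding bounded_pos by blast
  have "S \<subseteq> cbox (- b *\<^sub>R One) (b *\<^sub>R One)"
  proof
    fix x assume "x \<in> S"
    then have "\<bar>x \<bullet> i\<bar> \<le> b" if "i \<in> Basis" for i using Basis_le_norm[OF that, of x] b by fastforce
    then show "x \<in> cbox (- b *\<^sub>R One) (b *\<^sub>R One)" by (auto simp: mem_box abs_le_iff minus_le_iff)
  qed
  moreover have "box (- b *\<^sub>R One) (b *\<^sub>R One :: 'a) \<noteq> {}" using b by (simp add: box_ne_empty)
  \<comment> \<open>This gauge forces every cube of the covering, each tagged by a point of
    \<open>S\<close>, to stay inside \<open>U\<close>.\<close>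
  moreover have "gauge (\<lambda>x. if x \<in> U then U else UNIV)" using U by (auto simp: gauge_def)
  ultimately obtain \<D> where D: "countable \<D>" "\<Union>\<D> \<subseteq> cbox (- b *\<^sub>R One) (b *\<^sub>R One)"
    "\<And>K. K \<in> \<D> \<Longrightarrow> interior K \<noteq> {} \<and> (\<exists>c d. K = cbox c d)"
    "pairwise (\<lambda>A B. interior A \<inter> interior B = {}) \<D>"
    "\<And>K. K \<in> \<D> \<Longrightarrow> \<exists>x\<in>S \<inter> K. K \<subseteq> (if x \<in> U then U else UNIV)"
    "\<And>u v. cbox u v \<in> \<D> \<Longrightarrow> \<exists>n. \<forall>i\<in>Basis. v \<bullet> i - u \<bullet> i = ((b *\<^sub>R One) \<bullet> i - (- b *\<^sub>R One) \<bullet> i) / 2 ^ n"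
    "S \<subseteq> \<Union>\<D>"
    by (rule covering_lemma) blast
  have KU: "K \<subseteq> U" if "K \<in> \<D>" for K using D(5)[OF that] S(2) by (auto split: if_splits)
  have cube: "\<exists>Q. Q \<in> sets borel \<and> \<Phi> ` K \<subseteq> Q \<and> emeasure lborel Q \<le> ennreal C * emeasure lborel (interior K)" if K: "K \<in> \<D>" for K
  proof -
    obtain u v where uv: "K = cbox u v" "interior K \<noteq> {}" using D(3)[OF K] by blast
    obtain n where n: "\<And>i. i \<in> Basis \<Longrightarrow> v \<bullet> i - u \<bullet> i = 2 * b / 2 ^ n"
      using D(6)[of u v] K uv by auto
    define l where "l = 2 * b / 2 ^ n"
    have l: "0 \<le> l" using b by (simp add: l_def)
    \<comment> \<open>A cube of side \<open>l\<close> has points within \<open>DIM * l\<close> of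
      its corner, by the l1 bound on the norm; its image fits into a cube of half-side
      \<open>r\<close>, which multiplies the volume by \<open>(2 k DIM)^DIM\<close>.\<close>
    define r where "r = k * (DIM('a) * l)"
    have r: "0 \<le> r" using k l by (simp add: r_def)
    let ?Q = "cbox (\<Phi> u - r *\<^sub>R One) (\<Phi> u + r *\<^sub>R One)"
    have "\<Phi> ` K \<subseteq> ?Q"
    proof
      fix y assume "y \<in> \<Phi> ` K"
      then obtain x where x: "x \<in> cbox u v" "y = \<Phi> x" using uv by auto
      have "norm (x - u) \<le> (\<Sum>i\<in>Basis. \<bar>(x - u) \<bullet> i\<bar>)" by (rule norm_le_l1)
      also have "\<dots> \<le> (\<Sum>i\<in>(Basis :: 'a set). l)"
      proof (intro sum_mono)
        fix i :: 'a assume i: "i \<in> Basis"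
        then have "u \<bullet> i \<le> x \<bullet> i" "x \<bullet> i \<le> v \<bullet> i" using x(1) by (auto simp: mem_box)
        then show "\<bar>(x - u) \<bullet> i\<bar> \<le> l" using n[OF i] by (simp add: inner_diff_left l_def)
      qed
      finally have "norm (x - u) \<le> DIM('a) * l" by simp
      then have "norm (y - \<Phi> u) \<le> r"
        unfolding r_def x(2) using lip[of x u] k by (meson mult_left_mono order_trans)
      then have "\<bar>(y - \<Phi> u) \<bullet> i\<bar> \<le> r" if "i \<in> Basis" for i
        using Basis_le_norm[OF that, of "y - \<Phi> u"] by linarith
      then show "y \<in> ?Q"
        by (auto simp: mem_box inner_diff_left inner_add_left abs_le_iff) (smt (verit))+
    qed
    moreover have "emeasure lborel ?Q = ennreal ((2 * r) ^ DIM('a))"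
      using r by (simp add: emeasure_lborel_cbox inner_diff_left inner_add_left algebra_simps)
    moreover have "emeasure lborel (interior K) = ennreal (l ^ DIM('a))"
    proof -
      have "u \<bullet> i \<le> v \<bullet> i" if "i \<in> Basis" for i using n[OF that] l unfolding l_def by linarith
      then have "emeasure lborel (box u v) = ennreal (\<Prod>i\<in>Basis. (v - u) \<bullet> i)"
        by (rule emeasure_lborel_box)
      also have "(\<Prod>i\<in>Basis. (v - u) \<bullet> i) = (\<Prod>i\<in>(Basis :: 'a set). l)"
        by (rule prod.cong) (auto simp: inner_diff_left n l_def)
      finally show ?thesis by (simp add: uv(1) interior_cbox)
    qed
    moreover have "(2 * r) ^ DIM('a) = C * l ^ DIM('a)"
      unfolding C_def r_def power_mult_distrib[symmetric] by (simp add: mult_ac)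
    ultimately show ?thesis using C l by (intro exI[of _ ?Q]) (simp add: ennreal_mult)
  qed
  define J where "J = to_nat_on \<D> ` \<D>"
  \<comment> \<open>Reindexing over the naturals with empty fillers. Interiors are taken because
    neighbouring cubes share faces; they are disjoint and carry the full volume.\<close>
  define I where "I n = (if n \<in> J then interior (from_nat_into \<D> n) else {})" for n
  obtain Qf where Qf: "\<And>K. K \<in> \<D> \<Longrightarrow> Qf K \<in> sets borel \<and> \<Phi> ` K \<subseteq> Qf K \<and> emeasure lborel (Qf K) \<le> ennreal C * emeasure lborel (interior K)"
    using cube by metis
  define Q where "Q n = (if n \<in> J then Qf (from_nat_into \<D> n) else {})" for n
  have J: "from_nat_into \<D> n \<in> \<D>" if "n \<in> J" for n
    using that D(1) by (auto simp: J_def)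
  have Qs: "range Q \<subseteq> sets lborel" using Qf J by (auto simp: Q_def)
  have Is: "range I \<subseteq> sets lborel" by (auto simp: I_def)
  have disj: "disjoint_family I"
  proof (unfold disjoint_family_on_def, intro ballI impI)
    fix m n :: nat assume mn: "m \<noteq> n"
    show "I m \<inter> I n = {}"
    proof (cases "m \<in> J \<and> n \<in> J")
      case True
      then have "from_nat_into \<D> m \<noteq> from_nat_into \<D> n" using mn D(1) by (auto simp: J_def)
      then show ?thesis using D(4) True J unfolding pairwise_def I_def by auto
    qed (auto simp: I_def)
  qed
  have "T \<subseteq> (\<Union>n. Q n)"
  proof
    fix y assume "y \<in> T"
    then obtain x where x: "x \<in> S" "y = \<Phi> x" using T by auto
    then obtain K where K: "K \<in> \<D>" "x \<in> K" using D(7) by auto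
    then have "y \<in> Q (to_nat_on \<D> K)" using Qf[OF K(1)] x D(1) by (auto simp: Q_def J_def)
    then show "y \<in> (\<Union>n. Q n)" by blast
  qed
  then have "emeasure lborel T \<le> emeasure lborel (\<Union>n. Q n)" using Qs by (intro emeasure_mono) auto
  also have "\<dots> \<le> (\<Sum>n. emeasure lborel (Q n))" by (rule emeasure_subadditive_countably[OF Qs])
  also have "\<dots> \<le> (\<Sum>n. ennreal C * emeasure lborel (I n))"
    by (intro suminf_le summableI) (use Qf J in \<open>auto simp: Q_def I_def\<close>)
  also have "\<dots> = ennreal C * emeasure lborel (\<Union>n. I n)"
    by (simp add: suminf_emeasure[OF Is disj])
  also have "\<dots> \<le> ennreal C * emeasure lborel U"
  proof (intro mult_left_mono emeasure_mono)
    show "(\<Union>n. I n) \<subseteq> U" using KU J interior_subset by (fastforce simp: I_def split: if_splits)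
  qed (use U in auto)
  finally show ?thesis by (simp add: C_def)
qed

text \<open>Outer regularity encloses \<open>S\<close> in an open set of barely larger volume. A
  Borel part \<open>T\<close> of the image stands in for the image, which need not be Borel.\<close>

lemma lipschitz_image_measure:
  fixes \<Phi> :: "'a::euclidean_space \<Rightarrow> 'a"
  assumes lip: "\<And>v v'. norm (\<Phi> v - \<Phi> v') \<le> k * norm (v - v')" and k: "0 < k"
    and S: "bounded S" "S \<in> sets borel" and T: "T \<in> sets borel" "T \<subseteq> \<Phi> ` S"
  shows "emeasure lborel T \<le> ennreal ((2 * k * DIM('a)) ^ DIM('a)) * emeasure lborel S"
proof -
  define C where "C = (2 * k * DIM('a)) ^ DIM('a)"
  have C: "0 < C" using k by (simp add: C_def)
  have "emeasure lborel T \<le> ennreal C * emeasure lborel S + ennreal e" if e: "0 < e" for e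
  proof -
    have "S \<in> sets lebesgue" "0 < e / C" using S e C by auto
    then obtain U where U: "open U" "S \<subseteq> U" "emeasure lebesgue (U - S) < ennreal (e / C)"
      using sets_lebesgue_outer_open by metis
    have "emeasure lborel U = emeasure lborel (S \<union> (U - S))" using U(2) by (simp add: Un_absorb1)
    also have "\<dots> \<le> emeasure lborel S + emeasure lborel (U - S)"
      using U(1) S by (intro emeasure_subadditive) auto
    also have "emeasure lborel (U - S) \<le> ennreal (e / C)" using U S by simp
    finally have "emeasure lborel U \<le> emeasure lborel S + ennreal (e / C)" by (simp add: add_left_mono)
    then have "ennreal C * emeasure lborel U \<le> ennreal C * (emeasure lborel S + ennreal (e / C))"
      by (rule mult_left_mono) simp
    also have "\<dots> = ennreal C * emeasure lborel S + ennreal e"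
      using C e by (simp add: distrib_left ennreal_mult[symmetric])
    finally show ?thesis
      using lipschitz_image_measure_open[OF lip _ S(1) U(2,1) T] k unfolding C_def by (meson less_imp_le order_trans)
  qed
  then show ?thesis unfolding C_def by (rule ennreal_le_epsilon)
qed

text \<open>For Borel \<open>E\<close>, the part of \<open>E\<close> in the unit ball is covered by
  the image of the preimage of \<open>E\<close> in \<open>cball 0 R\<close>. The volume bound
  therefore compares Lebesgue measure on the unit ball with the push-forward of Lebesgue measure on
  \<open>cball 0 R\<close>, set by set.\<close>

lemma lipschitz_preimage_nn_integral:
  fixes \<Phi> :: "'a::euclidean_space \<Rightarrow> 'a"
  assumes lip: "\<And>v v'. norm (\<Phi> v - \<Phi> v') \<le> k * norm (v - v')" and k: "0 < k"
    and onto: "cball 0 1 \<subseteq> \<Phi> ` cball 0 R" and f: "f \<in> borel_measurable borel"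
  shows "(\<integral>\<^sup>+y. f y * indicator (cball 0 1) y \<partial>lborel)
    \<le> ennreal ((2 * k * DIM('a)) ^ DIM('a)) * (\<integral>\<^sup>+v. f (\<Phi> v) * indicator (cball 0 R) v \<partial>lborel)"
proof -
  have "k-lipschitz_on UNIV \<Phi>" using lip k by (intro lipschitz_onI) (auto simp: dist_norm)
  then have "continuous_on UNIV \<Phi>" by (rule lipschitz_on_continuous_on)
  then have \<Phi>m [measurable]: "\<Phi> \<in> borel_measurable borel" by (rule borel_measurable_continuous_onI)
  note [measurable] = f
  let ?B = "ennreal ((2 * k * DIM('a)) ^ DIM('a))"
  let ?\<mu> = "density lborel (indicator (cball 0 1)) :: 'a measure"
  let ?\<nu> = "scale_measure ?B (distr (density lborel (indicator (cball 0 R))) borel \<Phi>)"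
  have "?\<mu> \<le> ?\<nu>"
  proof (rule le_measure[THEN iffD2])
    show "\<forall>E\<in>sets ?\<mu>. emeasure ?\<mu> E \<le> emeasure ?\<nu> E"
    proof
      fix E :: "'a set" assume "E \<in> sets ?\<mu>"
      then have E [measurable]: "E \<in> sets borel" by simp
      have vE [measurable]: "\<Phi> -` E \<in> sets borel" using measurable_sets[OF \<Phi>m E] by simp
      have "emeasure (density lborel (indicator (cball 0 R))) (\<Phi> -` E) = emeasure lborel (cball 0 R \<inter> \<Phi> -` E)"
        by (subst emeasure_density)
          (auto simp: indicator_inter_arith[symmetric] intro!: borel_measurable_indicator)
      then have 1: "emeasure ?\<nu> E = ?B * emeasure lborel (cball 0 R \<inter> \<Phi> -` E)"
        by (simp add: emeasure_distr)
      have 2: "emeasure ?\<mu> E = emeasure lborel (E \<inter> cball 0 1)"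
        by (subst emeasure_density)
          (auto simp: indicator_inter_arith[symmetric] Int_commute intro!: borel_measurable_indicator)
      show "emeasure ?\<mu> E \<le> emeasure ?\<nu> E"
        unfolding 1 2
        by (rule lipschitz_image_measure[OF lip k])
          (use onto vE E in \<open>auto intro: bounded_subset[OF bounded_cball[of 0 R]]\<close>)
    qed
  qed simp
  then have "(\<integral>\<^sup>+y. f y \<partial>?\<mu>) \<le> (\<integral>\<^sup>+y. f y \<partial>?\<nu>)" by (intro nn_integral_mono_measure) auto
  moreover have "(\<integral>\<^sup>+y. f y \<partial>?\<mu>) = (\<integral>\<^sup>+y. f y * indicator (cball 0 1) y \<partial>lborel)"
    by (subst nn_integral_density) (auto simp: mult.commute intro!: borel_measurable_indicator)
  moreover have "(\<integral>\<^sup>+v. f (\<Phi> v) \<partial>density lborel (indicator (cball 0 R)))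
      = (\<integral>\<^sup>+v. f (\<Phi> v) * indicator (cball 0 R) v \<partial>lborel)"
    by (subst nn_integral_density) (auto simp: mult.commute intro!: borel_measurable_indicator)
  ultimately show ?thesis
    by (simp add: nn_integral_scale_measure nn_integral_distr)
qed

section \<open>Kalman condition and uniform positivity of the discrete Gramians\<close>

context euler_scheme
begin

text \<open>If \<open>v\<close> were orthogonal to all \<open>opexp A s (B e_i)\<close> on
  \<open>(0, 1)\<close>, differentiating \<open>j\<close> times and letting \<open>s\<close> tend to
  0 would make it orthogonal to every \<open>A^j B e_i\<close>, hence zero by the Kalman
  condition.\<close>

lemma opexp_B_nonvanishing:
  assumes kal: "kalman A B" and v: "v \<noteq> 0"
  obtains i s where "0 < s" "s < 1" "v \<bullet> opexp A s (B (axis i 1)) \<noteq> 0"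
proof (rule ccontr)
  note obt = that
  assume nothesis: "\<not> thesis"
  have zero: "v \<bullet> opexp A s (B (axis i 1)) = 0" if "0 < s" "s < 1" for s i
    using that obt nothesis by blast
  have "v \<bullet> opexp A s ((A ^^ j) (B (axis i 1))) = 0" if "0 < s" "s < 1" for s i j
    using that
  proof (induction j arbitrary: s)
    case 0
    then show ?case by (simp add: zero)
  next
    case (Suc j)
    let ?f = "\<lambda>s. v \<bullet> opexp A s ((A ^^ j) (B (axis i 1)))"
    have "(?f has_vector_derivative v \<bullet> opexp A s (A ((A ^^ j) (B (axis i 1))))) (at s)"
      by (rule bounded_linear.has_vector_derivative[OF bounded_linear_inner_right has_vector_derivative_opexp])
    moreover have "((\<lambda>_. 0) has_vector_derivative 0) (at s)" by simp
    then have "(?f has_vector_derivative 0) (at s)"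
      by (rule has_vector_derivative_transform_within_open[where S = "{0<..<1}"]) (use Suc in auto)
    ultimately have "v \<bullet> opexp A s (A ((A ^^ j) (B (axis i 1)))) = 0"
      by (rule vector_derivative_unique_at)
    then show ?case by simp
  qed
  then have z: "v \<bullet> (A ^^ j) (B (axis i 1)) = 0" for i j
  proof -
    let ?f = "\<lambda>s. v \<bullet> opexp A s ((A ^^ j) (B (axis i 1)))"
    have "isCont ?f 0"
      using has_vector_derivative_continuous[OF has_vector_derivative_opexp] by (intro isCont_inner) auto
    moreover have "(\<lambda>n. 1 / real (n + 2)) \<longlonglongrightarrow> 0"
      using LIMSEQ_ignore_initial_segment[OF lim_1_over_n, of 2] by simp
    ultimately have "(\<lambda>n. ?f (1 / real (n + 2))) \<longlonglongrightarrow> ?f 0" by (rule isCont_tendsto_compose)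
    moreover have "?f (1 / real (n + 2)) = 0" for n
      by (rule \<open>\<And>s i j. 0 < s \<Longrightarrow> s < 1 \<Longrightarrow> v \<bullet> opexp A s ((A ^^ j) (B (axis i 1))) = 0\<close>) auto
    ultimately have "(\<lambda>n. 0::real) \<longlonglongrightarrow> ?f 0" by simp
    from LIMSEQ_unique[OF this tendsto_const] show ?thesis by simp
  qed
  have "span {(A ^^ j) (B (axis i 1)) | j i. True} \<subseteq> {y. v \<bullet> y = 0}"
    by (rule span_minimal) (auto simp: z intro: subspace_hyperplane)
  then have "v \<in> {y. v \<bullet> y = 0}" using kal unfolding kalman_def by blast
  then have "v \<bullet> v = 0" by simp
  then show False using v by simp
qed

text \<open>A right-endpoint Riemann sum of mesh \<open>1 / N\<close> for the quadratic form of the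
  controllability Gramian over unit time.\<close>

definition gram :: "nat \<Rightarrow> real^'d \<Rightarrow> real" where
  "gram N v = (\<Sum>k<N. 1 / N * (\<Sum>i\<in>UNIV. (v \<bullet> opexp A (real (Suc k) * (1 / N)) (B (axis i 1)))\<^sup>2))"

text \<open>Compactness: a failing sequence of unit vectors, on ever finer meshes, has a limit
  direction \<open>v\<close>. Some \<open>B e_i\<close> is seen by \<open>v\<close> on a whole time
  window, with a margin stable under small changes of direction, and a fine grid places a fixed
  proportion of its points there. Coarse grids can miss the window, hence \<open>N0\<close>.\<close>

lemma gram_lower:
  assumes kal: "kalman A B"
  obtains g N0 where "0 < g" "0 < N0" "\<And>N v. N0 \<le> N \<Longrightarrow> g * (norm v)\<^sup>2 \<le> gram N v"
proof (rule ccontr)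
  note obt = that
  assume nothesis: "\<not> thesis"
  have no: "\<exists>N v. n \<le> N \<and> gram N v < e * (norm v)\<^sup>2" if "0 < e" "0 < n" for e n
    using that obt nothesis by (meson not_less)
  define \<psi> where "\<psi> i s v = v \<bullet> opexp A s (B (axis i 1))" for i s v
  have "\<exists>N v. Suc n \<le> N \<and> norm v = 1 \<and> gram N v < 1 / Suc n" for n
  proof -
    obtain N v where Nv: "Suc n \<le> N" "gram N v < 1 / Suc n * (norm v)\<^sup>2"
      using no[of "1 / Suc n" "Suc n"] by auto
    have g0: "0 \<le> gram N v" unfolding gram_def by (intro sum_nonneg mult_nonneg_nonneg) auto
    then have v: "v \<noteq> 0" using Nv by auto
    have sc: "gram N (c *\<^sub>R v) = c\<^sup>2 * gram N v" for c
      unfolding gram_def by (simp add: sum_distrib_left power_mult_distrib mult_ac)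
    have "gram N ((1 / norm v) *\<^sub>R v) < 1 / Suc n"
      unfolding sc using Nv(2) v by (simp add: field_simps)
    then show ?thesis using Nv v by (intro exI[of _ N] exI[of _ "(1 / norm v) *\<^sub>R v"]) auto
  qed
  then obtain Nf vf where vf: "\<And>n. Suc n \<le> Nf n" "\<And>n. norm (vf n) = 1" "\<And>n. gram (Nf n) (vf n) < 1 / Suc n"
    by metis
  have "compact (sphere 0 1 :: (real^'d) set)" by simp
  then obtain v r where v: "v \<in> sphere 0 1" "strict_mono r" "(vf \<circ> r) \<longlonglongrightarrow> v"
    unfolding compact_def using vf(2) by (metis mem_sphere_0)
  then have "v \<noteq> 0" by auto
  then obtain i s0 where s0: "0 < s0" "s0 < 1" "\<psi> i s0 v \<noteq> 0"
    using opexp_B_nonvanishing[OF kal] unfolding \<psi>_def by blast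
  \<comment> \<open>One third may be lost to the variation in time, one third to the variation in
    direction; the last third is the lower bound.\<close>
  define c where "c = \<bar>\<psi> i s0 v\<bar> / 3"
  have c: "0 < c" using s0 by (simp add: c_def)
  have "isCont (\<lambda>s. \<psi> i s v) s0"
    unfolding \<psi>_def using has_vector_derivative_continuous[OF has_vector_derivative_opexp]
    by (intro isCont_inner) auto
  then obtain d0 where d0: "0 < d0" "\<And>s. \<bar>s - s0\<bar> < d0 \<Longrightarrow> \<bar>\<psi> i s v - \<psi> i s0 v\<bar> < c"
    unfolding continuous_at_eps_delta using c by (metis dist_real_def dist_norm real_norm_def)
  define d where "d = min (d0 / 2) (1 - s0)"
  have d: "0 < d" "d < d0" "s0 + d \<le> 1" using d0 s0 by (auto simp: d_def)
  define D where "D = exp K * norm (B (axis i 1)) + 1"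
  have D: "0 < D" by (simp add: D_def add_nonneg_pos)
  have near: "c \<le> \<bar>\<psi> i s u\<bar>" if s: "s0 \<le> s" "s \<le> s0 + d" and u: "norm (u - v) < c / D" for s u
  proof -
    have "\<bar>\<psi> i s u - \<psi> i s v\<bar> = \<bar>(u - v) \<bullet> opexp A s (B (axis i 1))\<bar>"
      by (simp add: \<psi>_def inner_diff_left)
    also have "\<dots> \<le> norm (u - v) * norm (opexp A s (B (axis i 1)))" by (rule Cauchy_Schwarz_ineq2)
    also have "\<dots> \<le> norm (u - v) * D"
    proof (intro mult_left_mono)
      have "norm (opexp A s (B (axis i 1))) \<le> exp (K * \<bar>s\<bar>) * norm (B (axis i 1))" by (rule norm_opexp_le)
      also have "\<dots> \<le> exp K * norm (B (axis i 1))"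
        using s s0 d K0 by (intro mult_right_mono) (auto simp: mult_left_le)
      finally show "norm (opexp A s (B (axis i 1))) \<le> D" by (simp add: D_def)
    qed simp
    also have "\<dots> < c" using u D by (simp add: field_simps)
    finally have "\<bar>\<psi> i s u - \<psi> i s v\<bar> < c" .
    moreover have "\<bar>\<psi> i s v - \<psi> i s0 v\<bar> < c" using s d by (intro d0(2)) auto
    moreover have "\<bar>\<psi> i s0 v\<bar> = 3 * c" by (simp add: c_def)
    ultimately show ?thesis by linarith
  qed
  have lower: "d * c\<^sup>2 / 2 \<le> gram N u" if N: "4 / d \<le> real N" and u: "norm (u - v) < c / D" for N u
  proof -
    have N4: "4 \<le> d * N" using N d by (simp add: field_simps)
    then have N0: "0 < real N" using d by (metis mult_zero_right not_numeral_le_zero of_nat_0_less_iff gr0I of_nat_0)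
    \<comment> \<open>Index \<open>k\<close> stands for the grid time \<open>Suc k / N\<close>; the
      indices from \<open>a\<close> up to but excluding \<open>b\<close> have grid times in
      \<open>[s0, s0 + d]\<close>.\<close>
    define a b where "a = nat \<lceil>s0 * N\<rceil>" and "b = nat \<lfloor>(s0 + d) * N\<rfloor>"
    have "0 \<le> s0 * N" using s0 by simp
    then have a: "s0 * N \<le> a" "a < s0 * N + 1" unfolding a_def by linarith+
    have "0 \<le> (s0 + d) * N" using s0 d by simp
    then have b: "b \<le> (s0 + d) * N" "(s0 + d) * N - 1 < b" unfolding b_def by linarith+
    have "(s0 + d) * N \<le> 1 * real N" using d N0 by (intro mult_right_mono) auto
    then have bN: "b \<le> N" using b by linarith
    \<comment> \<open>Rounding costs at most two grid points, which is at most half of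
      \<open>d * N >= 4\<close>.\<close>
    have cnt: "d * N / 2 \<le> real (card {a..<b})"
    proof -
      have "(s0 + d) * N - 1 - (s0 * N + 1) \<le> real b - real a" using a b by linarith
      then have "d * N - 2 \<le> real b - real a" by (simp add: algebra_simps)
      then show ?thesis using N4 by simp
    qed
    have trm: "c\<^sup>2 \<le> (\<Sum>j\<in>UNIV. (\<psi> j (real (Suc k) * (1 / N)) u)\<^sup>2)" if k: "k \<in> {a..<b}" for k
    proof -
      have "s0 * N \<le> Suc k" "Suc k \<le> (s0 + d) * N" using k a b by auto
      then have "s0 \<le> real (Suc k) * (1 / N)" "real (Suc k) * (1 / N) \<le> s0 + d"
        using N0 by (auto simp: field_simps)
      then have "c\<^sup>2 \<le> (\<psi> i (real (Suc k) * (1 / N)) u)\<^sup>2"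
        using near[OF _ _ u] c by (simp add: abs_le_square_iff[symmetric])
      also have "\<dots> \<le> (\<Sum>j\<in>UNIV. (\<psi> j (real (Suc k) * (1 / N)) u)\<^sup>2)"
        by (rule member_le_sum) auto
      finally show ?thesis .
    qed
    have "d * c\<^sup>2 / 2 = (d * N / 2) * (1 / N * c\<^sup>2)" using N0 by simp
    also have "\<dots> \<le> real (card {a..<b}) * (1 / N * c\<^sup>2)" using cnt by (rule mult_right_mono) simp
    also have "\<dots> = (\<Sum>k\<in>{a..<b}. 1 / N * c\<^sup>2)" by simp
    also have "\<dots> \<le> (\<Sum>k\<in>{a..<b}. 1 / N * (\<Sum>j\<in>UNIV. (\<psi> j (real (Suc k) * (1 / N)) u)\<^sup>2))"
      by (intro sum_mono mult_left_mono trm) auto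
    also have "\<dots> \<le> gram N u"
      unfolding gram_def \<psi>_def using bN by (intro sum_mono2) (auto intro!: divide_nonneg_nonneg sum_nonneg)
    finally show ?thesis .
  qed
  obtain n1 where n1: "\<And>n. n1 \<le> n \<Longrightarrow> norm ((vf \<circ> r) n - v) < c / D"
    using LIMSEQ_D[OF v(3), of "c / D"] c D by auto
  obtain n2 n3 :: nat where n23: "4 / d < n2" "2 / (d * c\<^sup>2) < n3" using reals_Archimedean2 by meson
  define n where "n = max n1 (max n2 n3)"
  have "n \<le> r n" using v(2) by (rule seq_suble)
  then have rn: "n1 \<le> n" "n2 \<le> r n" "n3 \<le> r n" by (auto simp: n_def)
  have "d * c\<^sup>2 / 2 \<le> gram (Nf (r n)) (vf (r n))"
    using vf(1)[of "r n"] rn n23 n1[OF rn(1)] by (intro lower) (auto intro: order_trans[of _ "real n2"])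
  also have "\<dots> < 1 / Suc (r n)" by (rule vf(3))
  also have "\<dots> \<le> d * c\<^sup>2 / 2"
  proof -
    have "2 / (d * c\<^sup>2) \<le> Suc (r n)" using n23 rn by simp
    then show ?thesis using d c by (simp add: field_simps)
  qed
  finally show False by simp
qed

end

section \<open>Steered end points cover the unit ball, uniformly in the mesh\<close>

section \<open>Steering the Euler scheme\<close>

context euler_scheme
begin

lemma norm_opexp_le_C0: "0 \<le> s \<Longrightarrow> norm (opexp A s y) \<le> C0 * norm y"
proof -
  assume s: "0 \<le> s"
  have "C0 * exp (- c0 * s) \<le> C0 * 1" using C0 c0 s by (intro mult_left_mono) auto
  then show ?thesis using order_trans[OF decay[OF s, of y] mult_right_mono[of "C0 * exp (- c0 * s)" "C0 * 1" "norm y"]]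
    by simp
qed

text \<open>Discrete variation of constants; \<open>k - j\<close> is at least 1 because every step
  ends with a flow.\<close>

lemma euler_mild:
  assumes h: "0 \<le> h"
  shows "eu h x w k = opexp A (real k * h) x
    + (\<Sum>j<k. opexp A (real (k - j) * h) (h *\<^sub>R F (eu h x w j) + B (w j)))"
proof (induction k)
  case (Suc k)
  let ?g = "\<lambda>j. h *\<^sub>R F (eu h x w j) + B (w j)"
  have step: "opexp A h (opexp A (real m * h) y) = opexp A (real (Suc m) * h) y" for m y
    using opexp_plus[OF h, of "real m * h" y] by (simp add: algebra_simps)
  have "eu h x w (Suc k) = opexp A h (eu h x w k) + opexp A h (?g k)"
    by (simp add: euler_step_def opexp_add[symmetric] add.assoc)
  also have "opexp A h (eu h x w k) = opexp A (real (Suc k) * h) x + (\<Sum>j<k. opexp A (real (Suc (k - j)) * h) (?g j))"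
    by (subst Suc) (simp only: opexp_add linear_sum[OF linear_opexp] step)
  also have "(\<Sum>j<k. opexp A (real (Suc (k - j)) * h) (?g j)) = (\<Sum>j<k. opexp A (real (Suc k - j) * h) (?g j))"
    by (intro sum.cong) (auto simp: Suc_diff_le)
  finally show ?case by (simp add: add.assoc)
qed simp

text \<open>The linear part of the scheme over unit time, started at 0: a discretised stochastic
  convolution.\<close>

definition noise :: "nat \<Rightarrow> (nat \<Rightarrow> real^'n) \<Rightarrow> nat \<Rightarrow> real^'d" where
  "noise N w k = euler A (\<lambda>_. 0) B (1 / N) 0 w k"

text \<open>\<open>ctrl N v\<close> is the discretisation of the control \<open>s \<mapsto> B\<^sup>T exp((1 - s)A)\<^sup>T v\<close>, which steers the linear
  system by its Gramian applied to \<open>v\<close>.\<close>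
definition ctrl :: "nat \<Rightarrow> real^'d \<Rightarrow> nat \<Rightarrow> real^'n" where
  "ctrl N v k = (\<chi> i. v \<bullet> opexp A (real (N - k) * (1 / N)) (B (axis i 1)))"

text \<open>The factor \<open>1 / N\<close> is the length of a step, so the increment is shifted by
  the time integral of the control.\<close>

definition steer :: "nat \<Rightarrow> real^'d \<Rightarrow> (nat \<Rightarrow> real^'n) \<Rightarrow> nat \<Rightarrow> real^'n" where
  "steer N v w k = w k + (1 / N) *\<^sub>R ctrl N v k"

text \<open>With zero drift field the linear noise is itself an Euler scheme, so the mild formula,
  the description of its law and the moment bound all apply to it.\<close>

lemma euler_scheme_0: "euler_scheme A K C0 c0 B (\<lambda>_. 0) 0"
  by (intro euler_scheme.intro stable_linop_axioms euler_scheme_axioms.intro linB)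
    (auto simp: lipschitz_on_def intro!: exI[of _ 0])

lemma noise_eq: "noise N w k = (\<Sum>j<k. opexp A (real (k - j) * (1 / N)) (B (w j)))"
proof -
  interpret Z: euler_scheme A K C0 c0 B "\<lambda>_. 0" 0 by (rule euler_scheme_0)
  show ?thesis unfolding noise_def by (subst Z.euler_mild) (simp_all add: linear_0[OF linear_opexp])
qed

lemma B_expand: "B z = (\<Sum>i\<in>UNIV. z $ i *\<^sub>R B (axis i 1))"
proof -
  have "B z = B (\<Sum>i\<in>UNIV. z $ i *\<^sub>R axis i 1)"
    by (rule arg_cong[of _ _ B]) (simp add: vec_eq_iff axis_def if_distrib cong: if_cong)
  then show ?thesis by (simp add: linear_sum[OF linB] linear_cmul[OF linB])
qed

lemma ctrl_inner: "ctrl N v k \<bullet> z = v \<bullet> opexp A (real (N - k) * (1 / N)) (B z)"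
proof -
  have "v \<bullet> opexp A (real (N - k) * (1 / N)) (B z)
    = (\<Sum>i\<in>UNIV. z $ i * (v \<bullet> opexp A (real (N - k) * (1 / N)) (B (axis i 1))))"
    by (subst B_expand) (simp add: linear_sum[OF linear_opexp] opexp_scale inner_sum_right)
  moreover have "ctrl N v k \<bullet> z = (\<Sum>i\<in>UNIV. ctrl N v k $ i * z $ i)"
    by (simp add: inner_vec_def)
  ultimately show ?thesis by (simp add: ctrl_def mult.commute)
qed

text \<open>\<open>ctrl\<close> is the adjoint of the propagation up to the final time. The linear
  part of the Cameron-Martin exponent therefore collapses to a pairing with the end value of the
  linear noise.\<close>

lemma ctrl_noise: "(\<Sum>k<N. ctrl N v k \<bullet> w k) = v \<bullet> noise N w N"
  unfolding ctrl_inner noise_eq by (simp add: inner_sum_right)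

lemma linear_ctrl: "linear (\<lambda>v. ctrl N v k)"
  by (intro linearI) (simp_all add: ctrl_def vec_eq_iff inner_add_left)

lemma ctrl_bound:
  obtains CU where "0 < CU" "\<And>N v k. norm (ctrl N v k) \<le> CU * norm v"
proof -
  define c where "c = C0 * (\<Sum>i\<in>UNIV. norm (B (axis i 1)))"
  have "norm (ctrl N v k) \<le> c * norm v" for N v k
  proof -
    have "norm (ctrl N v k) \<le> (\<Sum>i\<in>UNIV. \<bar>ctrl N v k $ i\<bar>)" by (rule norm_le_l1_cart)
    also have "\<dots> \<le> (\<Sum>i\<in>UNIV. norm v * (C0 * norm (B (axis i 1))))"
    proof (intro sum_mono)
      fix i
      have "\<bar>ctrl N v k $ i\<bar> \<le> norm v * norm (opexp A (real (N - k) * (1 / N)) (B (axis i 1)))"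
        unfolding ctrl_def vec_lambda_beta by (rule Cauchy_Schwarz_ineq2)
      also have "\<dots> \<le> norm v * (C0 * norm (B (axis i 1)))"
        by (intro mult_left_mono norm_opexp_le_C0) auto
      finally show "\<bar>ctrl N v k $ i\<bar> \<le> norm v * (C0 * norm (B (axis i 1)))" .
    qed
    also have "\<dots> = c * norm v" by (simp add: c_def sum_distrib_left mult_ac)
    finally show ?thesis .
  qed
  moreover have "0 \<le> c" using C0 by (simp add: c_def sum_nonneg)
  ultimately show ?thesis
    by (intro that[of "c + 1"]) (auto simp: distrib_right intro: order_trans[OF _ le_add_same_cancel1[THEN iffD2]])
qed

text \<open>The discrete controllability Gramian as an operator: the displacement of the linear end
  point caused by the control \<open>ctrl N v\<close>.\<close>

definition gramop :: "nat \<Rightarrow> real^'d \<Rightarrow> real^'d" where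
  "gramop N v = (\<Sum>k<N. opexp A (real (N - k) * (1 / N)) (B ((1 / N) *\<^sub>R ctrl N v k)))"

lemma linear_gramop: "linear (gramop N)"
  by (intro linearI)
    (simp_all add: gramop_def linear_add[OF linear_ctrl] linear_cmul[OF linear_ctrl] scaleR_add_right
      linear_add[OF linB] linear_cmul[OF linB] opexp_add opexp_scale sum.distrib scaleR_sum_right scaleR_left_commute)

lemma gramop_gram: "v \<bullet> gramop N v = gram N v"
proof -
  have "v \<bullet> gramop N v = (\<Sum>k<N. 1 / N * (ctrl N v k \<bullet> ctrl N v k))"
    unfolding gramop_def inner_sum_right
    by (intro sum.cong refl) (simp add: ctrl_inner linear_cmul[OF linB] opexp_scale)
  \<comment> \<open>\<open>ctrl\<close> counts the remaining time \<open>N - k\<close>,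
    \<open>gram\<close> the elapsed time \<open>Suc k\<close>; reversing the sum matches
    them.\<close>
  also have "\<dots> = (\<Sum>k<N. 1 / N * (ctrl N v (N - Suc k) \<bullet> ctrl N v (N - Suc k)))"
    by (rule sum.nat_diff_reindex[symmetric])
  also have "\<dots> = gram N v"
    unfolding gram_def ctrl_def
    by (intro sum.cong refl) (auto simp: inner_vec_def power2_eq_square Suc_diff_Suc)
  finally show ?thesis .
qed

lemma steered_end:
  assumes "0 < N"
  shows "eu (1 / N) x (steer N v w) N = opexp A 1 x
    + (\<Sum>j<N. opexp A (real (N - j) * (1 / N)) ((1 / N) *\<^sub>R F (eu (1 / N) x (steer N v w) j))) + noise N w N + gramop N v"
  using assms
  by (subst euler_mild)
    (simp_all add: steer_def linear_add[OF linB] opexp_add sum.distrib noise_eq gramop_def add_ac)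

text \<open>Discrete Gronwall for the time average of the path norms. The noise enters through its
  time average as well, a quantity controlled by first moments, and the bound is only linear in
  \<open>v\<close>.\<close>

lemma steered_bound:
  obtains D where "0 < D"
    "\<And>N x v w. 0 < N \<Longrightarrow>
      (\<Sum>k<N. 1 / N * norm (eu (1 / N) x (steer N v w) k)) \<le> D * (1 + norm x + norm v + (\<Sum>k<N. 1 / N * norm (noise N w k)))"
proof -
  obtain CU where CU: "0 < CU" "\<And>N v k. norm (ctrl N v k) \<le> CU * norm v" using ctrl_bound by blast
  obtain KB where KB: "1 \<le> KB" "\<And>x. norm (B x) \<le> KB * norm x" using linear_norm_bound[OF linB] by blast
  have L0: "0 \<le> L" using lipschitz_on_nonneg[OF lipF] .
  have FL: "norm (F y) \<le> L * norm y + norm (F 0)" for y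
    using lipschitz_onD[OF lipF, of y 0] norm_triangle_ineq2[of "F y" "F 0"] by (simp add: dist_norm)
  define D0 where "D0 = C0 + C0 * norm (F 0) + C0 * KB * CU + 1"
  have D0: "1 \<le> D0" "C0 \<le> D0" "C0 * norm (F 0) \<le> D0" "C0 * KB * CU \<le> D0"
    using C0 KB(1) CU(1) by (auto simp: D0_def add_nonneg_nonneg)
  have "(\<Sum>k<N. 1 / N * norm (eu (1 / N) x (steer N v w) k))
      \<le> (exp (C0 * L) * D0) * (1 + norm x + norm v + (\<Sum>k<N. 1 / N * norm (noise N w k)))" if N: "0 < N" for N x v w
  proof -
    define h where "h = 1 / real N"
    have h: "0 < h" "real N * h = 1" using N by (auto simp: h_def)
    define y where "y k = norm (eu h x (steer N v w) k)" for k
    define z where "z k = norm (noise N w k)" for k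
    define c where "c = D0 * (1 + norm x + norm v)"
    have c0: "0 \<le> c" using D0 by (simp add: c_def)
    have yb: "y k \<le> c + z k + C0 * L * (\<Sum>j<k. h * y j)" if k: "k \<le> N" for k
    proof -
      let ?x = "eu h x (steer N v w)"
      have xk: "?x k = opexp A (real k * h) x + (\<Sum>j<k. opexp A (real (k - j) * h) (h *\<^sub>R F (?x j)))
        + noise N w k + (\<Sum>j<k. opexp A (real (k - j) * h) (B (h *\<^sub>R ctrl N v j)))"
        using h by (subst euler_mild)
          (simp_all add: steer_def linear_add[OF linB] opexp_add sum.distrib noise_eq h_def[symmetric] add_ac)
      have "norm (?x k) \<le> C0 * norm x + (\<Sum>j<k. C0 * (h * (L * y j + norm (F 0)))) + z k + (\<Sum>j<k. h * (C0 * KB * CU * norm v))"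
      proof (subst xk, intro order_trans[OF norm_triangle_ineq] add_mono)
        show "norm (opexp A (real k * h) x) \<le> C0 * norm x" using h by (intro norm_opexp_le_C0) auto
        show "norm (\<Sum>j<k. opexp A (real (k - j) * h) (h *\<^sub>R F (?x j))) \<le> (\<Sum>j<k. C0 * (h * (L * y j + norm (F 0))))"
        proof (intro sum_norm_le)
          fix j
          have "norm (opexp A (real (k - j) * h) (h *\<^sub>R F (?x j))) \<le> C0 * norm (h *\<^sub>R F (?x j))"
            using h by (intro norm_opexp_le_C0) auto
          also have "\<dots> \<le> C0 * (h * (L * y j + norm (F 0)))"
            using h C0 FL[of "?x j"] by (auto simp: y_def intro!: mult_left_mono)
          finally show "norm (opexp A (real (k - j) * h) (h *\<^sub>R F (?x j))) \<le> C0 * (h * (L * y j + norm (F 0)))" .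
        qed
        show "norm (noise N w k) \<le> z k" by (simp add: z_def)
        show "norm (\<Sum>j<k. opexp A (real (k - j) * h) (B (h *\<^sub>R ctrl N v j))) \<le> (\<Sum>j<k. h * (C0 * KB * CU * norm v))"
        proof (intro sum_norm_le)
          fix j
          have "norm (opexp A (real (k - j) * h) (B (h *\<^sub>R ctrl N v j))) \<le> C0 * norm (B (h *\<^sub>R ctrl N v j))"
            using h by (intro norm_opexp_le_C0) auto
          also have "\<dots> \<le> C0 * (KB * norm (h *\<^sub>R ctrl N v j))" using C0 by (intro mult_left_mono KB)
          also have "\<dots> \<le> C0 * (KB * (h * (CU * norm v)))"
            using h CU(2)[of N v j] C0 KB(1) by (intro mult_left_mono) auto
          finally show "norm (opexp A (real (k - j) * h) (B (h *\<^sub>R ctrl N v j))) \<le> h * (C0 * KB * CU * norm v)"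
            by (simp add: mult_ac)
        qed
      qed
      also have "\<dots> = C0 * norm x + (real k * h) * (C0 * norm (F 0)) + (real k * h) * (C0 * KB * CU * norm v) + z k + C0 * L * (\<Sum>j<k. h * y j)"
      proof -
        have "(\<Sum>j<k. C0 * (h * (L * y j + norm (F 0)))) = (\<Sum>j<k. C0 * L * (h * y j) + h * (C0 * norm (F 0)))"
          by (intro sum.cong refl) (simp add: algebra_simps)
        also have "\<dots> = C0 * L * (\<Sum>j<k. h * y j) + (real k * h) * (C0 * norm (F 0))"
          by (simp add: sum.distrib sum_distrib_left mult.assoc)
        finally show ?thesis by simp
      qed
      also have "\<dots> \<le> D0 * norm x + 1 * D0 + 1 * (D0 * norm v) + z k + C0 * L * (\<Sum>j<k. h * y j)"
      proof -
        have kh: "0 \<le> real k * h" "real k * h \<le> 1" using mult_right_mono[of "real k" "real N" h] k h by auto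
        have "C0 * norm x \<le> D0 * norm x" by (intro mult_right_mono D0) simp
        moreover have "(real k * h) * (C0 * norm (F 0)) \<le> 1 * D0" using kh C0 by (intro mult_mono D0) auto
        moreover have "(real k * h) * (C0 * KB * CU * norm v) \<le> 1 * (D0 * norm v)"
          using kh C0 KB(1) CU(1) by (intro mult_mono[OF kh(2) mult_right_mono[OF D0(4)]]) auto
        ultimately show ?thesis by linarith
      qed
      finally show ?thesis by (simp add: y_def c_def algebra_simps)
    qed
    define s where "s k = (\<Sum>j<k. h * y j)" for k
    \<comment> \<open>The running integral \<open>s k\<close> satisfies a linear recursion with
      factor \<open>1 + C0 * L * h\<close>, dominated by \<open>exp (C0 * L * h)\<close>.\<close>
    have "k \<le> N \<Longrightarrow> s k \<le> exp (C0 * L * (real k * h)) * (real k * h * c + (\<Sum>j<k. h * z j))" for k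
    proof (induction k)
      case (Suc k)
      let ?e = "\<lambda>k. exp (C0 * L * (real k * h))"
      have "s (Suc k) = s k + h * y k" by (simp add: s_def)
      also have "\<dots> \<le> s k + h * (c + z k + C0 * L * s k)"
        using yb[of k] Suc h by (intro add_left_mono mult_left_mono) (auto simp: s_def)
      also have "\<dots> = (1 + C0 * L * h) * s k + h * (c + z k)" by (simp add: algebra_simps)
      also have "\<dots> \<le> exp (C0 * L * h) * (?e k * (real k * h * c + (\<Sum>j<k. h * z j))) + ?e (Suc k) * (h * (c + z k))"
      proof (rule add_mono[OF mult_mono])
        show "1 + C0 * L * h \<le> exp (C0 * L * h)" by (rule exp_ge_add_one_self)
        show "s k \<le> ?e k * (real k * h * c + (\<Sum>j<k. h * z j))" using Suc by simp
        show "0 \<le> s k" using h by (auto simp: s_def y_def intro!: sum_nonneg)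
        have "1 * (h * (c + z k)) \<le> ?e (Suc k) * (h * (c + z k))"
          using h C0 L0 c0 by (intro mult_right_mono) (auto simp: z_def)
        then show "h * (c + z k) \<le> ?e (Suc k) * (h * (c + z k))" by simp
      qed simp
      also have "exp (C0 * L * h) * (?e k * (real k * h * c + (\<Sum>j<k. h * z j))) = ?e (Suc k) * (real k * h * c + (\<Sum>j<k. h * z j))"
      proof -
        have "exp (C0 * L * h) * ?e k = ?e (Suc k)"
          unfolding mult_exp_exp by (rule arg_cong[of _ _ exp]) (simp add: algebra_simps)
        then show ?thesis by (simp only: mult.assoc[symmetric])
      qed
      finally show ?case by (simp add: algebra_simps)
    qed (simp add: s_def)
    from this[of N] have "s N \<le> exp (C0 * L) * (c + (\<Sum>j<N. h * z j))" using h by simp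
    also have "\<dots> \<le> exp (C0 * L) * (D0 * (1 + norm x + norm v + (\<Sum>j<N. h * z j)))"
    proof (intro mult_left_mono)
      have "0 \<le> (\<Sum>j<N. h * z j)" using h by (auto simp: z_def intro!: sum_nonneg)
      then have "1 * (\<Sum>j<N. h * z j) \<le> D0 * (\<Sum>j<N. h * z j)" using D0 by (intro mult_right_mono) auto
      then show "c + (\<Sum>j<N. h * z j) \<le> D0 * (1 + norm x + norm v + (\<Sum>j<N. h * z j))"
        unfolding c_def by (simp add: distrib_left)
    qed simp
    finally show ?thesis by (simp add: s_def y_def z_def h_def mult.assoc)
  qed
  moreover have "0 < exp (C0 * L) * D0" using D0 by simp
  ultimately show ?thesis using that by blast
qed

text \<open>Two controls differ by \<open>h\<close> times a multiple of \<open>norm (v - v')\<close>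
  in each step, and Lipschitz stability accumulates the differences over unit time. The constant
  depends neither on the mesh nor on \<open>x\<close> or \<open>w\<close>, so the later volume bound
  is uniform too.\<close>

lemma steered_lipschitz:
  obtains k where "0 < k"
    "\<And>N x w v v'. 0 < N \<Longrightarrow> norm (eu (1 / N) x (steer N v w) N - eu (1 / N) x (steer N v' w) N) \<le> k * norm (v - v')"
proof -
  obtain CU where CU: "0 < CU" "\<And>N v k. norm (ctrl N v k) \<le> CU * norm v" using ctrl_bound by blast
  obtain KB where KB: "1 \<le> KB" "\<And>x. norm (B x) \<le> KB * norm x" using linear_norm_bound[OF linB] by blast
  have L0: "0 \<le> L" using lipschitz_on_nonneg[OF lipF] .
  have "norm (eu (1 / N) x (steer N v w) N - eu (1 / N) x (steer N v' w) N) \<le> (exp (K + L) * (exp K * (KB * CU))) * norm (v - v')"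
    if N: "0 < N" for N x w v v'
  proof -
    define h where "h = 1 / real N"
    have h: "0 < h" "real N * h = 1" "h \<le> 1" using N by (auto simp: h_def)
    define q where "q = exp K * (KB * CU) * norm (v - v')"
    have q: "0 \<le> q" using KB(1) CU(1) by (simp add: q_def)
    let ?x = "\<lambda>v. eu h x (steer N v w)"
    have "norm (?x v k - ?x v' k) \<le> exp ((K + L) * (real k * h)) * (real k * h * q)" for k
    proof (induction k)
      case (Suc k)
      let ?e = "\<lambda>k. exp ((K + L) * (real k * h))"
      have eq: "?x v (Suc k) - ?x v' (Suc k)
        = (est h (?x v k) (steer N v w k) - est h (?x v' k) (steer N v w k))
          + h *\<^sub>R opexp A h (B (ctrl N (v - v') k))"
        by (simp add: euler_step_def steer_def h_def[symmetric] opexp_add linear_diff[OF linear_ctrl]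
            linear_diff[OF linB] linear_add[OF linB] linear_cmul[OF linB] linear_diff[OF linear_opexp] opexp_scale algebra_simps)
      have "norm (opexp A h (B (ctrl N (v - v') k))) \<le> exp (K * h) * norm (B (ctrl N (v - v') k))"
        using norm_opexp_le[of h] h by simp
      also have "\<dots> \<le> exp K * (KB * (CU * norm (v - v')))"
      proof (intro mult_mono)
        show "exp (K * h) \<le> exp K" using h K0 by (simp add: mult_left_le)
        show "norm (B (ctrl N (v - v') k)) \<le> KB * (CU * norm (v - v'))"
          using order_trans[OF KB(2) mult_left_mono[OF CU(2)]] KB(1) by simp
      qed auto
      finally have "h * norm (opexp A h (B (ctrl N (v - v') k))) \<le> h * q"
        using h by (intro mult_left_mono) (auto simp: q_def mult_ac)
      then have "norm (?x v (Suc k) - ?x v' (Suc k)) \<le> exp ((K + L) * h) * norm (?x v k - ?x v' k) + h * q"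
        unfolding eq using h
        by (intro order_trans[OF norm_triangle_ineq add_mono] euler_step_lipschitz lipF) auto
      also have "\<dots> \<le> exp ((K + L) * h) * (?e k * (real k * h * q)) + ?e (Suc k) * (h * q)"
      proof (intro add_mono mult_left_mono Suc)
        have "1 * (h * q) \<le> ?e (Suc k) * (h * q)"
          using h K0 L0 q by (intro mult_right_mono) auto
        then show "h * q \<le> ?e (Suc k) * (h * q)" by simp
      qed simp
      also have "exp ((K + L) * h) * (?e k * (real k * h * q)) = ?e (Suc k) * (real k * h * q)"
      proof -
        have "exp ((K + L) * h) * ?e k = ?e (Suc k)"
          unfolding mult_exp_exp by (rule arg_cong[of _ _ exp]) (simp add: algebra_simps)
        then show ?thesis by (simp only: mult.assoc[symmetric])
      qed
      finally show ?case by (simp add: algebra_simps)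
    qed simp
    from this[of N] show ?thesis unfolding h(2) by (simp add: q_def h_def mult.assoc)
  qed
  moreover have "0 < exp (K + L) * (exp K * (KB * CU))" using KB(1) CU(1) by simp
  ultimately show ?thesis using that by blast
qed

text \<open>Write the end point as \<open>gramop N v + rm v\<close>. Hitting \<open>y\<close> means
  that \<open>v\<close> is a fixed point of \<open>v -> Hi (y - rm v)\<close>, with
  \<open>Hi\<close> the inverse Gramian. Since \<open>rm\<close> grows with slope at most half the
  lower bound of the Gramian, this map preserves a large ball.\<close>

lemma steered_onto:
  assumes kal: "kalman A B"
  obtains N0 where "0 < N0" "\<And>\<rho> r. 0 \<le> \<rho> \<Longrightarrow> 0 \<le> r \<Longrightarrow> \<exists>R>0. \<forall>N\<ge>N0. \<forall>x w. norm x \<le> \<rho> \<longrightarrow> norm (noise N w N) \<le> r \<longrightarrow>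
      (\<Sum>k<N. 1 / N * norm (noise N w k)) \<le> r \<longrightarrow> cball 0 1 \<subseteq> (\<lambda>v. eu (1 / N) x (steer N v w) N) ` cball 0 R"
proof -
  obtain g N0 where g: "0 < g" "0 < N0" "\<And>N v. N0 \<le> N \<Longrightarrow> g * (norm v)\<^sup>2 \<le> gram N v"
    using gram_lower[OF kal] by blast
  obtain D where D: "0 < D" "\<And>N x v w. 0 < N \<Longrightarrow>
      (\<Sum>k<N. 1 / N * norm (eu (1 / N) x (steer N v w) k)) \<le> D * (1 + norm x + norm v + (\<Sum>k<N. 1 / N * norm (noise N w k)))"
    using steered_bound by blast
  obtain kl where kl: "0 < kl"
    "\<And>N x w v v'. 0 < N \<Longrightarrow> norm (eu (1 / N) x (steer N v w) N - eu (1 / N) x (steer N v' w) N) \<le> kl * norm (v - v')"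
    using steered_lipschitz by blast
  \<comment> \<open>Makes the slope \<open>C0 * e * D\<close> of the remainder at most
    \<open>g / 2\<close>.\<close>
  define e where "e = g / (2 * (C0 * D + 1))"
  have CD: "0 \<le> C0 * D" using C0 D by simp
  have e: "0 < e" using g CD by (simp add: e_def)
  have eD: "C0 * e * D \<le> g / 2"
  proof -
    have "C0 * e * D \<le> (C0 * D + 1) * e" using e by (simp add: algebra_simps)
    also have "\<dots> = g / 2" using CD unfolding e_def by (simp add: field_simps)
    finally show ?thesis .
  qed
  obtain C1 where C1: "\<And>y. norm (F y) \<le> e * norm y + C1" using sublinear[OF e] by blast
  have C1': "0 \<le> C1" using order_trans[OF norm_ge_zero C1[of 0]] by simp
  have "\<exists>R>0. \<forall>N\<ge>N0. \<forall>x w. norm x \<le> \<rho> \<longrightarrow> norm (noise N w N) \<le> r \<longrightarrow>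
      (\<Sum>k<N. 1 / N * norm (noise N w k)) \<le> r \<longrightarrow> cball 0 1 \<subseteq> (\<lambda>v. eu (1 / N) x (steer N v w) N) ` cball 0 R"
    if \<rho>: "0 \<le> \<rho>" and r: "0 \<le> r" for \<rho> r
  proof -
    define E where "E = C0 * \<rho> + C0 * e * D * (1 + \<rho> + r) + C0 * C1 + r"
    have E: "0 \<le> E" using C0 \<rho> e D r C1' by (simp add: E_def)
    \<comment> \<open>The solution of \<open>1 + (E + g / 2 * R) = g * R\<close>, i.e. the radius at
      which the fixed-point map sends the ball into itself for all \<open>y\<close> of norm at most
      1.\<close>
    define R where "R = 2 * (1 + E) / g"
    have R: "0 < R" using E g by (simp add: R_def)
    have "cball 0 1 \<subseteq> (\<lambda>v. eu (1 / N) x (steer N v w) N) ` cball 0 R"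
      if N: "N0 \<le> N" and x: "norm x \<le> \<rho>" and w: "norm (noise N w N) \<le> r" "(\<Sum>k<N. 1 / N * norm (noise N w k)) \<le> r" for N x w
    proof
      fix y :: "real^'d" assume y: "y \<in> cball 0 1"
      have N1: "0 < N" using N g by simp
      define \<Phi> where "\<Phi> v = eu (1 / N) x (steer N v w) N" for v
      define rm where "rm v = \<Phi> v - gramop N v" for v
      have rm: "norm (rm v) \<le> E + g / 2 * norm v" for v
      proof -
        let ?x = "\<lambda>j. eu (1 / N) x (steer N v w) j"
        have rmv: "rm v = opexp A 1 x + (\<Sum>j<N. opexp A (real (N - j) * (1 / N)) ((1 / N) *\<^sub>R F (?x j))) + noise N w N"
          unfolding rm_def \<Phi>_def steered_end[OF N1] by simp
        have le: "norm (rm v) \<le> C0 * \<rho> + (\<Sum>j<N. C0 * (1 / N * (e * norm (?x j) + C1))) + r"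
        proof (subst rmv, intro order_trans[OF norm_triangle_ineq] add_mono w(1))
          show "norm (opexp A 1 x) \<le> C0 * \<rho>"
            using order_trans[OF norm_opexp_le_C0 mult_left_mono[OF x C0]] by simp
          show "norm (\<Sum>j<N. opexp A (real (N - j) * (1 / N)) ((1 / N) *\<^sub>R F (?x j))) \<le> (\<Sum>j<N. C0 * (1 / N * (e * norm (?x j) + C1)))"
          proof (intro sum_norm_le)
            fix j
            have "norm (opexp A (real (N - j) * (1 / N)) ((1 / N) *\<^sub>R F (?x j))) \<le> C0 * norm ((1 / N) *\<^sub>R F (?x j))"
              by (intro norm_opexp_le_C0) auto
            also have "norm ((1 / N) *\<^sub>R F (?x j)) = 1 / N * norm (F (?x j))" by simp
            also have "C0 * (1 / N * norm (F (?x j))) \<le> C0 * (1 / N * (e * norm (?x j) + C1))"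
              using C0 by (intro mult_left_mono C1) auto
            finally show "norm (opexp A (real (N - j) * (1 / N)) ((1 / N) *\<^sub>R F (?x j))) \<le> C0 * (1 / N * (e * norm (?x j) + C1))" .
          qed
        qed
        have eq: "(\<Sum>j<N. C0 * (1 / N * (e * norm (?x j) + C1))) = C0 * e * (\<Sum>j<N. 1 / N * norm (?x j)) + C0 * C1"
        proof -
          have "(\<Sum>j<N. C0 * (1 / N * (e * norm (?x j) + C1))) = (\<Sum>j<N. C0 * e * (1 / N * norm (?x j)) + 1 / N * (C0 * C1))"
            by (intro sum.cong refl) (simp add: algebra_simps)
          also have "\<dots> = C0 * e * (\<Sum>j<N. 1 / N * norm (?x j)) + C0 * C1"
            using N1 by (simp add: sum.distrib sum_distrib_left mult.assoc)
          finally show ?thesis .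
        qed
        have "C0 * e * (\<Sum>j<N. 1 / N * norm (?x j)) \<le> C0 * e * (D * (1 + \<rho> + norm v + r))"
        proof (intro mult_left_mono)
          have "(\<Sum>j<N. 1 / N * norm (?x j)) \<le> D * (1 + norm x + norm v + (\<Sum>k<N. 1 / N * norm (noise N w k)))"
            by (rule D(2)[OF N1])
          also have "\<dots> \<le> D * (1 + \<rho> + norm v + r)" using D(1) x w by (intro mult_left_mono) auto
          finally show "(\<Sum>j<N. 1 / N * norm (?x j)) \<le> D * (1 + \<rho> + norm v + r)" .
        qed (use C0 e in auto)
        also have "C0 * e * (D * (1 + \<rho> + norm v + r)) = C0 * e * D * (1 + \<rho> + r) + C0 * e * D * norm v"
          by (simp add: algebra_simps)
        also have "\<dots> \<le> C0 * e * D * (1 + \<rho> + r) + g / 2 * norm v"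
          using eD by (intro add_left_mono mult_right_mono) auto
        finally show ?thesis using le unfolding eq E_def by linarith
      qed
      have gv: "g * norm v \<le> norm (gramop N v)" for v
      proof (cases "v = 0")
        case False
        have "norm v * (g * norm v) \<le> gram N v" using g(3)[OF N, of v] by (simp add: power2_eq_square mult_ac)
        also have "\<dots> \<le> norm v * norm (gramop N v)"
          unfolding gramop_gram[symmetric] by (rule norm_cauchy_schwarz)
        finally show ?thesis using False by simp
      qed simp
      have "inj (gramop N)"
      proof (rule linear_injective_0[OF linear_gramop, THEN iffD2], intro allI impI)
        fix v assume "gramop N v = 0"
        then have "g * norm v \<le> 0" using gv[of v] by simp
        then show "v = 0" using g(1) by (simp add: mult_le_0_iff)
      qed
      then have "surj (gramop N)" by (rule linear_injective_imp_surjective[OF linear_gramop]) simp_all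
      then obtain Hi where Hi: "linear Hi" "gramop N \<circ> Hi = id"
        using linear_surjective_right_inverse[OF linear_gramop] by blast
      have HiG: "gramop N (Hi z) = z" for z using Hi(2) by (metis comp_apply id_apply)
      have Hb: "norm (Hi z) \<le> norm z / g" for z
        using gv[of "Hi z"] g(1) by (simp add: HiG field_simps)
      have "kl-lipschitz_on UNIV \<Phi>"
        using kl(1) kl(2)[OF N1] by (intro lipschitz_onI) (auto simp: dist_norm \<Phi>_def)
      then have c\<Phi>: "continuous_on UNIV \<Phi>" by (rule lipschitz_on_continuous_on)
      have cG: "continuous_on UNIV (gramop N)"
        using linear_gramop linear_conv_bounded_linear linear_continuous_on by blast
      have crm: "continuous_on UNIV rm" unfolding rm_def by (intro continuous_intros c\<Phi> cG)
      have cHi: "continuous_on S Hi" for S using Hi(1) linear_conv_bounded_linear linear_continuous_on by blast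
      have "continuous_on (cball 0 R) (\<lambda>v. Hi (y - rm v))"
        by (rule continuous_on_compose2[OF cHi[of UNIV]])
          (auto intro!: continuous_intros continuous_on_subset[OF crm])
      moreover have "(\<lambda>v. Hi (y - rm v)) \<in> cball 0 R \<rightarrow> cball 0 R"
      proof
        fix v assume v: "v \<in> cball (0::real^'d) R"
        have "norm (y - rm v) \<le> norm y + norm (rm v)" by (rule norm_triangle_ineq4)
        also have "\<dots> \<le> 1 + (E + g / 2 * R)"
          using y v g(1) order_trans[OF rm add_left_mono[OF mult_left_mono[of "norm v" R "g / 2"]]]
          by (intro add_mono) auto
        also have "\<dots> = g * R" using g(1) by (simp add: R_def)
        finally have "norm (y - rm v) / g \<le> R" using g(1) by (simp add: field_simps)
        then show "Hi (y - rm v) \<in> cball 0 R" using Hb[of "y - rm v"] by simp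
      qed
      ultimately obtain v where v: "v \<in> cball 0 R" "Hi (y - rm v) = v"
        using brouwer_ball[OF R] by metis
      have "y - rm v = gramop N v" using HiG[of "y - rm v"] v(2) by simp
      then have "\<Phi> v = y" by (simp add: rm_def algebra_simps)
      then show "y \<in> (\<lambda>v. eu (1 / N) x (steer N v w) N) ` cball 0 R" using v(1) by (auto simp: \<Phi>_def)
    qed
    then show ?thesis using R by blast
  qed
  then show ?thesis using g(2) that by blast
qed

end

section \<open>Lower bound on the law at time 1 by Lebesgue measure on the unit ball\<close>

section \<open>Minorization\<close>

context euler_scheme
begin

lemma noise_measurable:
  assumes "k \<le> N" "0 < N"
  shows "(\<lambda>w. noise N w k) \<in> borel_measurable (PiM {..<N} (\<lambda>_. gauss h))"
proof -
  interpret Z: euler_scheme A K C0 c0 B "\<lambda>_. 0" 0 by (rule euler_scheme_0)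
  show ?thesis unfolding noise_def
    using assms by (intro Z.measurable_euler) (auto intro!: measurable_component_singleton
      simp: measurable_cong_sets[OF refl sets_gauss, symmetric] cong: measurable_cong_sets)
qed

text \<open>The drift bound for the linear scheme started at 0 bounds \<open>V\<close>, hence first
  moments, uniformly in step and mesh; Markov's inequality does the rest.\<close>

lemma noise_moderate:
  obtains r N1 where "0 < r" "0 < N1" "\<And>N. N1 \<le> N \<Longrightarrow>
    ennreal (1 / 2) \<le> emeasure (PiM {..<N} (\<lambda>_. gauss (1 / N)))
      {w \<in> space (PiM {..<N} (\<lambda>_. gauss (1 / N))). norm (noise N w N) \<le> r \<and> (\<Sum>k<N. 1 / N * norm (noise N w k)) \<le> r}"
proof -
  interpret Z: euler_scheme A K C0 c0 B "\<lambda>_. 0" 0 by (rule euler_scheme_0)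
  obtain k h0 C where kh: "0 < k" "0 < h0" "0 \<le> C"
    "\<And>h n x. 0 < h \<Longrightarrow> h \<le> h0 \<Longrightarrow> (Z.Kop h ^^ n) (\<lambda>y. ennreal (V y)) x \<le> ennreal (exp (- k * (n * h)) * V x + C)"
    using Z.V_euler_bound by blast
  obtain c1 where c1: "0 < c1" "\<And>x. c1 * (norm x)\<^sup>2 \<le> V x" using V_lower by blast
  define D where "D = 1 + C / c1"
  have D: "0 < D" using kh c1 by (simp add: D_def add_pos_nonneg)
  \<comment> \<open>The quantity \<open>S\<close> below, end value plus time average, has mean at
    most \<open>2 * D\<close>, so it reaches \<open>r\<close> with probability at most 1/2.\<close>
  define r where "r = 4 * D"
  have r: "0 < r" using D by (simp add: r_def)
  obtain N1 :: nat where N1: "1 / h0 < N1" using reals_Archimedean2 by blast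
  have N1': "0 < N1" using N1 kh(2) by (metis gr0I less_trans not_less_iff_gr_or_eq of_nat_0 zero_less_divide_1_iff)
  have "ennreal (1 / 2) \<le> emeasure (PiM {..<N} (\<lambda>_. gauss (1 / N)))
      {w \<in> space (PiM {..<N} (\<lambda>_. gauss (1 / N))). norm (noise N w N) \<le> r \<and> (\<Sum>k<N. 1 / N * norm (noise N w k)) \<le> r}"
    if N: "N1 \<le> N" for N
  proof -
    have N0: "0 < N" using N N1' by simp
    define h where "h = 1 / real N"
    have "1 / h0 < N" using N N1 by simp
    then have h: "0 < h" "h \<le> h0" using N0 kh(2) by (auto simp: h_def field_simps)
    define P where "P = PiM {..<N} (\<lambda>_. gauss h :: (real^'n) measure)"
    interpret P: prob_space P unfolding P_def by (intro prob_space_PiM prob_space_gauss h)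
    have nm [measurable]: "(\<lambda>w. noise N w k) \<in> borel_measurable P" if "k \<le> N" for k
      unfolding P_def using that N0 by (rule noise_measurable)
    have nb: "(\<integral>\<^sup>+w. ennreal (norm (noise N w k)) \<partial>P) \<le> ennreal D" if k: "k \<le> N" for k
    proof -
      note [measurable] = nm[OF k]
      have le: "norm z \<le> 1 + V z / c1" for z
      proof -
        have "norm z \<le> 1 + (norm z)\<^sup>2"
          using zero_le_power2[of "norm z - 1"] by (simp add: power2_diff, smt (verit) zero_le_power2)
        also have "(norm z)\<^sup>2 \<le> V z / c1" using c1 by (simp add: field_simps)
        finally show ?thesis by simp
      qed
      have "(\<integral>\<^sup>+w. ennreal (norm (noise N w k)) \<partial>P) \<le> (\<integral>\<^sup>+w. 1 + ennreal (1 / c1) * ennreal (V (noise N w k)) \<partial>P)"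
      proof (intro nn_integral_mono)
        fix w
        have "ennreal (norm (noise N w k)) \<le> ennreal (1 + 1 / c1 * V (noise N w k))"
          using le[of "noise N w k"] by (intro ennreal_leI) simp
        also have "\<dots> = 1 + ennreal (1 / c1) * ennreal (V (noise N w k))"
          using c1(1) V_nonneg[of "noise N w k"] by (subst ennreal_plus) (auto simp: ennreal_mult[symmetric])
        finally show "ennreal (norm (noise N w k)) \<le> 1 + ennreal (1 / c1) * ennreal (V (noise N w k))" .
      qed
      also have "\<dots> = 1 + ennreal (1 / c1) * (\<integral>\<^sup>+w. ennreal (V (noise N w k)) \<partial>P)"
        by (subst nn_integral_add) (auto simp: nn_integral_cmult P.emeasure_space_1)
      also have "(\<integral>\<^sup>+w. ennreal (V (noise N w k)) \<partial>P) = (Z.Kop h ^^ k) (\<lambda>y. ennreal (V y)) 0"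
        unfolding P_def noise_def h_def[symmetric] by (rule Z.euler_law[OF h(1) _ k]) simp
      also have "1 + ennreal (1 / c1) * (Z.Kop h ^^ k) (\<lambda>y. ennreal (V y)) 0 \<le> 1 + ennreal (1 / c1) * ennreal C"
        using kh(4)[OF h, of k 0] V_scale[of 0 0] by (intro add_left_mono mult_left_mono) auto
      also have "\<dots> = ennreal D" using c1(1) kh(3) unfolding D_def
        by (subst ennreal_plus) (auto simp: ennreal_mult[symmetric])
      finally show ?thesis .
    qed
    define S where "S w = norm (noise N w N) + (\<Sum>k<N. h * norm (noise N w k))" for w
    have S0: "0 \<le> S w" for w using h by (auto simp: S_def intro!: add_nonneg_nonneg sum_nonneg)
    have Sm [measurable]: "S \<in> borel_measurable P" unfolding S_def
      by (intro borel_measurable_add borel_measurable_sum borel_measurable_times borel_measurable_norm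
          measurable_compose[OF nm borel_measurable_norm]) (auto intro!: nm)
    have "(\<integral>\<^sup>+w. ennreal (S w) \<partial>P) = (\<integral>\<^sup>+w. ennreal (norm (noise N w N)) + (\<Sum>k<N. ennreal h * ennreal (norm (noise N w k))) \<partial>P)"
      using h by (intro nn_integral_cong)
        (auto simp: S_def ennreal_plus sum_nonneg sum_ennreal[symmetric] ennreal_mult[symmetric] simp del: sum_ennreal)
    also have "\<dots> = (\<integral>\<^sup>+w. ennreal (norm (noise N w N)) \<partial>P) + (\<Sum>k<N. ennreal h * (\<integral>\<^sup>+w. ennreal (norm (noise N w k)) \<partial>P))"
    proof -
      have m: "(\<lambda>w. ennreal (norm (noise N w k))) \<in> borel_measurable P" if "k \<le> N" for k
        using nm[OF that] by measurable
      have "(\<integral>\<^sup>+w. (\<Sum>k<N. ennreal h * ennreal (norm (noise N w k))) \<partial>P) = (\<Sum>k<N. \<integral>\<^sup>+w. ennreal h * ennreal (norm (noise N w k)) \<partial>P)"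
        by (rule nn_integral_sum) (auto intro!: borel_measurable_times_ennreal m)
      also have "\<dots> = (\<Sum>k<N. ennreal h * (\<integral>\<^sup>+w. ennreal (norm (noise N w k)) \<partial>P))"
        by (intro sum.cong refl nn_integral_cmult m) auto
      finally show ?thesis
        using m by (subst nn_integral_add) (auto intro!: borel_measurable_sum borel_measurable_times_ennreal)
    qed
    also have "\<dots> \<le> ennreal D + (\<Sum>k<N. ennreal h * ennreal D)"
      by (intro add_mono sum_mono mult_left_mono nb) auto
    also have "\<dots> = ennreal (2 * D)"
      using D h N0 by (simp add: ennreal_mult[symmetric] h_def ennreal_of_nat_eq_real_of_nat ennreal_plus[symmetric] del: ennreal_plus)
    finally have S: "(\<integral>\<^sup>+w. ennreal (S w) \<partial>P) \<le> ennreal (2 * D)" .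
    define bad where "bad = {w \<in> space P. 1 \<le> ennreal (1 / r) * ennreal (S w)}"
    have bm: "bad \<in> sets P" unfolding bad_def by measurable
    have "emeasure P bad \<le> ennreal (1 / r) * (\<integral>\<^sup>+w. ennreal (S w) * indicator (space P) w \<partial>P)"
      unfolding bad_def by (rule nn_integral_Markov_inequality) auto
    also have "(\<integral>\<^sup>+w. ennreal (S w) * indicator (space P) w \<partial>P) = (\<integral>\<^sup>+w. ennreal (S w) \<partial>P)"
      by (intro nn_integral_cong) auto
    also have "ennreal (1 / r) * (\<integral>\<^sup>+w. ennreal (S w) \<partial>P) \<le> ennreal (1 / r) * ennreal (2 * D)"
      by (intro mult_left_mono S) simp
    also have "\<dots> = ennreal (1 / 2)" using r D by (simp add: ennreal_mult[symmetric] r_def)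
    finally have "ennreal (P.prob bad) \<le> ennreal (1 / 2)" unfolding P.emeasure_eq_measure .
    then have "P.prob bad \<le> 1 / 2" by (subst (asm) ennreal_le_iff) auto
    then have "1 / 2 \<le> P.prob (space P - bad)" by (simp add: P.prob_compl[OF bm])
    also have "\<dots> \<le> P.prob {w \<in> space P. norm (noise N w N) \<le> r \<and> (\<Sum>k<N. 1 / N * norm (noise N w k)) \<le> r}"
    proof (rule P.finite_measure_mono)
      show "space P - bad \<subseteq> {w \<in> space P. norm (noise N w N) \<le> r \<and> (\<Sum>k<N. 1 / N * norm (noise N w k)) \<le> r}"
      proof
        fix w assume w: "w \<in> space P - bad"
        then have "\<not> 1 \<le> S w / r"
          using S0[of w] r unfolding bad_def by (auto simp: ennreal_mult[symmetric] ennreal_1[symmetric] simp del: ennreal_1)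
        then have "S w \<le> r" using r by (simp add: field_simps)
        moreover have "0 \<le> (\<Sum>k<N. h * norm (noise N w k))" using h by (intro sum_nonneg) auto
        ultimately have "norm (noise N w N) \<le> r" "(\<Sum>k<N. h * norm (noise N w k)) \<le> r"
          unfolding S_def using norm_ge_zero[of "noise N w N"] by linarith+
        then show "w \<in> {w \<in> space P. norm (noise N w N) \<le> r \<and> (\<Sum>k<N. 1 / N * norm (noise N w k)) \<le> r}"
          using w by (auto simp: h_def)
      qed
      have [measurable]: "(\<lambda>w. \<Sum>k<N. 1 / N * norm (noise N w k)) \<in> borel_measurable P"
        by (intro borel_measurable_sum borel_measurable_times borel_measurable_norm nm) auto
      show "{w \<in> space P. norm (noise N w N) \<le> r \<and> (\<Sum>k<N. 1 / N * norm (noise N w k)) \<le> r} \<in> sets P"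
        using nm[OF order_refl] by measurable
    qed
    finally have "ennreal (1 / 2) \<le> emeasure P {w \<in> space P. norm (noise N w N) \<le> r \<and> (\<Sum>k<N. 1 / N * norm (noise N w k)) \<le> r}"
      unfolding P.emeasure_eq_measure by (rule ennreal_leI)
    then show ?thesis unfolding P_def h_def .
  qed
  then show ?thesis using r N1' that by blast
qed

text \<open>The unsteered expectation dominates the steered one for each \<open>v\<close>
  separately. Averaging over \<open>v\<close> in a ball and exchanging the integrals leaves, for
  each good noise path, a push-forward of Lebesgue measure under a Lipschitz map that covers the
  unit ball.\<close>

lemma euler_minorization:
  assumes kal: "kalman A B"
  obtains N0 where "0 < N0" "\<And>\<rho>. 0 \<le> \<rho> \<Longrightarrow> \<exists>e>0. \<forall>N\<ge>N0. \<forall>x f. norm x \<le> \<rho> \<longrightarrow> f \<in> borel_measurable borel \<longrightarrow>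
    ennreal e * (\<integral>\<^sup>+y. f y * indicator (cball 0 1) y \<partial>lborel) \<le> (Kop (1 / N) ^^ N) f x"
proof -
  obtain r N1 where rN1: "0 < r" "0 < N1" "\<And>N. N1 \<le> N \<Longrightarrow>
    ennreal (1 / 2) \<le> emeasure (PiM {..<N} (\<lambda>_. gauss (1 / N)))
      {w \<in> space (PiM {..<N} (\<lambda>_. gauss (1 / N))). norm (noise N w N) \<le> r \<and> (\<Sum>k<N. 1 / N * norm (noise N w k)) \<le> r}"
    using noise_moderate by blast
  obtain N2 where N2: "0 < N2" "\<And>\<rho> r. 0 \<le> \<rho> \<Longrightarrow> 0 \<le> r \<Longrightarrow> \<exists>R>0. \<forall>N\<ge>N2. \<forall>x w. norm x \<le> \<rho> \<longrightarrow> norm (noise N w N) \<le> r \<longrightarrow>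
      (\<Sum>k<N. 1 / N * norm (noise N w k)) \<le> r \<longrightarrow> cball 0 1 \<subseteq> (\<lambda>v. eu (1 / N) x (steer N v w) N) ` cball 0 R"
    using steered_onto[OF kal] by blast
  obtain kl where kl: "0 < kl"
    "\<And>N x w v v'. 0 < N \<Longrightarrow> norm (eu (1 / N) x (steer N v w) N - eu (1 / N) x (steer N v' w) N) \<le> kl * norm (v - v')"
    using steered_lipschitz by blast
  obtain CU where CU: "0 < CU" "\<And>N v k. norm (ctrl N v k) \<le> CU * norm v" using ctrl_bound by blast
  have "\<exists>e>0. \<forall>N\<ge>max N1 N2. \<forall>x f. norm x \<le> \<rho> \<longrightarrow> f \<in> borel_measurable borel \<longrightarrow>
    ennreal e * (\<integral>\<^sup>+y. f y * indicator (cball 0 1) y \<partial>lborel) \<le> (Kop (1 / N) ^^ N) f x" if \<rho>: "0 \<le> \<rho>" for \<rho>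
  proof -
    obtain R where R: "0 < R" "\<And>N x w. N2 \<le> N \<Longrightarrow> norm x \<le> \<rho> \<Longrightarrow> norm (noise N w N) \<le> r \<Longrightarrow>
      (\<Sum>k<N. 1 / N * norm (noise N w k)) \<le> r \<Longrightarrow> cball 0 1 \<subseteq> (\<lambda>v. eu (1 / N) x (steer N v w) N) ` cball 0 R"
      using N2(2)[OF \<rho>, of r] rN1(1) by auto
    \<comment> \<open>Lower bound of the Cameron-Martin density: \<open>R * r\<close> bounds the
      pairing of \<open>v\<close> with the final noise, and \<open>(CU * R)^2 / 2\<close> the
      energy, since the \<open>N\<close> squares of size \<open>(h * CU * R)^2\<close> are divided
      by \<open>2 * h\<close> and \<open>N * h = 1\<close>.\<close>
    define \<kappa> where "\<kappa> = exp (- (R * r) - (CU * R)\<^sup>2 / 2)"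
    have \<kappa>: "0 < \<kappa>" by (simp add: \<kappa>_def)
    define Cl where "Cl = (2 * kl * CARD('d)) ^ CARD('d)"
    have Cl: "0 < Cl" using kl(1) by (simp add: Cl_def)
    define m where "m = measure lborel (cball (0::real^'d) R)"
    have em: "emeasure lborel (cball (0::real^'d) R) = ennreal m"
      unfolding m_def by (intro emeasure_eq_ennreal_measure) (use emeasure_lborel_cball_finite[of "0::real^'d" R] in auto)
    have m: "0 < m" unfolding m_def using R(1) by (simp add: content_cball_pos)
    \<comment> \<open>Solves \<open>\<kappa> / 2 * I <= Cl * m * T\<close> for \<open>T\<close>:
      half for the probability of the good event, \<open>Cl\<close> for the volume distortion,
      \<open>m\<close> for the volume of the ball of controls.\<close>
    define e where "e = 1 / (Cl * m) * (\<kappa> * (1 / 2))"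
    have e: "0 < e" using Cl m \<kappa> by (simp add: e_def)
    have "ennreal e * (\<integral>\<^sup>+y. f y * indicator (cball 0 1) y \<partial>lborel) \<le> (Kop (1 / N) ^^ N) f x"
      if N: "max N1 N2 \<le> N" and x: "norm x \<le> \<rho>" and f [measurable]: "f \<in> borel_measurable borel" for N x f
    proof -
      define h where "h = 1 / real N"
      have N0: "0 < N" using N N2(1) by simp
      have h: "0 < h" "real N * h = 1" using N0 by (auto simp: h_def)
      define P where "P = PiM {..<N} (\<lambda>_. gauss h :: (real^'n) measure)"
      interpret P: prob_space P unfolding P_def by (intro prob_space_PiM prob_space_gauss h)
      define I where "I = (\<integral>\<^sup>+y. f y * indicator (cball 0 1) y \<partial>lborel)"
      define T where "T = (Kop h ^^ N) f x"
      define Gd where "Gd = {w \<in> space P. norm (noise N w N) \<le> r \<and> (\<Sum>k<N. 1 / N * norm (noise N w k)) \<le> r}"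
      have nm: "(\<lambda>w. noise N w k) \<in> borel_measurable P" if "k \<le> N" for k
        unfolding P_def using that N0 by (rule noise_measurable)
      have nn: "(\<lambda>w. norm (noise N w k)) \<in> borel_measurable P" if "k \<le> N" for k
        using nm[OF that] by measurable
      have [measurable]: "(\<lambda>w. \<Sum>k<N. 1 / N * norm (noise N w k)) \<in> borel_measurable P"
        by (intro borel_measurable_sum borel_measurable_times borel_measurable_const nn) auto
      have Gm [measurable]: "Gd \<in> sets P" unfolding Gd_def using nm[OF order_refl] by measurable
      have PG: "ennreal (1 / 2) \<le> emeasure P Gd"
        using rN1(3)[of N] N unfolding Gd_def P_def h_def by simp
      let ?\<Phi> = "\<lambda>v w. eu h x (steer N v w) N"
      have comp: "(\<lambda>w. w j) \<in> borel_measurable P" if "j < N" for j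
        unfolding P_def using that by (auto intro!: measurable_component_singleton
          simp: measurable_cong_sets[OF refl sets_gauss, symmetric] cong: measurable_cong_sets)
      have ctm [measurable]: "(\<lambda>v. ctrl N v j) \<in> borel_measurable borel" for j
        by (intro borel_measurable_continuous_onI linear_continuous_on)
          (use linear_ctrl linear_conv_bounded_linear in blast)
      have \<Phi>m: "(\<lambda>p. ?\<Phi> (fst p) (snd p)) \<in> borel_measurable (lborel \<Otimes>\<^sub>M P)"
      proof (rule measurable_euler)
        show "(\<lambda>p. steer N (fst p) (snd p) j) \<in> borel_measurable (lborel \<Otimes>\<^sub>M P)" if "j < N" for j
          unfolding steer_def
          by (intro borel_measurable_add borel_measurable_scaleR borel_measurable_const
              measurable_compose[OF measurable_snd comp[OF that]] measurable_compose[OF measurable_fst]) simp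
      qed simp
      have fm: "(\<lambda>p. f (?\<Phi> (fst p) (snd p)) * indicator Gd (snd p) * indicator (cball 0 R) (fst p)) \<in> borel_measurable (lborel \<Otimes>\<^sub>M P)"
        using measurable_compose[OF \<Phi>m f]
        by (intro borel_measurable_times_ennreal measurable_compose[OF measurable_snd borel_measurable_indicator[OF Gm]]
            measurable_compose[OF measurable_fst borel_measurable_indicator]) auto
      \<comment> \<open>Steering by a fixed \<open>v\<close> only reweights the noise, by a density
        at least \<open>\<kappa>\<close> on \<open>Gd\<close>; what happens off \<open>Gd\<close> is
        discarded.\<close>
      have shift: "ennreal \<kappa> * (\<integral>\<^sup>+w. f (?\<Phi> v w) * indicator Gd w \<partial>P) \<le> T" if v: "v \<in> cball 0 R" for v
      proof -
        have v': "norm v \<le> R" using v by simp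
        define a where "a k = h *\<^sub>R ctrl N v k" for k
        let ?E = "\<lambda>w. exp (- ((\<Sum>k<N. a k \<bullet> w k) / h) - (\<Sum>k<N. (norm (a k))\<^sup>2) / (2 * h))"
        have "(\<lambda>w. f (eu h x w N)) \<in> borel_measurable P"
          using measurable_compose[OF measurable_euler[of "\<lambda>_. x" P N "\<lambda>w. w"] f] comp by auto
        then have "(\<integral>\<^sup>+w. f (eu h x w N) \<partial>P) = (\<integral>\<^sup>+w. f (eu h x (\<lambda>k\<in>{..<N}. w k + a k) N) * ennreal (?E w) \<partial>P)"
          unfolding P_def by (rule gauss_PiM_shift[OF h(1)])
        also have "\<dots> = (\<integral>\<^sup>+w. f (?\<Phi> v w) * ennreal (?E w) \<partial>P)"
          by (intro nn_integral_cong arg_cong2[where f = "(*)"] arg_cong[of _ _ f] euler_cong refl)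
            (simp add: steer_def a_def h_def)
        also have "\<dots> \<ge> (\<integral>\<^sup>+w. ennreal \<kappa> * (f (?\<Phi> v w) * indicator Gd w) \<partial>P)"
        proof (intro nn_integral_mono)
          fix w
          show "ennreal \<kappa> * (f (?\<Phi> v w) * indicator Gd w) \<le> f (?\<Phi> v w) * ennreal (?E w)"
          proof (cases "w \<in> Gd")
            case True
            have "(\<Sum>k<N. a k \<bullet> w k) = h * (v \<bullet> noise N w N)"
              by (simp add: a_def ctrl_noise[symmetric] sum_distrib_left)
            then have "(\<Sum>k<N. a k \<bullet> w k) / h = v \<bullet> noise N w N" using h by simp
            also have "\<dots> \<le> norm v * norm (noise N w N)" by (rule norm_cauchy_schwarz)
            also have "\<dots> \<le> R * r" using v' True R(1) by (intro mult_mono) (auto simp: Gd_def)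
            finally have 1: "(\<Sum>k<N. a k \<bullet> w k) / h \<le> R * r" .
            have "(\<Sum>k<N. (norm (a k))\<^sup>2) \<le> (\<Sum>k<N. (h * (CU * R))\<^sup>2)"
            proof (intro sum_mono power_mono)
              fix k
              have "norm (ctrl N v k) \<le> CU * R"
                using order_trans[OF CU(2) mult_left_mono[OF v']] CU(1) by simp
              then show "norm (a k) \<le> h * (CU * R)" using h by (simp add: a_def)
            qed simp
            also have "\<dots> = (real N * h) * h * (CU * R)\<^sup>2" by (simp add: power_mult_distrib power2_eq_square)
            also have "\<dots> = h * (CU * R)\<^sup>2" by (simp only: h(2) mult_1_left)
            finally have 2: "(\<Sum>k<N. (norm (a k))\<^sup>2) / (2 * h) \<le> (CU * R)\<^sup>2 / 2"
              using h by (simp add: field_simps)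
            have "ennreal \<kappa> \<le> ennreal (?E w)" unfolding \<kappa>_def using 1 2 by (intro ennreal_leI) simp
            from mult_right_mono[OF this, of "f (?\<Phi> v w)"]
            have "ennreal \<kappa> * f (?\<Phi> v w) \<le> f (?\<Phi> v w) * ennreal (?E w)"
              by (simp only: mult.commute[of "f (?\<Phi> v w)"]) simp
            moreover have "indicator Gd w = (1 :: ennreal)" using True by simp
            ultimately show ?thesis by (simp only: mult_1_right)
          qed simp
        qed
        finally have "(\<integral>\<^sup>+w. ennreal \<kappa> * (f (?\<Phi> v w) * indicator Gd w) \<partial>P) \<le> (\<integral>\<^sup>+w. f (eu h x w N) \<partial>P)" .
        moreover have "(\<integral>\<^sup>+w. f (eu h x w N) \<partial>P) = T"
          unfolding P_def T_def by (rule euler_law[OF h(1) f order_refl])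
        moreover have "(\<lambda>w. f (?\<Phi> v w) * indicator Gd w) \<in> borel_measurable P"
        proof -
          have "(\<lambda>w. ?\<Phi> v w) \<in> borel_measurable P"
            by (intro measurable_euler) (auto simp: steer_def intro!: borel_measurable_add comp)
          from measurable_compose[OF this f] show ?thesis by (intro borel_measurable_times_ennreal) auto
        qed
        ultimately show ?thesis by (simp add: nn_integral_cmult)
      qed
      have "ennreal \<kappa> * (ennreal (1 / 2) * I) \<le> ennreal \<kappa> * (emeasure P Gd * I)"
        by (intro mult_left_mono mult_right_mono PG) auto
      also have "emeasure P Gd * I = (\<integral>\<^sup>+w. I * indicator Gd w \<partial>P)"
        using Gm by (simp add: nn_integral_cmult_indicator mult.commute)
      \<comment> \<open>Pathwise in \<open>w\<close>: on the good event the end-point map covers the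
        unit ball, so its push-forward dominates there.\<close>
      also have "\<dots> \<le> (\<integral>\<^sup>+w. ennreal Cl * (\<integral>\<^sup>+v. f (?\<Phi> v w) * indicator Gd w * indicator (cball 0 R) v \<partial>lborel) \<partial>P)"
      proof (intro nn_integral_mono)
        fix w assume "w \<in> space P"
        show "I * indicator Gd w \<le> ennreal Cl * (\<integral>\<^sup>+v. f (?\<Phi> v w) * indicator Gd w * indicator (cball 0 R) v \<partial>lborel)"
        proof (cases "w \<in> Gd")
          case True
          have onto: "cball 0 1 \<subseteq> (\<lambda>v. ?\<Phi> v w) ` cball 0 R"
            using R(2)[of N x w] N x True unfolding Gd_def h_def by auto
          have "I \<le> ennreal ((2 * kl * DIM(real^'d)) ^ DIM(real^'d)) * (\<integral>\<^sup>+v. f (?\<Phi> v w) * indicator (cball 0 R) v \<partial>lborel)"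
            unfolding I_def
            by (rule lipschitz_preimage_nn_integral[OF _ kl(1) onto f]) (use kl(2)[OF N0] in \<open>simp add: h_def\<close>)
          then show ?thesis using True by (simp add: Cl_def)
        qed simp
      qed
      also have "\<dots> = ennreal Cl * (\<integral>\<^sup>+w. (\<integral>\<^sup>+v. f (?\<Phi> v w) * indicator Gd w * indicator (cball 0 R) v \<partial>lborel) \<partial>P)"
        using measurable_compose[OF measurable_pair_swap' fm]
        by (intro nn_integral_cmult lborel.borel_measurable_nn_integral) (simp add: split_beta)
      also have "(\<integral>\<^sup>+w. (\<integral>\<^sup>+v. f (?\<Phi> v w) * indicator Gd w * indicator (cball 0 R) v \<partial>lborel) \<partial>P)
        = (\<integral>\<^sup>+v. (\<integral>\<^sup>+w. f (?\<Phi> v w) * indicator Gd w * indicator (cball 0 R) v \<partial>P) \<partial>lborel)"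
      proof -
        interpret pair_sigma_finite lborel P
          by (intro pair_sigma_finite.intro lborel.sigma_finite_measure_axioms P.sigma_finite_measure_axioms)
        show ?thesis by (rule Fubini') (use fm in \<open>simp add: split_beta\<close>)
      qed
      finally have 1: "ennreal \<kappa> * (ennreal (1 / 2) * I)
        \<le> ennreal \<kappa> * (ennreal Cl * (\<integral>\<^sup>+v. (\<integral>\<^sup>+w. f (?\<Phi> v w) * indicator Gd w * indicator (cball 0 R) v \<partial>P) \<partial>lborel))"
        by (simp add: mult_left_mono)
      have "ennreal \<kappa> * (\<integral>\<^sup>+v. (\<integral>\<^sup>+w. f (?\<Phi> v w) * indicator Gd w * indicator (cball 0 R) v \<partial>P) \<partial>lborel)
        = (\<integral>\<^sup>+v. ennreal \<kappa> * (\<integral>\<^sup>+w. f (?\<Phi> v w) * indicator Gd w * indicator (cball 0 R) v \<partial>P) \<partial>lborel)"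
        using fm by (intro nn_integral_cmult[symmetric] P.borel_measurable_nn_integral) (simp add: split_beta)
      also have "\<dots> \<le> (\<integral>\<^sup>+v. T * indicator (cball (0::real^'d) R) v \<partial>lborel)"
      proof (intro nn_integral_mono)
        fix v
        show "ennreal \<kappa> * (\<integral>\<^sup>+w. f (?\<Phi> v w) * indicator Gd w * indicator (cball 0 R) v \<partial>P) \<le> T * indicator (cball 0 R) v"
          by (cases "v \<in> cball 0 R") (use shift in auto)
      qed
      also have "\<dots> = T * ennreal m" by (simp add: nn_integral_cmult_indicator em)
      finally have "ennreal Cl * (ennreal \<kappa> * (\<integral>\<^sup>+v. (\<integral>\<^sup>+w. f (?\<Phi> v w) * indicator Gd w * indicator (cball 0 R) v \<partial>P) \<partial>lborel))
        \<le> ennreal Cl * (T * ennreal m)" by (rule mult_left_mono) simp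
      then have 2: "ennreal \<kappa> * (ennreal (1 / 2) * I) \<le> ennreal Cl * (T * ennreal m)"
        using 1 by (simp add: mult.left_commute)
      have "ennreal e * I = ennreal (1 / (Cl * m)) * (ennreal \<kappa> * (ennreal (1 / 2) * I))"
      proof -
        have "ennreal e = ennreal (1 / (Cl * m)) * ennreal (\<kappa> * (1 / 2))"
          unfolding e_def using Cl m \<kappa> by (intro ennreal_mult) auto
        also have "ennreal (\<kappa> * (1 / 2)) = ennreal \<kappa> * ennreal (1 / 2)"
          using \<kappa> by (intro ennreal_mult) auto
        finally show ?thesis by (simp only: mult.assoc)
      qed
      also have "\<dots> \<le> ennreal (1 / (Cl * m)) * (ennreal Cl * (T * ennreal m))"
        by (rule mult_left_mono[OF 2]) simp
      also have "\<dots> = (ennreal (1 / (Cl * m)) * (ennreal Cl * ennreal m)) * T"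
        by (simp only: mult_ac)
      also have "ennreal (1 / (Cl * m)) * (ennreal Cl * ennreal m) = 1"
        using Cl m by (simp add: ennreal_mult[symmetric])
      finally show ?thesis by (simp add: I_def T_def h_def)
    qed
    then show ?thesis using e by blast
  qed
  then show ?thesis using rN1(2) that[of "max N1 N2"] by auto
qed

end

context sde
begin

text \<open>The discrete constant is the same for all fine meshes, so the inequality survives the
  limit for continuous test functions and extends to Borel sets by
  \<open>emeasure_le_of_continuous\<close>.\<close>

lemma minorization:
  assumes kal: "kalman A B" and \<rho>: "0 \<le> \<rho>"
  obtains e where "0 < e" "\<And>x E. norm x \<le> \<rho> \<Longrightarrow> E \<in> sets borel \<Longrightarrow>
    ennreal e * emeasure lborel (E \<inter> cball 0 1) \<le> emeasure (transP M X 1 x) E"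
proof -
  obtain N0 where N0: "0 < N0" "\<And>\<rho>. 0 \<le> \<rho> \<Longrightarrow> \<exists>e>0. \<forall>N\<ge>N0. \<forall>x f. norm x \<le> \<rho> \<longrightarrow> f \<in> borel_measurable borel \<longrightarrow>
    ennreal e * (\<integral>\<^sup>+y. f y * indicator (cball 0 1) y \<partial>lborel) \<le> (Kop (1 / N) ^^ N) f x"
    using euler_minorization[OF kal] by blast
  then obtain e where e: "0 < e" "\<And>N x f. N0 \<le> N \<Longrightarrow> norm x \<le> \<rho> \<Longrightarrow> f \<in> borel_measurable borel \<Longrightarrow>
    ennreal e * (\<integral>\<^sup>+y. f y * indicator (cball 0 1) y \<partial>lborel) \<le> (Kop (1 / N) ^^ N) f x"
    using \<rho> by meson
  let ?\<nu> = "scale_measure (ennreal e) (density lborel (indicator (cball (0::real^'d) 1)))"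
  have "ennreal e * emeasure lborel (E \<inter> cball 0 1) \<le> emeasure (transP M X 1 x) E"
    if x: "norm x \<le> \<rho>" and E: "E \<in> sets borel" for x E
  proof -
    have "emeasure ?\<nu> E \<le> emeasure (transP M X 1 x) E"
    proof (rule emeasure_le_of_continuous[OF _ _ _ _ E])
      show "finite_measure (transP M X 1 x)" using prob_space_transP[of 1 x] by (simp add: prob_space_def)
      fix f :: "real^'d \<Rightarrow> real" assume f: "continuous_on UNIV f" "\<And>x. 0 \<le> f x \<and> f x \<le> 1"
      have [measurable]: "f \<in> borel_measurable borel" by (intro borel_measurable_continuous_onI f)
      let ?u = "\<lambda>n \<omega>. ennreal (f (eu (1 / real (Suc (N0 + n))) x (incr 0 (1 / real (Suc (N0 + n))) \<omega>) (Suc (N0 + n))))"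
      have um: "(\<lambda>\<omega>. eu h x (incr 0 h' \<omega>) k) \<in> borel_measurable M" for h h' k
        by (rule measurable_euler) measurable
      have ul: "(\<lambda>n. ?u n \<omega>) \<longlonglongrightarrow> ennreal (f (X 1 x \<omega>))" if \<omega>: "\<omega> \<in> space M" for \<omega>
      proof (intro tendsto_ennrealI continuous_on_tendsto_compose[OF f(1)])
        show "(\<lambda>n. eu (1 / real (Suc (N0 + n))) x (incr 0 (1 / real (Suc (N0 + n))) \<omega>) (Suc (N0 + n))) \<longlonglongrightarrow> X 1 x \<omega>"
          using LIMSEQ_ignore_initial_segment[OF euler_tendsto_X0[OF \<omega>, of 1 x], of "Suc N0"]
          by (simp add: add.commute del: euler.simps of_nat_Suc)
      qed auto
      have "(\<lambda>n. \<integral>\<^sup>+\<omega>. ?u n \<omega> \<partial>M) \<longlonglongrightarrow> (\<integral>\<^sup>+\<omega>. ennreal (f (X 1 x \<omega>)) \<partial>M)"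
      proof (rule nn_integral_bounded_convergence)
        show "?u n \<in> borel_measurable M" for n
          by (rule measurable_compose[OF um]) measurable
        show "(\<lambda>\<omega>. ennreal (f (X 1 x \<omega>))) \<in> borel_measurable M"
          by (rule measurable_compose[OF X_measurable]) auto
        show "?u n \<omega> \<le> 1" for n \<omega> using f(2) by simp
      qed (rule ul)
      moreover have "(\<integral>\<^sup>+\<omega>. ?u n \<omega> \<partial>M) = (Kop (1 / real (Suc (N0 + n))) ^^ Suc (N0 + n)) (\<lambda>y. ennreal (f y)) x" for n
        by (rule euler_incr_law) auto
      ultimately have lim: "(\<lambda>n. (Kop (1 / real (Suc (N0 + n))) ^^ Suc (N0 + n)) (\<lambda>y. ennreal (f y)) x)
        \<longlonglongrightarrow> (\<integral>\<^sup>+y. ennreal (f y) \<partial>transP M X 1 x)"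
        by (simp add: nn_integral_transP)
      have "(\<integral>\<^sup>+y. ennreal (f y) \<partial>?\<nu>) = ennreal e * (\<integral>\<^sup>+y. ennreal (f y) * indicator (cball 0 1) y \<partial>lborel)"
        by (subst nn_integral_scale_measure, simp, subst nn_integral_density)
          (auto simp: mult.commute intro!: borel_measurable_indicator)
      also have "\<dots> \<le> (\<integral>\<^sup>+y. ennreal (f y) \<partial>transP M X 1 x)"
        by (rule LIMSEQ_le_const[OF lim]) (auto intro!: e x exI[of _ 0] simp del: funpow.simps of_nat_Suc)
      finally show "(\<integral>\<^sup>+y. ennreal (f y) \<partial>?\<nu>) \<le> (\<integral>\<^sup>+y. ennreal (f y) \<partial>transP M X 1 x)" .
    qed auto
    moreover have "emeasure ?\<nu> E = ennreal e * emeasure lborel (E \<inter> cball 0 1)"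
      using E by (simp, subst emeasure_density)
        (auto simp: indicator_inter_arith[symmetric] Int_commute intro!: borel_measurable_indicator)
    ultimately show ?thesis by simp
  qed
  then show ?thesis using e(1) that by blast
qed

end

section \<open>Contraction in a weighted oscillation, invariant measure and rate, for an abstract
  semigroup\<close>

section \<open>Harris' theorem\<close>

text \<open>Layer cake: the integral of \<open>g\<close> is the integral over levels in
  \<open>(0, 1]\<close> of the measure of \<open>{x. s <= g x}\<close>, so the excess
  \<open>\<delta>\<close> is integrated over an interval of length 1.\<close>

lemma nn_integral_le_of_measure_le:
  assumes m: "prob_space m" "sets m = sets borel" and \<mu>: "prob_space \<mu>" "sets \<mu> = sets borel"
    and close: "\<And>E. E \<in> sets borel \<Longrightarrow> emeasure m E \<le> emeasure \<mu> E + ennreal \<delta>"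
    and g: "g \<in> borel_measurable borel" "\<And>x. 0 \<le> g x" "\<And>x. g x \<le> 1"
  shows "(\<integral>\<^sup>+x. ennreal (g x) \<partial>m) \<le> (\<integral>\<^sup>+x. ennreal (g x) \<partial>\<mu>) + ennreal \<delta>"
proof -
  let ?i = "\<lambda>x s. indicator {p. 0 < snd p \<and> snd p \<le> g (fst p)} (x, s :: real) :: ennreal"
  have cake: "(\<integral>\<^sup>+x. ennreal (g x) \<partial>N) = (\<integral>\<^sup>+s. emeasure N {x. s \<le> g x} * indicator {0<..1} s \<partial>lborel)"
    and meas: "(\<lambda>s. emeasure N {x. s \<le> g x}) \<in> borel_measurable borel"
    if N: "prob_space N" "sets N = sets borel" for N
  proof -
    interpret N: prob_space N by (rule N)
    interpret pair_sigma_finite N lborel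
      by (intro pair_sigma_finite.intro N.sigma_finite_measure_axioms lborel.sigma_finite_measure_axioms)
    have gN [measurable]: "g \<in> borel_measurable N" using g(1) N(2) by (simp cong: measurable_cong_sets)
    have spN: "space N = UNIV" using sets_eq_imp_space_eq[OF N(2)] by simp
    have im: "(\<lambda>p. ?i (fst p) (snd p)) \<in> borel_measurable (N \<Otimes>\<^sub>M lborel)"
      by (intro borel_measurable_indicator') measurable
    have "(\<integral>\<^sup>+x. ennreal (g x) \<partial>N) = (\<integral>\<^sup>+x. (\<integral>\<^sup>+s. ?i x s \<partial>lborel) \<partial>N)"
    proof (intro nn_integral_cong)
      fix x
      have "(\<integral>\<^sup>+s. ?i x s \<partial>lborel) = (\<integral>\<^sup>+s. indicator {0<..g x} s \<partial>lborel)"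
        by (intro nn_integral_cong) (auto split: split_indicator)
      then show "ennreal (g x) = (\<integral>\<^sup>+s. ?i x s \<partial>lborel)" using g(2)[of x] by simp
    qed
    also have "\<dots> = (\<integral>\<^sup>+s. (\<integral>\<^sup>+x. ?i x s \<partial>N) \<partial>lborel)"
      by (rule Fubini'[symmetric]) (use im in \<open>simp add: split_beta\<close>)
    also have "\<dots> = (\<integral>\<^sup>+s. emeasure N {x. s \<le> g x} * indicator {0<..1} s \<partial>lborel)"
    proof (intro nn_integral_cong)
      fix s :: real
      have sm: "{x. s \<le> g x} \<in> sets N"
        using measurable_sets[OF gN, of "{s..}"] spN by (simp add: vimage_def)
      have "(\<integral>\<^sup>+x. ?i x s \<partial>N) = (\<integral>\<^sup>+x. indicator {0<..1} s * indicator {x. s \<le> g x} x \<partial>N)"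
        using g(3) order_trans by (intro nn_integral_cong) (fastforce split: split_indicator)
      also have "\<dots> = indicator {0<..1} s * emeasure N {x. s \<le> g x}"
        using sm by (rule nn_integral_cmult_indicator)
      finally show "(\<integral>\<^sup>+x. ?i x s \<partial>N) = emeasure N {x. s \<le> g x} * indicator {0<..1} s"
        by (simp add: mult.commute)
    qed
    finally show "(\<integral>\<^sup>+x. ennreal (g x) \<partial>N) = (\<integral>\<^sup>+s. emeasure N {x. s \<le> g x} * indicator {0<..1} s \<partial>lborel)" .
    have "(\<lambda>s. emeasure N (Pair s -` {p \<in> space (lborel \<Otimes>\<^sub>M N). fst p \<le> g (snd p)})) \<in> borel_measurable lborel"
      by (rule N.measurable_emeasure_Pair) measurable
    moreover have "Pair s -` {p \<in> space (lborel \<Otimes>\<^sub>M N). fst p \<le> g (snd p)} = {x. s \<le> g x}" for s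
      using spN by (auto simp: space_pair_measure)
    ultimately show "(\<lambda>s. emeasure N {x. s \<le> g x}) \<in> borel_measurable borel" by simp
  qed
  have "(\<integral>\<^sup>+x. ennreal (g x) \<partial>m) \<le> (\<integral>\<^sup>+s. emeasure \<mu> {x. s \<le> g x} * indicator {0<..1} s + ennreal \<delta> * indicator {0<..1} s \<partial>lborel)"
    unfolding cake[OF m]
  proof (intro nn_integral_mono)
    fix s :: real
    have "{x. s \<le> g x} \<in> sets borel" using measurable_sets[OF g(1), of "{s..}"] by (simp add: vimage_def)
    from mult_right_mono[OF close[OF this], of "indicator {0<..1} s"]
    show "emeasure m {x. s \<le> g x} * indicator {0<..1} s
      \<le> emeasure \<mu> {x. s \<le> g x} * indicator {0<..1} s + ennreal \<delta> * indicator {0<..1} s"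
      by (simp add: distrib_right)
  qed
  also have "\<dots> = (\<integral>\<^sup>+x. ennreal (g x) \<partial>\<mu>) + ennreal \<delta>"
    unfolding cake[OF \<mu>]
    by (subst nn_integral_add) (use meas[OF \<mu>] in \<open>auto simp: nn_integral_cmult_indicator\<close>)
  finally show ?thesis .
qed

text \<open>The minorization is required on every sublevel set because the level that matters is
  fixed only in \<open>contraction\<close>, in terms of \<open>k\<close> and
  \<open>C\<close>.\<close>

locale harris =
  fixes P :: "real \<Rightarrow> 'a::topological_space \<Rightarrow> 'a measure" and V :: "'a \<Rightarrow> real" and k C :: real
  assumes kernel: "\<And>t. 0 \<le> t \<Longrightarrow> P t \<in> measurable borel (subprob_algebra borel)"
    and prob: "\<And>t x. 0 \<le> t \<Longrightarrow> prob_space (P t x)"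
    and start: "\<And>x. P 0 x = return borel x"
    and semigroup: "\<And>s t x. 0 \<le> s \<Longrightarrow> 0 \<le> t \<Longrightarrow> P (s + t) x = P s x \<bind> P t"
    and Vm: "V \<in> borel_measurable borel" and V0: "\<And>x. 0 \<le> V x"
    and k: "0 < k" and C: "0 \<le> C"
    and drift: "\<And>t x. 0 \<le> t \<Longrightarrow> (\<integral>\<^sup>+y. ennreal (V y) \<partial>P t x) \<le> ennreal (exp (- k * t) * V x + C)"
    and minor: "\<And>R. \<exists>e>0. \<exists>\<nu>. prob_space \<nu> \<and> sets \<nu> = sets borel \<and>
      (\<forall>x E. V x \<le> R \<longrightarrow> E \<in> sets borel \<longrightarrow> ennreal e * emeasure \<nu> E \<le> emeasure (P 1 x) E)"
begin

lemma sets_P: "0 \<le> t \<Longrightarrow> sets (P t x) = sets borel"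
  using sets_kernel[OF kernel, of t x] by simp

lemma space_P: "0 \<le> t \<Longrightarrow> space (P t x) = UNIV"
  using sets_eq_imp_space_eq[OF sets_P] by simp

text \<open>\<open>c\<close> bounds the supremum norm of \<open>f\<close> with weight
  \<open>1 + V\<close>; carrying it explicitly makes all later estimates quantitative.\<close>

definition tame :: "real \<Rightarrow> ('a \<Rightarrow> real) \<Rightarrow> bool" where
  "tame c f \<longleftrightarrow> 0 \<le> c \<and> f \<in> borel_measurable borel \<and> (\<forall>x. \<bar>f x\<bar> \<le> c * (1 + V x))"

lemma tame_integrable:
  assumes f: "tame c f" and m: "prob_space m" "sets m = sets borel" "(\<integral>\<^sup>+y. ennreal (V y) \<partial>m) < \<infinity>"
  shows "integrable m f" "integrable m V" "\<bar>\<integral>y. f y \<partial>m\<bar> \<le> c * (1 + (\<integral>y. V y \<partial>m))"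
proof -
  interpret m: prob_space m by (rule m)
  have Vmm: "V \<in> borel_measurable m" using Vm m(2) by (simp cong: measurable_cong_sets)
  show iV: "integrable m V"
    using m(3) Vmm V0 by (intro integrableI_bounded) auto
  have iW: "integrable m (\<lambda>x. c * (1 + V x))" using iV by simp
  show intf: "integrable m f"
    by (rule Bochner_Integration.integrable_bound[OF iW])
      (use f m(2) in \<open>auto simp: tame_def cong: measurable_cong_sets intro: order_trans[OF _ abs_ge_self]\<close>)
  have "\<bar>\<integral>y. f y \<partial>m\<bar> \<le> (\<integral>y. c * (1 + V y) \<partial>m)"
  proof -
    have "(\<integral>y. \<bar>f y\<bar> \<partial>m) \<le> (\<integral>y. c * (1 + V y) \<partial>m)"
      by (rule integral_mono[OF integrable_abs[OF intf] iW]) (use f in \<open>simp add: tame_def\<close>)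
    then show ?thesis by (rule order_trans[OF integral_abs_bound])
  qed
  also have "\<dots> = c * (1 + (\<integral>y. V y \<partial>m))" using iV m.prob_space by simp
  finally show "\<bar>\<integral>y. f y \<partial>m\<bar> \<le> c * (1 + (\<integral>y. V y \<partial>m))" .
qed

lemma P_V_finite: "0 \<le> t \<Longrightarrow> (\<integral>\<^sup>+y. ennreal (V y) \<partial>P t x) < \<infinity>"
  using drift[of t x] by (auto intro: le_less_trans)

lemma tame_V: "tame 1 V"
  using Vm V0 by (auto simp: tame_def)

lemma P_integrable: "0 \<le> t \<Longrightarrow> tame c f \<Longrightarrow> integrable (P t x) f"
  by (rule tame_integrable(1)[OF _ prob sets_P P_V_finite])

lemma P_V_le:
  assumes t: "0 \<le> t"
  shows "(\<integral>y. V y \<partial>P t x) \<le> exp (- k * t) * V x + C"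
proof -
  have "ennreal (\<integral>y. V y \<partial>P t x) = (\<integral>\<^sup>+y. ennreal (V y) \<partial>P t x)"
    by (rule nn_integral_eq_integral[symmetric]) (use P_integrable[OF t tame_V] V0 in auto)
  then have "ennreal (\<integral>y. V y \<partial>P t x) \<le> ennreal (exp (- k * t) * V x + C)" using drift[OF t] by simp
  then show ?thesis using V0 C by (subst (asm) ennreal_le_iff) auto
qed

lemma P_V_le': "0 \<le> t \<Longrightarrow> (\<integral>y. V y \<partial>P t x) \<le> V x + C"
  using P_V_le[of t x] mult_right_mono[of "exp (- k * t)" 1 "V x"] V0[of x] k by simp

text \<open>The factor \<open>1 + C\<close> does not depend on \<open>t\<close>: the semigroup is
  bounded in the weighted norm uniformly in time.\<close>

lemma tame_P:
  assumes t: "0 \<le> t" and f: "tame c f"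
  shows "tame (c * (1 + C)) (\<lambda>x. \<integral>y. f y \<partial>P t x)"
  unfolding tame_def
proof (intro conjI allI)
  have c: "0 \<le> c" and fm: "f \<in> borel_measurable borel" using f by (auto simp: tame_def)
  show "0 \<le> c * (1 + C)" using c C by simp
  show "(\<lambda>x. \<integral>y. f y \<partial>P t x) \<in> borel_measurable borel"
    by (rule measurable_compose[OF kernel[OF t] integral_measurable_subprob_algebra[OF fm]])
  fix x
  have "\<bar>\<integral>y. f y \<partial>P t x\<bar> \<le> c * (1 + (\<integral>y. V y \<partial>P t x))"
    by (rule tame_integrable(3)[OF f prob[OF t] sets_P[OF t] P_V_finite[OF t]])
  also have "\<dots> \<le> c * (1 + (V x + C))" using c P_V_le'[OF t] by (intro mult_left_mono add_left_mono) auto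
  also have "\<dots> \<le> c * ((1 + C) * (1 + V x))" using c C V0[of x] by (intro mult_left_mono) (auto simp: algebra_simps)
  finally show "\<bar>\<integral>y. f y \<partial>P t x\<bar> \<le> c * (1 + C) * (1 + V x)" by simp
qed

text \<open>For nonnegative functions this is Tonelli. Adding \<open>c * (1 + V)\<close> makes a
  tame function nonnegative, and the added part is subtracted again afterwards.\<close>

lemma integral_bind_tame:
  assumes m: "prob_space m" "sets m = sets borel" "(\<integral>\<^sup>+y. ennreal (V y) \<partial>m) < \<infinity>" and t: "0 \<le> t" and f: "tame c f"
  shows "(\<integral>y. f y \<partial>(m \<bind> P t)) = (\<integral>x. (\<integral>y. f y \<partial>P t x) \<partial>m)"
proof -
  have kt: "P t \<in> measurable m (subprob_algebra borel)"
    using kernel[OF t] m(2) by (simp cong: measurable_cong_sets)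
  have spm: "space m = UNIV" using sets_eq_imp_space_eq[OF m(2)] by simp
  have sb: "sets (m \<bind> P t) = sets borel" by (rule sets_bind) (use sets_P[OF t] spm in auto)
  have pos: "integrable (m \<bind> P t) g \<and> (\<integral>y. g y \<partial>(m \<bind> P t)) = (\<integral>x. (\<integral>y. g y \<partial>P t x) \<partial>m)"
    if g: "tame c g" "\<And>x. 0 \<le> g x" for c g
  proof -
    have gm: "g \<in> borel_measurable borel" using g by (simp add: tame_def)
    have "(\<integral>\<^sup>+y. ennreal (g y) \<partial>(m \<bind> P t)) = (\<integral>\<^sup>+x. (\<integral>\<^sup>+y. ennreal (g y) \<partial>P t x) \<partial>m)"
      by (rule nn_integral_bind[OF _ kt]) (use gm in measurable)
    also have "\<dots> = (\<integral>\<^sup>+x. ennreal (\<integral>y. g y \<partial>P t x) \<partial>m)"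
      by (intro nn_integral_cong nn_integral_eq_integral P_integrable[OF t g(1)]) (simp add: g(2))
    also have "\<dots> = ennreal (\<integral>x. (\<integral>y. g y \<partial>P t x) \<partial>m)"
      by (intro nn_integral_eq_integral tame_integrable(1)[OF tame_P[OF t g(1)] m])
        (auto intro!: Bochner_Integration.integral_nonneg g(2))
    finally have eq: "(\<integral>\<^sup>+y. ennreal (g y) \<partial>(m \<bind> P t)) = ennreal (\<integral>x. (\<integral>y. g y \<partial>P t x) \<partial>m)" .
    have i: "integrable (m \<bind> P t) g"
      by (rule integrableI_nonneg) (use gm sb g(2) eq in \<open>auto cong: measurable_cong_sets\<close>)
    moreover have "(\<integral>y. g y \<partial>(m \<bind> P t)) = (\<integral>x. (\<integral>y. g y \<partial>P t x) \<partial>m)"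
      using nn_integral_eq_integral[OF i] g(2) eq
      by (simp add: ennreal_inj[OF Bochner_Integration.integral_nonneg Bochner_Integration.integral_nonneg]
          Bochner_Integration.integral_nonneg)
    ultimately show ?thesis by blast
  qed
  let ?g = "\<lambda>x. f x + c * (1 + V x)" and ?h = "\<lambda>x. c * (1 + V x)"
  have c: "0 \<le> c" using f by (simp add: tame_def)
  have th: "tame c ?h" using c Vm V0 by (auto simp: tame_def abs_mult)
  have tg: "tame (2 * c) ?g"
    unfolding tame_def
  proof (intro conjI allI)
    have [measurable]: "f \<in> borel_measurable borel" "V \<in> borel_measurable borel"
      using f Vm by (simp_all add: tame_def)
    show "?g \<in> borel_measurable borel" by measurable
    fix x
    have "\<bar>f x\<bar> \<le> c * (1 + V x)" "0 \<le> c * (1 + V x)" using f c V0[of x] by (auto simp: tame_def)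
    then show "\<bar>?g x\<bar> \<le> 2 * c * (1 + V x)" by linarith
  qed (use c in simp)
  have g0: "0 \<le> ?g x" for x using f unfolding tame_def by (smt (verit))
  have h0: "0 \<le> ?h x" for x using c V0[of x] by simp
  have "(\<integral>y. f y \<partial>(m \<bind> P t)) = (\<integral>y. ?g y - ?h y \<partial>(m \<bind> P t))" by simp
  also have "\<dots> = (\<integral>y. ?g y \<partial>(m \<bind> P t)) - (\<integral>y. ?h y \<partial>(m \<bind> P t))"
    by (rule Bochner_Integration.integral_diff) (use pos[OF tg g0] pos[OF th h0] in blast)+
  also have "\<dots> = (\<integral>x. (\<integral>y. ?g y \<partial>P t x) \<partial>m) - (\<integral>x. (\<integral>y. ?h y \<partial>P t x) \<partial>m)"
    using pos[OF tg g0] pos[OF th h0] by simp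
  also have "\<dots> = (\<integral>x. (\<integral>y. ?g y \<partial>P t x) - (\<integral>y. ?h y \<partial>P t x) \<partial>m)"
    by (rule Bochner_Integration.integral_diff[symmetric])
      (rule tame_integrable(1)[OF tame_P[OF t tg] m] tame_integrable(1)[OF tame_P[OF t th] m])+
  also have "\<dots> = (\<integral>x. (\<integral>y. f y \<partial>P t x) \<partial>m)"
  proof (intro Bochner_Integration.integral_cong refl)
    fix x
    show "(\<integral>y. ?g y \<partial>P t x) - (\<integral>y. ?h y \<partial>P t x) = (\<integral>y. f y \<partial>P t x)"
      using Bochner_Integration.integral_diff[OF P_integrable[OF t tg] P_integrable[OF t th], of x]
      by (simp only: add_diff_cancel_right')
  qed
  finally show ?thesis .
qed

lemma P_plus:
  "0 \<le> s \<Longrightarrow> 0 \<le> t \<Longrightarrow> tame c f \<Longrightarrow> (\<integral>y. f y \<partial>P (s + t) x) = (\<integral>z. (\<integral>y. f y \<partial>P t z) \<partial>P s x)"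
  unfolding semigroup by (intro integral_bind_tame prob sets_P P_V_finite)

lemma tame_indicator: "E \<in> sets borel \<Longrightarrow> tame 1 (indicator E)"
  using V0 by (auto simp: tame_def split: split_indicator)

text \<open>The dual form: the kernel acts on functions, measured by their oscillation relative to
  the weight \<open>2 + \<beta> * (V x + V y)\<close>. Far out the drift shrinks the weight; for
  \<open>V x + V y <= R\<close> the common part \<open>\<nu>\<close> of both kernels cancels. A
  small \<open>\<beta>\<close> prevents the constant \<open>C\<close> from undoing the second
  gain.\<close>

lemma contraction:
  "\<exists>\<beta> \<alpha>. 0 < \<beta> \<and> 0 < \<alpha> \<and> \<alpha> < 1 \<and>
    (\<forall>f c A. tame c f \<longrightarrow> 0 \<le> A \<longrightarrow> (\<forall>x y. \<bar>f x - f y\<bar> \<le> A * (2 + \<beta> * (V x + V y))) \<longrightarrow>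
      (\<forall>x y. \<bar>(\<integral>z. f z \<partial>P 1 x) - (\<integral>z. f z \<partial>P 1 y)\<bar> \<le> \<alpha> * A * (2 + \<beta> * (V x + V y))))"
proof -
  define \<gamma> where "\<gamma> = exp (- k)"
  have \<gamma>: "0 < \<gamma>" "\<gamma> < 1" using k by (auto simp: \<gamma>_def)
  \<comment> \<open>Beyond this level the additive \<open>2 * C\<close> uses up at most half of the
    drift gain \<open>(1 - \<gamma>) * (V x + V y)\<close>; the summand 1 makes that sum at least 1
    there.\<close>
  define R where "R = 4 * C / (1 - \<gamma>) + 1"
  have "(1 - \<gamma>) * (4 * C / (1 - \<gamma>)) = 4 * C" using \<gamma> by simp
  then have R: "1 \<le> R" "2 * C \<le> (1 - \<gamma>) / 2 * R"
    using C \<gamma> unfolding R_def distrib_left by auto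
  obtain e \<nu> where e: "0 < e" and \<nu>: "prob_space \<nu>" "sets \<nu> = sets borel"
    and mn: "\<And>x E. V x \<le> R \<Longrightarrow> E \<in> sets borel \<Longrightarrow> ennreal e * emeasure \<nu> E \<le> emeasure (P 1 x) E"
    using minor[of R] by blast
  have mni: "ennreal e * (\<integral>\<^sup>+z. g z \<partial>\<nu>) \<le> (\<integral>\<^sup>+z. g z \<partial>P 1 x)" if x: "V x \<le> R" and g: "g \<in> borel_measurable borel" for x g
  proof -
    have "scale_measure (ennreal e) \<nu> \<le> P 1 x"
      by (rule le_measure[THEN iffD2]) (use mn[OF x] \<nu>(2) sets_P[of 1 x] in auto)
    then have "(\<integral>\<^sup>+z. g z \<partial>scale_measure (ennreal e) \<nu>) \<le> (\<integral>\<^sup>+z. g z \<partial>P 1 x)"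
      by (intro nn_integral_mono_measure) (use \<nu>(2) sets_P[of 1 x] in auto)
    then show ?thesis using g \<nu>(2) by (subst (asm) nn_integral_scale_measure) (auto cong: measurable_cong_sets)
  qed
  \<comment> \<open>\<open>2 * \<beta> * C <= e\<close> leaves half of the gain \<open>2 * e\<close>
    of the minorization, whence \<open>1 - e / 2\<close> in \<open>\<alpha>\<close>.\<close>
  define \<beta> where "\<beta> = e / (2 * C + 1)"
  have \<beta>: "0 < \<beta>" "2 * \<beta> * C \<le> e" using e C by (auto simp: \<beta>_def field_simps)
  \<comment> \<open>For \<open>U >= 1\<close> the weight \<open>2 + \<beta> * U\<close> is at most
    \<open>(2 + \<beta>) * U\<close>; \<open>q\<close> turns the drift gain
    \<open>\<beta> * (1 - \<gamma>) / 2 * U\<close> into a fraction of that weight.\<close>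
  define q where "q = \<beta> * (1 - \<gamma>) / (2 * (2 + \<beta>))"
  have q: "0 < q" "q * (2 + \<beta>) = \<beta> * (1 - \<gamma>) / 2" using \<beta> \<gamma> by (auto simp: q_def field_simps)
  define \<alpha> where "\<alpha> = max \<gamma> (max (1 - e / 2) (1 - q))"
  have \<alpha>: "0 < \<alpha>" "\<alpha> < 1" "\<gamma> \<le> \<alpha>" "1 - e / 2 \<le> \<alpha>" "1 - q \<le> \<alpha>" using \<gamma> e q by (auto simp: \<alpha>_def)
  have main: "\<bar>(\<integral>z. f z \<partial>P 1 x) - (\<integral>z. f z \<partial>P 1 y)\<bar> \<le> \<alpha> * A * (2 + \<beta> * (V x + V y))"
    if f: "tame c f" and A: "0 \<le> A" and lip: "\<And>x y. \<bar>f x - f y\<bar> \<le> A * (2 + \<beta> * (V x + V y))" for f c A x y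
  proof -
    define Wt where "Wt x = A * (1 + \<beta> * V x)" for x
    have Wt0: "0 \<le> Wt x" for x using A \<beta> V0[of x] by (simp add: Wt_def)
    have Wtm: "Wt \<in> borel_measurable borel" unfolding Wt_def using Vm by measurable
    have tW: "tame (A * (1 + \<beta>)) Wt"
      unfolding tame_def
    proof (intro conjI allI Wtm)
      fix x
      have "1 + \<beta> * V x \<le> (1 + \<beta>) * (1 + V x)" using \<beta> V0[of x] by (simp add: algebra_simps)
      then show "\<bar>Wt x\<bar> \<le> A * (1 + \<beta>) * (1 + V x)"
        using A Wt0[of x] by (simp add: Wt_def mult.assoc mult_left_mono)
    qed (use A \<beta> in simp)
    \<comment> \<open>recentring: \<open>\<bar>f - s\<bar> \<le> Wt\<close>\<close>
    define s where "s = (SUP x. f x - Wt x)"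
    \<comment> \<open>The oscillation bound says exactly that every \<open>f x - Wt x\<close> lies
      below every \<open>f y + Wt y\<close>, so the supremum \<open>s\<close> separates the two
      families.\<close>
    have le: "f x - Wt x \<le> f y + Wt y" for x y using lip[of x y] by (simp add: Wt_def algebra_simps abs_le_iff)
    have "bdd_above (range (\<lambda>x. f x - Wt x))" using le by (intro bdd_aboveI2) 
    then have s1: "f x - Wt x \<le> s" for x unfolding s_def by (intro cSUP_upper) auto
    have s2: "s \<le> f y + Wt y" for y unfolding s_def by (intro cSUP_least le) auto
    have fm: "f \<in> borel_measurable borel" using f by (simp add: tame_def)
    have p1: "(0::real) \<le> 1" by simp
    have iW: "integrable (P 1 x) Wt" and intf: "integrable (P 1 x) f" for x
      using P_integrable[OF p1 tW] P_integrable[OF p1 f] by auto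
    have PW: "(\<integral>z. Wt z \<partial>P 1 x) \<le> A * (1 + \<beta> * (\<gamma> * V x + C))" for x
    proof -
      interpret prob_space "P 1 x" by (rule prob) simp
      have "(\<integral>z. Wt z \<partial>P 1 x) = A * (1 + \<beta> * (\<integral>z. V z \<partial>P 1 x))"
        using P_integrable[OF p1 tame_V] prob_space by (simp add: Wt_def)
      also have "\<dots> \<le> A * (1 + \<beta> * (\<gamma> * V x + C))"
        using A \<beta> P_V_le[OF p1, of x] by (intro mult_left_mono add_left_mono) (auto simp: \<gamma>_def)
      finally show ?thesis .
    qed
    have one: "(\<integral>z. f z - s \<partial>P 1 x) = (\<integral>z. f z \<partial>P 1 x) - s" for x
    proof -
      interpret prob_space "P 1 x" by (rule prob) simp
      show ?thesis using intf prob_space by simp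
    qed
    define S where "S x y = A * (2 + \<beta> * \<gamma> * (V x + V y) + 2 * \<beta> * C)" for x y
    have PWS: "(\<integral>z. Wt z \<partial>P 1 x) + (\<integral>z. Wt z \<partial>P 1 y) \<le> S x y" for x y
      using add_mono[OF PW[of x] PW[of y]] by (simp add: S_def algebra_simps)
    have ub: "(\<integral>z. f z \<partial>P 1 x) - (\<integral>z. f z \<partial>P 1 y) \<le> \<alpha> * A * (2 + \<beta> * (V x + V y))" for x y
    proof (cases "V x + V y \<le> R")
      case False
      have "(\<integral>z. f z - s \<partial>P 1 x) \<le> (\<integral>z. Wt z \<partial>P 1 x)"
        using s2 s1 by (intro integral_mono) (auto intro!: iW intf finite_measure.integrable_const[OF prob_space.finite_measure[OF prob]] simp: algebra_simps)
      moreover have "(\<integral>z. - Wt z \<partial>P 1 y) \<le> (\<integral>z. f z - s \<partial>P 1 y)"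
        using s2 s1 by (intro integral_mono) (auto intro!: iW intf finite_measure.integrable_const[OF prob_space.finite_measure[OF prob]] simp: algebra_simps)
      ultimately have "(\<integral>z. f z \<partial>P 1 x) - (\<integral>z. f z \<partial>P 1 y) \<le> S x y"
        using PWS[of x y] by (simp add: one)
      also have "S x y \<le> A * (\<alpha> * (2 + \<beta> * (V x + V y)))"
        unfolding S_def
      proof (rule mult_left_mono[OF _ A])
        define U where "U = V x + V y"
        have U: "R \<le> U" "1 \<le> U" using False R(1) by (auto simp: U_def)
        have "(1 - \<gamma>) / 2 * R \<le> (1 - \<gamma>) / 2 * U" using \<gamma> U by (intro mult_left_mono) auto
        then have "2 * C \<le> (1 - \<gamma>) / 2 * U" using R(2) by linarith
        then have "\<beta> * (2 * C) \<le> \<beta> * ((1 - \<gamma>) / 2 * U)" using \<beta> by (intro mult_left_mono) auto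
        then have 1: "2 + \<beta> * \<gamma> * U + 2 * \<beta> * C \<le> 2 + \<beta> * U - \<beta> * (1 - \<gamma>) / 2 * U"
          by (simp add: field_simps)
        have "q * (2 + \<beta> * U) \<le> q * ((2 + \<beta>) * U)" using q U by (intro mult_left_mono) (auto simp: algebra_simps)
        also have "\<dots> = \<beta> * (1 - \<gamma>) / 2 * U" by (simp only: mult.assoc[symmetric] q(2))
        finally have qU: "q * (2 + \<beta> * U) \<le> \<beta> * (1 - \<gamma>) / 2 * U" .
        have "(1 - q) * (2 + \<beta> * U) = 2 + \<beta> * U - q * (2 + \<beta> * U)" by (simp only: left_diff_distrib mult_1_left)
        then have 2: "2 + \<beta> * \<gamma> * U + 2 * \<beta> * C \<le> (1 - q) * (2 + \<beta> * U)" using 1 qU by linarith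
        have "(1 - q) * (2 + \<beta> * U) \<le> \<alpha> * (2 + \<beta> * U)" using \<alpha> \<beta> U by (intro mult_right_mono) auto
        then show "2 + \<beta> * \<gamma> * (V x + V y) + 2 * \<beta> * C \<le> \<alpha> * (2 + \<beta> * (V x + V y))"
          using 2 unfolding U_def by linarith
      qed
      finally show ?thesis by (simp add: mult_ac)
    next
      case True
      then have VR: "V x \<le> R" "V y \<le> R" using V0[of x] V0[of y] by auto
      \<comment> \<open>The gaps between \<open>f - s\<close> and its bounds from above and below.
        They are nonnegative and sum to at least \<open>2 * A\<close>, so integrating them against
        the common part \<open>\<nu>\<close> at \<open>x\<close> and \<open>y\<close> saves
        \<open>2 * e * A\<close>.\<close>
      let ?u = "\<lambda>z. Wt z - (f z - s)" and ?v = "\<lambda>z. Wt z + (f z - s)"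
      have uv0: "0 \<le> ?u z" "0 \<le> ?v z" for z using s1[of z] s2[of z] by auto
      have um: "?u \<in> borel_measurable borel" "?v \<in> borel_measurable borel" using Wtm fm by measurable
      have iu: "integrable (P 1 x) ?u" "integrable (P 1 y) ?v"
        by (auto intro!: Bochner_Integration.integrable_diff Bochner_Integration.integrable_add iW intf finite_measure.integrable_const[OF prob_space.finite_measure[OF prob]])
      have "ennreal (e * (2 * A)) = ennreal e * (\<integral>\<^sup>+z. ennreal (2 * A) \<partial>\<nu>)"
        using e A prob_space.emeasure_space_1[OF \<nu>(1)] by (simp add: ennreal_mult)
      also have "\<dots> \<le> ennreal e * (\<integral>\<^sup>+z. ennreal (?u z) + ennreal (?v z) \<partial>\<nu>)"
      proof (intro mult_left_mono nn_integral_mono)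
        fix z
        have "2 * A \<le> ?u z + ?v z" using A \<beta> V0[of z] by (simp add: Wt_def algebra_simps)
        then show "ennreal (2 * A) \<le> ennreal (?u z) + ennreal (?v z)"
          using uv0[of z] by (simp add: ennreal_plus[symmetric] ennreal_leI del: ennreal_plus)
      qed simp
      also have "\<dots> = ennreal e * (\<integral>\<^sup>+z. ennreal (?u z) \<partial>\<nu>) + ennreal e * (\<integral>\<^sup>+z. ennreal (?v z) \<partial>\<nu>)"
        using um \<nu>(2) by (subst nn_integral_add) (auto simp: distrib_left cong: measurable_cong_sets)
      also have "\<dots> \<le> (\<integral>\<^sup>+z. ennreal (?u z) \<partial>P 1 x) + (\<integral>\<^sup>+z. ennreal (?v z) \<partial>P 1 y)"
        by (intro add_mono mni VR measurable_compose[OF um(1) measurable_ennreal]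
            measurable_compose[OF um(2) measurable_ennreal])
      also have "\<dots> = ennreal (\<integral>z. ?u z \<partial>P 1 x) + ennreal (\<integral>z. ?v z \<partial>P 1 y)"
        using uv0 iu by (simp add: nn_integral_eq_integral)
      also have "\<dots> = ennreal ((\<integral>z. ?u z \<partial>P 1 x) + (\<integral>z. ?v z \<partial>P 1 y))"
        using uv0 by (intro ennreal_plus[symmetric] Bochner_Integration.integral_nonneg) auto
      finally have "e * (2 * A) \<le> (\<integral>z. ?u z \<partial>P 1 x) + (\<integral>z. ?v z \<partial>P 1 y)"
        using uv0 by (subst (asm) ennreal_le_iff) (auto intro!: add_nonneg_nonneg Bochner_Integration.integral_nonneg)
      also have "(\<integral>z. ?u z \<partial>P 1 x) = (\<integral>z. Wt z \<partial>P 1 x) - ((\<integral>z. f z \<partial>P 1 x) - s)"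
        unfolding one[symmetric] by (intro Bochner_Integration.integral_diff iW)
          (auto intro!: intf finite_measure.integrable_const[OF prob_space.finite_measure[OF prob]])
      also have "(\<integral>z. ?v z \<partial>P 1 y) = (\<integral>z. Wt z \<partial>P 1 y) + ((\<integral>z. f z \<partial>P 1 y) - s)"
        unfolding one[symmetric] by (intro Bochner_Integration.integral_add iW)
          (auto intro!: intf finite_measure.integrable_const[OF prob_space.finite_measure[OF prob]])
      finally have "(\<integral>z. f z \<partial>P 1 x) - (\<integral>z. f z \<partial>P 1 y) \<le> S x y - A * (2 * e)"
        using PWS[of x y] by (simp add: mult_ac)
      also have "\<dots> = A * (2 - 2 * e + 2 * \<beta> * C + \<beta> * \<gamma> * (V x + V y))" by (simp add: S_def algebra_simps)
      also have "\<dots> \<le> A * (\<alpha> * (2 + \<beta> * (V x + V y)))"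
      proof (rule mult_left_mono[OF _ A])
        have "\<gamma> * (\<beta> * (V x + V y)) \<le> \<alpha> * (\<beta> * (V x + V y))"
          using \<alpha> \<beta> V0[of x] V0[of y] by (intro mult_right_mono) auto
        moreover have "2 - 2 * e + 2 * \<beta> * C \<le> \<alpha> * 2" using \<beta>(2) \<alpha>(4) by linarith
        ultimately show "2 - 2 * e + 2 * \<beta> * C + \<beta> * \<gamma> * (V x + V y) \<le> \<alpha> * (2 + \<beta> * (V x + V y))"
          by (simp add: algebra_simps)
      qed
      finally show ?thesis by (simp add: mult_ac)
    qed
    show ?thesis using ub[of x y] ub[of y x] by (simp add: abs_le_iff add.commute)
  qed
  show ?thesis using \<beta>(1) \<alpha>(1,2) main by (intro exI[of _ \<beta>] exI[of _ \<alpha>]) simp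
qed

lemma exponential_contraction:
  obtains \<alpha> D where "0 < \<alpha>" "\<alpha> < 1" "0 < D"
    "\<And>c f n x y. tame c f \<Longrightarrow> \<bar>(\<integral>z. f z \<partial>P (real n) x) - (\<integral>z. f z \<partial>P (real n) y)\<bar> \<le> D * c * \<alpha> ^ n * (2 + V x + V y)"
proof -
  from contraction obtain \<beta> \<alpha> where *: "0 < \<beta>" "0 < \<alpha>" "\<alpha> < 1"
    "\<forall>f c A. tame c f \<longrightarrow> 0 \<le> A \<longrightarrow> (\<forall>x y. \<bar>f x - f y\<bar> \<le> A * (2 + \<beta> * (V x + V y))) \<longrightarrow>
      (\<forall>x y. \<bar>(\<integral>z. f z \<partial>P 1 x) - (\<integral>z. f z \<partial>P 1 y)\<bar> \<le> \<alpha> * A * (2 + \<beta> * (V x + V y)))"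
    by (elim exE conjE) (rule that)
  note \<beta> = *(1) and \<alpha> = *(2,3) and con = *(4)[rule_format]
  \<comment> \<open>Converts weights: \<open>b * (2 + \<beta> * U)\<close> dominates
    \<open>2 + U\<close>. The opposite comparison costs the factor \<open>1 + \<beta>\<close> in
    \<open>D\<close>.\<close>
  define b where "b = 1 + 1 / \<beta>"
  have b: "0 < b" using \<beta> by (simp add: b_def add_pos_pos)
  define D where "D = b * (1 + \<beta>)"
  have "\<bar>(\<integral>z. f z \<partial>P (real n) x) - (\<integral>z. f z \<partial>P (real n) y)\<bar> \<le> D * c * \<alpha> ^ n * (2 + V x + V y)" if f: "tame c f" for c f n x y
  proof -
    have c: "0 \<le> c" using f by (simp add: tame_def)
    have it: "\<bar>(\<integral>z. f z \<partial>P (real n) x) - (\<integral>z. f z \<partial>P (real n) y)\<bar> \<le> \<alpha> ^ n * (b * c) * (2 + \<beta> * (V x + V y))" for x y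
    proof (induction n arbitrary: x y)
      case 0
      have fm: "f \<in> borel_measurable borel" using f by (simp add: tame_def)
      have "\<bar>f x - f y\<bar> \<le> c * (1 + V x) + c * (1 + V y)"
        using f abs_triangle_ineq4[of "f x" "f y"] unfolding tame_def by (smt (verit))
      also have "\<dots> = c * (2 + (V x + V y))" by (simp add: algebra_simps)
      also have "\<dots> \<le> c * (b * (2 + \<beta> * (V x + V y)))"
      proof (rule mult_left_mono[OF _ c])
        have "b * (2 + \<beta> * (V x + V y)) = 2 + 2 / \<beta> + (V x + V y) + \<beta> * (V x + V y)"
          using \<beta> by (simp add: b_def field_simps)
        then show "2 + (V x + V y) \<le> b * (2 + \<beta> * (V x + V y))" using \<beta> V0[of x] V0[of y] by simp
      qed
      finally show ?case using fm by (simp add: start integral_return mult_ac)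
    next
      case (Suc n)
      have eq: "(\<integral>z. f z \<partial>P (real (Suc n)) x) = (\<integral>w. (\<integral>z. f z \<partial>P (real n) w) \<partial>P 1 x)" for x
        using P_plus[of 1 "real n" c f x] f by simp
      show ?case unfolding eq
        using con[OF tame_P[OF _ f, of "real n"], of "\<alpha> ^ n * (b * c)"] Suc.IH \<alpha> b c by (simp add: mult.assoc)
    qed
    also have "\<alpha> ^ n * (b * c) * (2 + \<beta> * (V x + V y)) \<le> \<alpha> ^ n * (b * c) * ((1 + \<beta>) * (2 + (V x + V y)))"
      using \<alpha> b c \<beta> V0[of x] V0[of y] by (intro mult_left_mono) (auto simp: algebra_simps)
    finally show ?thesis by (simp add: D_def mult_ac add.assoc)
  qed
  moreover have "0 < D" using b \<beta> by (simp add: D_def)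
  ultimately show ?thesis using \<alpha> that by blast
qed

text \<open>The laws \<open>P n x0\<close> form a Cauchy sequence on every Borel set, at a geometric
  rate uniform over the sets. This uniformity makes the setwise limit countably additive and lets
  integrals of functions with values in [0, 1] converge as well.\<close>

lemma invariant_measure_exists:
  obtains \<mu> \<alpha> D where "prob_space \<mu>" "sets \<mu> = sets borel" "(\<integral>\<^sup>+y. ennreal (V y) \<partial>\<mu>) < \<infinity>"
    "\<And>t. 0 \<le> t \<Longrightarrow> \<mu> \<bind> P t = \<mu>" "0 < \<alpha>" "\<alpha> < 1" "0 < D"
    "\<And>c f n x. tame c f \<Longrightarrow> \<bar>(\<integral>z. f z \<partial>P (real n) x) - (\<integral>z. f z \<partial>\<mu>)\<bar> \<le> D * c * \<alpha> ^ n * (1 + V x)"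
proof -
  obtain \<alpha> D where \<alpha>: "0 < \<alpha>" "\<alpha> < 1" and D: "0 < D"
    and con: "\<And>c f n x y. tame c f \<Longrightarrow> \<bar>(\<integral>z. f z \<partial>P (real n) x) - (\<integral>z. f z \<partial>P (real n) y)\<bar> \<le> D * c * \<alpha> ^ n * (2 + V x + V y)"
    by (rule exponential_contraction) (rule that)
  \<comment> \<open>A point start is compared with an initial law \<open>m\<close>: the law
    \<open>P m x0\<close> for the Cauchy property, the measure \<open>\<mu>\<close> itself for the
    final rate.\<close>
  have avg: "\<bar>(\<integral>z. f z \<partial>P (real n) x) - (\<integral>y. (\<integral>z. f z \<partial>P (real n) y) \<partial>m)\<bar> \<le> D * c * \<alpha> ^ n * (2 + V x + (\<integral>y. V y \<partial>m))"
    if f: "tame c f" and m: "prob_space m" "sets m = sets borel" "(\<integral>\<^sup>+y. ennreal (V y) \<partial>m) < \<infinity>" for c f n x m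
  proof -
    interpret m: prob_space m by (rule m)
    have iV: "integrable m V" by (rule tame_integrable(2)[OF tame_V m])
    have ig: "integrable m (\<lambda>y. \<integral>z. f z \<partial>P (real n) y)"
      by (rule tame_integrable(1)[OF tame_P[OF _ f] m]) simp
    have "(\<integral>z. f z \<partial>P (real n) x) - (\<integral>y. (\<integral>z. f z \<partial>P (real n) y) \<partial>m)
      = (\<integral>y. (\<integral>z. f z \<partial>P (real n) x) - (\<integral>z. f z \<partial>P (real n) y) \<partial>m)"
      using ig m.prob_space by simp
    also have "\<bar>\<dots>\<bar> \<le> (\<integral>y. \<bar>(\<integral>z. f z \<partial>P (real n) x) - (\<integral>z. f z \<partial>P (real n) y)\<bar> \<partial>m)"
      by (rule integral_abs_bound)
    also have "\<dots> \<le> (\<integral>y. D * c * \<alpha> ^ n * (2 + V x + V y) \<partial>m)"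
      using ig iV by (intro integral_mono con[OF f]) auto
    also have "\<dots> = D * c * \<alpha> ^ n * (2 + V x + (\<integral>y. V y \<partial>m))"
      using iV m.prob_space by simp
    finally show ?thesis .
  qed
  \<comment> \<open>Any fixed starting point serves; by \<open>setlim\<close> the limit does not
    depend on it.\<close>
  define x0 :: 'a where "x0 = undefined"
  define q where "q n E = measure (P (real n) x0) E" for n E
  define D' where "D' = D * (2 + 2 * V x0 + C)"
  have D': "0 \<le> D'" using D V0[of x0] C by (simp add: D'_def)
  have qI: "q n E = (\<integral>z. indicator E z \<partial>P (real n) x0)" for n E
    by (simp add: q_def space_P)
  \<comment> \<open>\<open>P (m + n) x0\<close> is \<open>P n\<close> started from the law
    \<open>P m x0\<close>, whose mean of \<open>V\<close> is at most \<open>V x0 + C\<close> for all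
    \<open>m\<close>.\<close>
  have cau: "\<bar>q (m + n) E - q n E\<bar> \<le> D' * \<alpha> ^ n" if E: "E \<in> sets borel" for m n E
  proof -
    have "\<bar>q n E - q (m + n) E\<bar> \<le> D * 1 * \<alpha> ^ n * (2 + V x0 + (\<integral>y. V y \<partial>P (real m) x0))"
      unfolding qI using P_plus[of "real m" "real n" 1 "indicator E" x0] tame_indicator[OF E]
        avg[OF tame_indicator[OF E] prob sets_P P_V_finite, of "real m" n x0 x0] by simp
    also have "\<dots> \<le> D * 1 * \<alpha> ^ n * (2 + V x0 + (V x0 + C))"
      using D \<alpha> by (intro mult_left_mono add_left_mono P_V_le') auto
    finally show ?thesis by (simp add: D'_def abs_minus_commute algebra_simps)
  qed
  have a0: "(\<lambda>n. D' * \<alpha> ^ n) \<longlonglongrightarrow> 0"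
    using tendsto_mult_right_zero[OF LIMSEQ_realpow_zero[of \<alpha>], of D'] \<alpha> by simp
  define l where "l E = lim (\<lambda>n. q n E)" for E
  have ql: "(\<lambda>n. q n E) \<longlonglongrightarrow> l E" if E: "E \<in> sets borel" for E
  proof -
    have "Cauchy (\<lambda>n. q n E)"
    proof (rule metric_CauchyI)
      fix e :: real assume "0 < e"
      then obtain n0 where n0: "\<And>n. n0 \<le> n \<Longrightarrow> \<bar>D' * \<alpha> ^ n\<bar> < e / 2"
        using LIMSEQ_D[OF a0, of "e / 2"] by auto
      have "dist (q m E) (q n E) < e" if "n0 \<le> m" "n0 \<le> n" for m n
      proof -
        have "\<bar>q m E - q n0 E\<bar> < e / 2" "\<bar>q n E - q n0 E\<bar> < e / 2"
          using cau[OF E, of "m - n0" n0] cau[OF E, of "n - n0" n0] n0[of n0] that by auto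
        then show ?thesis unfolding dist_real_def by linarith
      qed
      then show "\<exists>M. \<forall>m\<ge>M. \<forall>n\<ge>M. dist (q m E) (q n E) < e" by blast
    qed
    then show ?thesis unfolding l_def by (simp add: Cauchy_convergent_iff convergent_LIMSEQ_iff)
  qed
  have near: "\<bar>l E - q n E\<bar> \<le> D' * \<alpha> ^ n" if E: "E \<in> sets borel" for E n
  proof (rule LIMSEQ_le_const2)
    show "(\<lambda>m. \<bar>q (m + n) E - q n E\<bar>) \<longlonglongrightarrow> \<bar>l E - q n E\<bar>"
      by (intro tendsto_intros LIMSEQ_ignore_initial_segment ql E)
  qed (use cau[OF E] in blast)
  have l0: "0 \<le> l E" if "E \<in> sets borel" for E
    by (rule LIMSEQ_le_const[OF ql[OF that]]) (auto simp: q_def)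
  have P1: "prob_space (P (real n) x0)" for n by (rule prob) simp
  have fsum: "l (\<Union>i<m. A i) = (\<Sum>i<m. l (A i))" if A: "range A \<subseteq> sets borel" "disjoint_family A" for A :: "nat \<Rightarrow> 'a set" and m
  proof (rule LIMSEQ_unique[OF ql])
    have "q n (\<Union>i<m. A i) = (\<Sum>i<m. q n (A i))" for n
      unfolding q_def using A
      by (intro finite_measure.finite_measure_finite_Union[OF prob_space.finite_measure[OF P1]])
        (auto simp: sets_P disjoint_family_on_def)
    moreover have "(\<lambda>n. \<Sum>i<m. q n (A i)) \<longlonglongrightarrow> (\<Sum>i<m. l (A i))"
      using A by (intro tendsto_sum ql) auto
    ultimately show "(\<lambda>n. q n (\<Union>i<m. A i)) \<longlonglongrightarrow> (\<Sum>i<m. l (A i))" by simp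
  qed (use A in auto)
  \<comment> \<open>Three-epsilon argument: fix \<open>n\<close> with error below
    \<open>e / 3\<close> on all sets at once and use continuity of the genuine measure
    \<open>P n x0\<close> along the increasing unions.\<close>
  have sig: "(\<lambda>i. l (A i)) sums l (\<Union>i. A i)" if A: "range A \<subseteq> sets borel" "disjoint_family A" for A :: "nat \<Rightarrow> 'a set"
    unfolding sums_def
  proof (rule LIMSEQ_I)
    fix e :: real assume e: "0 < e"
    then obtain n where n: "\<bar>D' * \<alpha> ^ n\<bar> < e / 3"
      using LIMSEQ_D[OF a0, of "e / 3"] by auto
    have Um: "(\<Union>i<m. A i) \<in> sets borel" "(\<Union>i. A i) \<in> sets borel" for m using A by auto
    have "(\<lambda>m. q n (\<Union>i<m. A i)) \<longlonglongrightarrow> q n (\<Union>m. (\<Union>i<m. A i))"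
      unfolding q_def
      by (rule finite_measure.finite_Lim_measure_incseq[OF prob_space.finite_measure[OF P1]])
        (use Um in \<open>auto simp: sets_P incseq_def intro: less_le_trans\<close>)
    moreover have "(\<Union>m. (\<Union>i<m. A i)) = (\<Union>i. A i)" by auto
    ultimately obtain m0 where m0: "\<And>m. m0 \<le> m \<Longrightarrow> \<bar>q n (\<Union>i<m. A i) - q n (\<Union>i. A i)\<bar> < e / 3"
      using LIMSEQ_D[of "\<lambda>m. q n (\<Union>i<m. A i)" "q n (\<Union>i. A i)" "e / 3"] e by auto
    have "norm ((\<Sum>i<m. l (A i)) - l (\<Union>i. A i)) < e" if "m0 \<le> m" for m
      using near[OF Um(1), of m n] near[OF Um(2), of n] n m0[OF that] unfolding fsum[OF A, symmetric] real_norm_def by linarith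
    then show "\<exists>no. \<forall>m\<ge>no. norm ((\<Sum>i<m. l (A i)) - l (\<Union>i. A i)) < e" by blast
  qed
  define \<mu> where "\<mu> = measure_of UNIV (sets borel) (\<lambda>E. ennreal (l E))"
  have s\<mu>: "sets \<mu> = sets borel" unfolding \<mu>_def by (metis sets.sets_measure_of_eq space_borel)
  have em\<mu>: "emeasure \<mu> E = ennreal (l E)" if E: "E \<in> sets borel" for E
  proof (rule emeasure_measure_of[OF \<mu>_def])
    have "l {} = 0" by (rule LIMSEQ_unique[OF ql]) (auto simp: q_def)
    then show "positive (sets \<mu>) (\<lambda>E. ennreal (l E))" by (simp add: positive_def)
    show "countably_additive (sets \<mu>) (\<lambda>E. ennreal (l E))"
      unfolding countably_additive_def s\<mu>
    proof (intro allI impI)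
      fix A :: "nat \<Rightarrow> 'a set" assume A: "range A \<subseteq> sets borel" "disjoint_family A" "\<Union> (range A) \<in> sets borel"
      then show "(\<Sum>i. ennreal (l (A i))) = ennreal (l (\<Union> (range A)))"
        using sig[OF A(1,2)] l0 by (intro sums_unique[symmetric] sums_ennreal[THEN iffD2]) auto
    qed
  qed (use E s\<mu> in auto)
  have sp\<mu>: "space \<mu> = UNIV" using sets_eq_imp_space_eq[OF s\<mu>] by simp
  have "l UNIV = 1"
    by (rule LIMSEQ_unique[OF ql]) (use prob_space.prob_space[OF P1] in \<open>auto simp: q_def space_P\<close>)
  then have p\<mu>: "prob_space \<mu>" by (intro prob_spaceI) (simp add: sp\<mu> em\<mu>)
  interpret \<mu>: prob_space \<mu> by (rule p\<mu>)
  have m\<mu>: "measure \<mu> E = l E" if "E \<in> sets borel" for E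
    using em\<mu>[OF that] l0[OF that] by (simp add: measure_def)
  have close: "emeasure \<mu> E \<le> emeasure (P (real n) x0) E + ennreal (D' * \<alpha> ^ n)"
    "emeasure (P (real n) x0) E \<le> emeasure \<mu> E + ennreal (D' * \<alpha> ^ n)" if E: "E \<in> sets borel" for E n
  proof -
    interpret Pn: prob_space "P (real n) x0" by (rule P1)
    have "0 \<le> D' * \<alpha> ^ n" using D' \<alpha> by simp
    then show "emeasure \<mu> E \<le> emeasure (P (real n) x0) E + ennreal (D' * \<alpha> ^ n)"
      "emeasure (P (real n) x0) E \<le> emeasure \<mu> E + ennreal (D' * \<alpha> ^ n)"
      using near[OF E, of n] l0[OF E] unfolding em\<mu>[OF E] Pn.emeasure_eq_measure q_def[symmetric]
      by (auto simp: ennreal_plus[symmetric] q_def simp del: ennreal_plus intro!: ennreal_leI)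
  qed
  have c1: "(\<integral>\<^sup>+x. ennreal (g x) \<partial>\<mu>) \<le> (\<integral>\<^sup>+x. ennreal (g x) \<partial>P (real n) x0) + ennreal (D' * \<alpha> ^ n)"
    "(\<integral>\<^sup>+x. ennreal (g x) \<partial>P (real n) x0) \<le> (\<integral>\<^sup>+x. ennreal (g x) \<partial>\<mu>) + ennreal (D' * \<alpha> ^ n)"
    if "g \<in> borel_measurable borel" "\<And>x. 0 \<le> g x" "\<And>x. g x \<le> 1" for g n
    by (rule nn_integral_le_of_measure_le[OF p\<mu> s\<mu> P1 sets_P close(1) that], simp_all)
      (rule nn_integral_le_of_measure_le[OF P1 sets_P p\<mu> s\<mu> close(2) that], simp_all)
  have V\<mu>: "(\<integral>\<^sup>+y. ennreal (V y) \<partial>\<mu>) \<le> ennreal (V x0 + C)"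
  proof -
    \<comment> \<open>The comparison \<open>c1\<close> is for values in [0, 1], hence the scaling by
      \<open>j\<close>. For fixed \<open>j\<close> the error \<open>j * D' * \<alpha>^n\<close>
      vanishes as \<open>n\<close> grows; monotone convergence afterwards removes the
      truncation.\<close>
    have trunc: "(\<integral>\<^sup>+y. ennreal (min (V y) (real j)) \<partial>\<mu>) \<le> ennreal (V x0 + C)" for j :: nat
    proof (cases "j = 0")
      case True
      have "min (V y) 0 = 0" for y using V0[of y] by simp
      then show ?thesis using True by simp
    next
      case False
      then have j: "0 < real j" by simp
      define g where "g y = min (V y) (real j) / real j" for y
      have g: "g \<in> borel_measurable borel" "0 \<le> g y" "g y \<le> 1" for y
        using Vm V0[of y] j unfolding g_def by (measurable, auto simp: field_simps)
      have "(\<integral>\<^sup>+y. ennreal (min (V y) (real j)) \<partial>\<mu>) = ennreal j * (\<integral>\<^sup>+y. ennreal (g y) \<partial>\<mu>)"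
      proof -
        have "ennreal (min (V y) (real j)) = ennreal j * ennreal (g y)" for y
          using j g(2)[of y] by (simp add: ennreal_mult[symmetric] g_def)
        then show ?thesis using g(1) s\<mu> by (simp add: nn_integral_cmult cong: measurable_cong_sets)
      qed
      also have "\<dots> \<le> ennreal (V x0 + C)"
      proof (rule LIMSEQ_le_const)
        show "(\<lambda>n. ennreal (V x0 + C + real j * (D' * \<alpha> ^ n))) \<longlonglongrightarrow> ennreal (V x0 + C)"
          using tendsto_add[OF tendsto_const tendsto_mult_right_zero[OF a0, of "real j"], of "V x0 + C"]
          by (intro tendsto_ennrealI) simp
        have "ennreal j * (\<integral>\<^sup>+y. ennreal (g y) \<partial>\<mu>) \<le> ennreal (V x0 + C + real j * (D' * \<alpha> ^ n))" for n
        proof -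
          have "ennreal j * (\<integral>\<^sup>+y. ennreal (g y) \<partial>\<mu>) \<le> ennreal j * ((\<integral>\<^sup>+x. ennreal (g x) \<partial>P (real n) x0) + ennreal (D' * \<alpha> ^ n))"
            by (intro mult_left_mono c1(1) g) simp
          also have "\<dots> = (\<integral>\<^sup>+x. ennreal j * ennreal (g x) \<partial>P (real n) x0) + ennreal (j * (D' * \<alpha> ^ n))"
            using g(1) D' \<alpha> sets_P[of "real n" x0]
            by (simp add: distrib_left nn_integral_cmult ennreal_mult cong: measurable_cong_sets)
          also have "(\<integral>\<^sup>+x. ennreal j * ennreal (g x) \<partial>P (real n) x0) \<le> (\<integral>\<^sup>+x. ennreal (V x) \<partial>P (real n) x0)"
            using j g(2) by (intro nn_integral_mono) (auto simp: ennreal_mult[symmetric] g_def intro!: ennreal_leI)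
          also have "(\<integral>\<^sup>+x. ennreal (V x) \<partial>P (real n) x0) \<le> ennreal (V x0 + C)"
            using k V0[of x0] by (intro order_trans[OF drift] ennreal_leI) (auto simp: mult_left_le_one_le)
          finally show ?thesis
            using V0[of x0] C D' \<alpha> by (simp add: ennreal_plus[symmetric] add_right_mono del: ennreal_plus)
        qed
        then show "\<exists>N. \<forall>n\<ge>N. ennreal j * (\<integral>\<^sup>+y. ennreal (g y) \<partial>\<mu>) \<le> ennreal (V x0 + C + real j * (D' * \<alpha> ^ n))" by blast
      qed
      finally show ?thesis .
    qed
    have sup: "(SUP j. ennreal (min (V y) (real j))) = ennreal (V y)" for y
    proof (rule antisym)
      obtain j :: nat where "V y \<le> j" using real_arch_simple by blast
      then have "ennreal (V y) = ennreal (min (V y) (real j))" by simp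
      then show "ennreal (V y) \<le> (SUP j. ennreal (min (V y) (real j)))" by (metis SUP_upper UNIV_I)
    qed (auto intro!: SUP_least ennreal_leI)
    have "(\<integral>\<^sup>+y. ennreal (V y) \<partial>\<mu>) = (SUP j. \<integral>\<^sup>+y. ennreal (min (V y) (real j)) \<partial>\<mu>)"
      unfolding sup[symmetric]
    proof (rule nn_integral_monotone_convergence_SUP)
      show "incseq (\<lambda>j y. ennreal (min (V y) (real j)))"
        by (auto simp: incseq_def le_fun_def intro!: ennreal_leI)
      show "(\<lambda>y. ennreal (min (V y) (real j))) \<in> borel_measurable \<mu>" for j
        using Vm s\<mu> by (simp cong: measurable_cong_sets)
    qed
    also have "\<dots> \<le> ennreal (V x0 + C)" by (intro SUP_least trunc)
    finally show ?thesis .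
  qed
  then have Vf: "(\<integral>\<^sup>+y. ennreal (V y) \<partial>\<mu>) < \<infinity>" by (auto intro: le_less_trans)
  have setlim: "(\<lambda>n. measure (P (real n) x) E) \<longlonglongrightarrow> measure \<mu> E" if E: "E \<in> sets borel" for x E
  proof -
    have "(\<lambda>n. measure (P (real n) x) E - q n E) \<longlonglongrightarrow> 0"
    proof (rule Lim_null_comparison)
      show "\<forall>\<^sub>F n in sequentially. norm (measure (P (real n) x) E - q n E) \<le> D * 1 * (2 + V x + V x0) * \<alpha> ^ n"
        using con[OF tame_indicator[OF E], of _ x x0] by (auto simp: q_def space_P mult_ac intro!: always_eventually)
      show "(\<lambda>n. D * 1 * (2 + V x + V x0) * \<alpha> ^ n) \<longlonglongrightarrow> 0"
        using tendsto_mult_right_zero[OF LIMSEQ_realpow_zero[of \<alpha>], of "D * 1 * (2 + V x + V x0)"] \<alpha> by simp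
    qed
    from tendsto_add[OF this ql[OF E]] show ?thesis by (simp add: m\<mu>[OF E])
  qed
  have inv: "\<mu> \<bind> P t = \<mu>" if t: "0 \<le> t" for t
  proof (rule measure_eqI)
    have kt: "P t \<in> measurable \<mu> (subprob_algebra borel)"
      using kernel[OF t] s\<mu> by (simp cong: measurable_cong_sets)
    show sb: "sets (\<mu> \<bind> P t) = sets \<mu>" unfolding s\<mu> by (rule sets_bind) (use sets_P[OF t] sp\<mu> in auto)
    fix E assume "E \<in> sets (\<mu> \<bind> P t)"
    then have E: "E \<in> sets borel" using sb s\<mu> by simp
    define g where "g y = measure (P t y) E" for y
    have gm: "g \<in> borel_measurable borel"
      unfolding g_def by (rule measurable_compose[OF kernel[OF t] measurable_measure_subprob_algebra[OF E]])
    have g01: "0 \<le> g y" "g y \<le> 1" for y using prob_space.prob_le_1[OF prob[OF t]] by (auto simp: g_def)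
    have ge: "ennreal (g y) = emeasure (P t y) E" for y
      unfolding g_def by (rule finite_measure.emeasure_eq_measure[symmetric, OF prob_space.finite_measure[OF prob[OF t]]])
    \<comment> \<open>The limit of these integrals is computed in two ways; here directly from the
      closeness of \<open>P n x0\<close> to \<open>\<mu>\<close>.\<close>
    have "(\<lambda>n. \<integral>y. g y \<partial>P (real n) x0) \<longlonglongrightarrow> (\<integral>y. g y \<partial>\<mu>)"
    proof -
      have ig: "integrable m g" if "prob_space m" "sets m = sets borel" for m
        using gm g01 that by (intro finite_measure.integrable_const_bound[where B = 1, OF prob_space.finite_measure])
          (auto cong: measurable_cong_sets)
      have nn: "(\<integral>\<^sup>+y. ennreal (g y) \<partial>m) = ennreal (\<integral>y. g y \<partial>m)" if "prob_space m" "sets m = sets borel" for m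
        using ig[OF that] g01 by (intro nn_integral_eq_integral) auto
      have I0: "0 \<le> (\<integral>y. g y \<partial>m)" for m by (intro Bochner_Integration.integral_nonneg g01)
      have "norm ((\<integral>y. g y \<partial>P (real n) x0) - (\<integral>y. g y \<partial>\<mu>)) \<le> D' * \<alpha> ^ n" for n
      proof -
        have "0 \<le> D' * \<alpha> ^ n" using D' \<alpha> by simp
        then show ?thesis
          using c1[OF gm g01, of n] I0
          by (simp add: nn[OF p\<mu> s\<mu>] nn[OF P1 sets_P] ennreal_plus[symmetric] abs_le_iff del: ennreal_plus)
      qed
      then have "(\<lambda>n. (\<integral>y. g y \<partial>P (real n) x0) - (\<integral>y. g y \<partial>\<mu>)) \<longlonglongrightarrow> 0"
        by (intro Lim_null_comparison[OF _ a0] always_eventually) auto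
      then show ?thesis by (simp add: LIM_zero_iff)
    qed
    \<comment> \<open>The second way: \<open>P n\<close> and \<open>P t\<close> commute, so the
      integral is an average over \<open>P t x0\<close> of \<open>P n y E\<close>, which tends to
      \<open>\<mu> E\<close> from every starting point \<open>y\<close>.\<close>
    moreover have "(\<lambda>n. \<integral>y. g y \<partial>P (real n) x0) \<longlonglongrightarrow> measure \<mu> E"
    proof -
      have "(\<integral>y. g y \<partial>P (real n) x0) = (\<integral>y. measure (P (real n) y) E \<partial>P t x0)" for n
      proof -
        have "(\<integral>y. (\<integral>z. (indicator E z :: real) \<partial>P t y) \<partial>P (real n) x0) = (\<integral>y. (\<integral>z. (indicator E z :: real) \<partial>P (real n) y) \<partial>P t x0)"
        proof -
          have "(\<integral>y. (\<integral>z. (indicator E z :: real) \<partial>P t y) \<partial>P (real n) x0) = (\<integral>z. (indicator E z :: real) \<partial>P (real n + t) x0)"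
            by (rule P_plus[OF of_nat_0_le_iff t tame_indicator[OF E], symmetric])
          also have "\<dots> = (\<integral>z. (indicator E z :: real) \<partial>P (t + real n) x0)" by (simp only: add.commute)
          also have "\<dots> = (\<integral>y. (\<integral>z. (indicator E z :: real) \<partial>P (real n) y) \<partial>P t x0)"
            by (rule P_plus[OF t of_nat_0_le_iff tame_indicator[OF E]])
          finally show ?thesis .
        qed
        then show ?thesis by (simp add: g_def space_P t)
      qed
      moreover have "(\<lambda>n. \<integral>y. measure (P (real n) y) E \<partial>P t x0) \<longlonglongrightarrow> (\<integral>y. measure \<mu> E \<partial>P t x0)"
      proof (rule integral_dominated_convergence[where w = "\<lambda>_. 1"])
        show "(\<lambda>y. measure (P (real n) y) E) \<in> borel_measurable (P t x0)" for n
          using measurable_compose[OF kernel measurable_measure_subprob_algebra[OF E], of "real n"] sets_P[OF t]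
          by (simp cong: measurable_cong_sets)
        show "integrable (P t x0) (\<lambda>_. 1::real)"
          by (rule finite_measure.integrable_const[OF prob_space.finite_measure[OF prob[OF t]]])
        show "AE y in P t x0. norm (measure (P (real n) y) E) \<le> 1" for n
          using prob_space.prob_le_1[OF prob] by auto
      qed (auto intro: setlim E)
      moreover have "(\<integral>y. measure \<mu> E \<partial>P t x0) = measure \<mu> E"
        using prob_space.prob_space[OF prob[OF t]] by simp
      ultimately show ?thesis by (simp only:)
    qed
    ultimately have "(\<integral>y. g y \<partial>\<mu>) = measure \<mu> E" by (rule LIMSEQ_unique)
    moreover have "emeasure (\<mu> \<bind> P t) E = (\<integral>\<^sup>+y. ennreal (g y) \<partial>\<mu>)"
      unfolding ge by (rule emeasure_bind[OF _ kt E]) (simp add: sp\<mu>)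
    moreover have "(\<integral>\<^sup>+y. ennreal (g y) \<partial>\<mu>) = ennreal (\<integral>y. g y \<partial>\<mu>)"
      using gm g01 s\<mu> by (intro nn_integral_eq_integral \<mu>.integrable_const_bound[where B = 1]) (auto cong: measurable_cong_sets)
    ultimately show "emeasure (\<mu> \<bind> P t) E = emeasure \<mu> E" by (simp add: \<mu>.emeasure_eq_measure)
  qed
  define I where "I = (\<integral>y. V y \<partial>\<mu>)"
  have I0: "0 \<le> I" unfolding I_def by (intro Bochner_Integration.integral_nonneg V0)
  have "\<bar>(\<integral>z. f z \<partial>P (real n) x) - (\<integral>z. f z \<partial>\<mu>)\<bar> \<le> (D * (2 + I)) * c * \<alpha> ^ n * (1 + V x)" if f: "tame c f" for c f n x
  proof -
    have c: "0 \<le> c" using f by (simp add: tame_def)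
    have "(\<integral>z. f z \<partial>\<mu>) = (\<integral>y. (\<integral>z. f z \<partial>P (real n) y) \<partial>\<mu>)"
      using integral_bind_tame[OF p\<mu> s\<mu> Vf _ f, of "real n"] inv[of "real n"] by simp
    then have "\<bar>(\<integral>z. f z \<partial>P (real n) x) - (\<integral>z. f z \<partial>\<mu>)\<bar> \<le> D * c * \<alpha> ^ n * (2 + V x + I)"
      using avg[OF f p\<mu> s\<mu> Vf, of n x] by (simp add: I_def)
    also have "\<dots> \<le> D * c * \<alpha> ^ n * ((2 + I) * (1 + V x))"
      using D c \<alpha> V0[of x] I0 by (intro mult_left_mono) (auto simp: algebra_simps)
    finally show ?thesis by (simp add: mult_ac)
  qed
  moreover have "0 < D * (2 + I)" using D I0 by simp
  ultimately show ?thesis using p\<mu> s\<mu> Vf inv \<alpha> that by blast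
qed

text \<open>Convergence at integer times is already known; a general time is split into its integer
  part and a remainder of length at most 1, along which the weighted norm grows by a factor
  \<open>1 + C\<close> at most.\<close>

theorem exponential_ergodicity:
  "\<exists>\<mu>. prob_space \<mu> \<and> sets \<mu> = sets borel \<and> integrable \<mu> V \<and>
    (\<forall>t\<ge>0. \<forall>E\<in>sets borel. (\<integral>x. measure (P t x) E \<partial>\<mu>) = measure \<mu> E) \<and>
    (\<forall>\<nu>. prob_space \<nu> \<longrightarrow> sets \<nu> = sets borel \<longrightarrow>
      (\<forall>t\<ge>0. \<forall>E\<in>sets borel. (\<integral>x. measure (P t x) E \<partial>\<nu>) = measure \<nu> E) \<longrightarrow> \<nu> = \<mu>) \<and>
    (\<exists>c>0. \<exists>C>0. \<forall>x t f. 0 \<le> t \<longrightarrow> f \<in> borel_measurable borel \<longrightarrow> (\<forall>y. \<bar>f y\<bar> \<le> 1 + V y) \<longrightarrow>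
      \<bar>(\<integral>y. f y \<partial>P t x) - (\<integral>y. f y \<partial>\<mu>)\<bar> \<le> C * (1 + V x) * exp (- c * t))"
proof -
  obtain \<mu> \<alpha> D where \<mu>: "prob_space \<mu>" "sets \<mu> = sets borel" "(\<integral>\<^sup>+y. ennreal (V y) \<partial>\<mu>) < \<infinity>"
    and inv: "\<And>t. 0 \<le> t \<Longrightarrow> \<mu> \<bind> P t = \<mu>" and \<alpha>: "0 < \<alpha>" "\<alpha> < 1" and D: "0 < D"
    and conv: "\<And>c f n x. tame c f \<Longrightarrow> \<bar>(\<integral>z. f z \<partial>P (real n) x) - (\<integral>z. f z \<partial>\<mu>)\<bar> \<le> D * c * \<alpha> ^ n * (1 + V x)"
    by (rule invariant_measure_exists) (rule that)
  have sp\<mu>: "space \<mu> = UNIV" using sets_eq_imp_space_eq[OF \<mu>(2)] by simp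
  have int\<mu>: "(\<integral>y. (\<integral>z. f z \<partial>P t y) \<partial>\<mu>) = (\<integral>z. f z \<partial>\<mu>)" if "0 \<le> t" "tame c f" for t c f
    using integral_bind_tame[OF \<mu> that] inv[OF that(1)] by simp
  have invE: "(\<integral>x. measure (P t x) E \<partial>\<mu>) = measure \<mu> E" if "0 \<le> t" "E \<in> sets borel" for t E
    using int\<mu>[OF that(1) tame_indicator[OF that(2)]] by (simp add: space_P that sp\<mu>)
  have lim: "(\<lambda>n. measure (P (real n) x) E) \<longlonglongrightarrow> measure \<mu> E" if E: "E \<in> sets borel" for x E
  proof -
    have "(\<lambda>n. measure (P (real n) x) E - measure \<mu> E) \<longlonglongrightarrow> 0"
    proof (rule Lim_null_comparison)
      show "\<forall>\<^sub>F n in sequentially. norm (measure (P (real n) x) E - measure \<mu> E) \<le> D * 1 * (1 + V x) * \<alpha> ^ n"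
        using conv[OF tame_indicator[OF E], of _ x] by (auto simp: space_P sp\<mu> mult_ac intro!: always_eventually)
      show "(\<lambda>n. D * 1 * (1 + V x) * \<alpha> ^ n) \<longlonglongrightarrow> 0"
        using tendsto_mult_right_zero[OF LIMSEQ_realpow_zero[of \<alpha>], of "D * 1 * (1 + V x)"] \<alpha> by simp
    qed
    then show ?thesis by (simp add: LIM_zero_iff)
  qed
  \<comment> \<open>Integrate the setwise convergence \<open>lim\<close> over the starting point
    with respect to \<open>\<nu>\<close>: invariance keeps the left side at
    \<open>\<nu> E\<close>.\<close>
  have uniq: "\<nu> = \<mu>" if \<nu>: "prob_space \<nu>" "sets \<nu> = sets borel"
    and inv\<nu>: "\<forall>t\<ge>0. \<forall>E\<in>sets borel. (\<integral>x. measure (P t x) E \<partial>\<nu>) = measure \<nu> E" for \<nu>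
  proof (rule measure_eqI)
    interpret \<nu>: prob_space \<nu> by (rule \<nu>)
    interpret \<mu>: prob_space \<mu> by (rule \<mu>)
    fix E assume "E \<in> sets \<nu>"
    then have E: "E \<in> sets borel" using \<nu> by simp
    have "(\<lambda>n. \<integral>x. measure (P (real n) x) E \<partial>\<nu>) \<longlonglongrightarrow> (\<integral>x. measure \<mu> E \<partial>\<nu>)"
    proof (rule integral_dominated_convergence[where w = "\<lambda>_. 1"])
      show "(\<lambda>y. measure (P (real n) y) E) \<in> borel_measurable \<nu>" for n
        using measurable_compose[OF kernel measurable_measure_subprob_algebra[OF E], of "real n"] \<nu>(2)
        by (simp cong: measurable_cong_sets)
      show "AE y in \<nu>. norm (measure (P (real n) y) E) \<le> 1" for n
        using prob_space.prob_le_1[OF prob] by auto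
    qed (auto intro: lim E)
    then have "(\<lambda>n. measure \<nu> E) \<longlonglongrightarrow> measure \<mu> E"
      using inv\<nu> E \<nu>.prob_space by simp
    then have "measure \<nu> E = measure \<mu> E" by (rule LIMSEQ_unique[OF tendsto_const])
    then show "emeasure \<nu> E = emeasure \<mu> E" by (simp add: \<nu>.emeasure_eq_measure \<mu>.emeasure_eq_measure)
  qed (simp add: \<nu> \<mu>)
  define c where "c = - ln \<alpha>"
  have c: "0 < c" using \<alpha> by (simp add: c_def)
  \<comment> \<open>\<open>D\<close> from integer times, \<open>1 + C\<close> from the remainder,
    and \<open>exp c\<close> because the integer part of \<open>t\<close> falls short of
    \<open>t\<close> by at most 1.\<close>
  define C' where "C' = D * (1 + C) * exp c"
  have C': "0 < C'" using D C by (simp add: C'_def)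
  have bound: "\<bar>(\<integral>y. f y \<partial>P t x) - (\<integral>y. f y \<partial>\<mu>)\<bar> \<le> C' * (1 + V x) * exp (- c * t)"
    if t: "0 \<le> t" and f: "f \<in> borel_measurable borel" "\<forall>y. \<bar>f y\<bar> \<le> 1 + V y" for x t f
  proof -
    have tf: "tame 1 f" using f by (simp add: tame_def)
    define n where "n = nat \<lfloor>t\<rfloor>"
    define r where "r = t - real n"
    have r: "0 \<le> r" "r \<le> 1" using t unfolding r_def n_def by linarith+
    have tr: "t = real n + r" by (simp add: r_def)
    have "(\<integral>y. f y \<partial>P t x) = (\<integral>z. (\<integral>y. f y \<partial>P r z) \<partial>P (real n) x)"
      unfolding tr by (rule P_plus[OF of_nat_0_le_iff r(1) tf])
    moreover have "(\<integral>y. f y \<partial>\<mu>) = (\<integral>z. (\<integral>y. f y \<partial>P r z) \<partial>\<mu>)"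
      by (rule int\<mu>[OF r(1) tf, symmetric])
    ultimately have "\<bar>(\<integral>y. f y \<partial>P t x) - (\<integral>y. f y \<partial>\<mu>)\<bar> \<le> D * (1 * (1 + C)) * \<alpha> ^ n * (1 + V x)"
      using conv[OF tame_P[OF r(1) tf], of n x] by simp
    also have "\<alpha> ^ n \<le> exp c * exp (- c * t)"
    proof -
      have "\<alpha> ^ n = exp (real n * ln \<alpha>)" using \<alpha> by (simp add: exp_of_nat_mult)
      also have "real n * ln \<alpha> = - c * real n" by (simp add: c_def)
      also have "exp (- c * real n) \<le> exp (c + - c * t)"
      proof -
        have "c * r \<le> c * 1" using c r by (intro mult_left_mono) auto
        then show ?thesis by (simp add: tr algebra_simps)
      qed
      finally show ?thesis unfolding exp_add .
    qed
    then have "D * (1 * (1 + C)) * \<alpha> ^ n * (1 + V x) \<le> D * (1 * (1 + C)) * (exp c * exp (- c * t)) * (1 + V x)"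
      using D C V0[of x] by (intro mult_right_mono mult_left_mono) auto
    finally show ?thesis by (simp add: C'_def mult_ac)
  qed
  show ?thesis
  proof (intro exI[of _ \<mu>] conjI allI ballI impI)
    show "integrable \<mu> V" by (rule tame_integrable(2)[OF tame_V \<mu>])
    show "\<exists>c>0. \<exists>C>0. \<forall>x t f. 0 \<le> t \<longrightarrow> f \<in> borel_measurable borel \<longrightarrow> (\<forall>y. \<bar>f y\<bar> \<le> 1 + V y) \<longrightarrow>
      \<bar>(\<integral>y. f y \<partial>P t x) - (\<integral>y. f y \<partial>\<mu>)\<bar> \<le> C * (1 + V x) * exp (- c * t)"
    proof (rule exI[of _ c], rule conjI[OF c], rule exI[of _ C'], rule conjI[OF C'], intro allI impI)
      fix x and t :: real and f :: "'a \<Rightarrow> real"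
      assume "0 \<le> t" "f \<in> borel_measurable borel" "\<forall>y. \<bar>f y\<bar> \<le> 1 + V y"
      then show "\<bar>(\<integral>y. f y \<partial>P t x) - (\<integral>y. f y \<partial>\<mu>)\<bar> \<le> C' * (1 + V x) * exp (- c * t)" by (rule bound)
    qed
    show "\<nu> = \<mu>" if "prob_space \<nu>" "sets \<nu> = sets borel"
      "\<forall>t\<ge>0. \<forall>E\<in>sets borel. (\<integral>x. measure (P t x) E \<partial>\<nu>) = measure \<nu> E" for \<nu>
      using that by (rule uniq)
  qed (use \<mu> invE in auto)
qed

end

section \<open>Verification of the Harris conditions for the equation\<close>

section \<open>Exponential mixing\<close>

text \<open>For \<open>a <= 1/2\<close> the power is at most \<open>q = sqrt (1 + norm x)\<close>,
  and \<open>M * q <= e * q^2 + M^2 / (4 * e)\<close> by completing a square.\<close>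

lemma sublinear_growth:
  fixes F :: "'a::real_normed_vector \<Rightarrow> 'b::real_normed_vector"
  assumes a: "a \<le> 1 / 2" and bd: "bdd_above (range (\<lambda>x. norm (F x) / (1 + norm x) powr a))" and e: "0 < e"
  shows "\<exists>C. \<forall>x. norm (F x) \<le> e * norm x + C"
proof -
  obtain m where m: "\<And>x. norm (F x) / (1 + norm x) powr a \<le> m" using bd by (auto simp: bdd_above_def)
  define M where "M = max m 0"
  have "norm (F x) \<le> e * norm x + (e + M\<^sup>2 / (4 * e))" for x
  proof -
    define q where "q = sqrt (1 + norm x)"
    have q: "0 \<le> q" "q\<^sup>2 = 1 + norm x" by (auto simp: q_def)
    have "1 + norm x \<noteq> 0" using norm_ge_zero[of x] by linarith
    then have pos: "0 < (1 + norm x) powr a" by simp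
    have "norm (F x) \<le> m * (1 + norm x) powr a" using m[of x] pos by (simp add: field_simps)
    also have "\<dots> \<le> M * (1 + norm x) powr a" using pos by (intro mult_right_mono) (auto simp: M_def)
    also have "\<dots> \<le> M * q"
    proof (rule mult_left_mono)
      have "(1 + norm x) powr a \<le> (1 + norm x) powr (1 / 2)" using a by (intro powr_mono) auto
      then show "(1 + norm x) powr a \<le> q" by (simp add: q_def powr_half_sqrt)
    qed (simp add: M_def)
    also have "M * q \<le> e * q\<^sup>2 + M\<^sup>2 / (4 * e)"
    proof -
      have "0 \<le> (2 * e * q - M)\<^sup>2 / (4 * e)" using e by simp
      also have "\<dots> = e * q\<^sup>2 + M\<^sup>2 / (4 * e) - M * q"
        using e by (simp add: power2_diff field_simps power2_eq_square)
      finally show ?thesis by simp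
    qed
    finally show ?thesis unfolding q(2) by (simp add: algebra_simps)
  qed
  then show ?thesis by blast
qed

context sde
begin

text \<open>Sublevel sets of \<open>V\<close> are bounded, so the minorization on balls applies to
  them. The minorizing probability is uniform on the unit ball, and its normalisation contributes
  the factor \<open>m\<close>.\<close>

lemma exponential_ergodicity_sde:
  assumes kal: "kalman A B"
  shows "\<exists>\<mu>. prob_space \<mu> \<and> sets \<mu> = sets borel \<and> integrable \<mu> V \<and>
    (\<forall>t\<ge>0. \<forall>E\<in>sets borel. (\<integral>x. measure (transP M X t x) E \<partial>\<mu>) = measure \<mu> E) \<and>
    (\<forall>\<nu>. prob_space \<nu> \<longrightarrow> sets \<nu> = sets borel \<longrightarrow>
      (\<forall>t\<ge>0. \<forall>E\<in>sets borel. (\<integral>x. measure (transP M X t x) E \<partial>\<nu>) = measure \<nu> E) \<longrightarrow> \<nu> = \<mu>) \<and>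
    (\<exists>c>0. \<exists>C>0. \<forall>x t f. 0 \<le> t \<longrightarrow> f \<in> borel_measurable borel \<longrightarrow> (\<forall>y. \<bar>f y\<bar> \<le> 1 + V y) \<longrightarrow>
      \<bar>(\<integral>y. f y \<partial>transP M X t x) - (\<integral>y. f y \<partial>\<mu>)\<bar> \<le> C * (1 + V x) * exp (- c * t))"
proof -
  obtain k C where kC: "0 < k" "0 \<le> C"
    "\<And>t x. 0 \<le> t \<Longrightarrow> (\<integral>\<^sup>+y. ennreal (V y) \<partial>transP M X t x) \<le> ennreal (exp (- k * t) * V x + C)"
    using V_transP_bound by blast
  obtain c1 where c1: "0 < c1" "\<And>x. c1 * (norm x)\<^sup>2 \<le> V x" using V_lower by blast
  define m where "m = measure lborel (cball (0::real^'d) 1)"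
  have em: "emeasure lborel (cball (0::real^'d) 1) = ennreal m"
    unfolding m_def by (intro emeasure_eq_ennreal_measure) (use emeasure_lborel_cball_finite[of "0::real^'d" 1] in auto)
  have m: "0 < m" unfolding m_def by (simp add: content_cball_pos)
  define \<nu> :: "(real^'d) measure" where "\<nu> = uniform_measure lborel (cball 0 1)"
  have minor: "\<exists>e>0. \<exists>\<nu>. prob_space \<nu> \<and> sets \<nu> = sets borel \<and>
      (\<forall>x E. V x \<le> R \<longrightarrow> E \<in> sets borel \<longrightarrow> ennreal e * emeasure \<nu> E \<le> emeasure (transP M X 1 x) E)" for R
  proof -
    \<comment> \<open>The radius of a ball containing \<open>{x. V x <= R}\<close>, from
      \<open>c1 * (norm x)^2 <= V x\<close>; \<open>max R 0\<close> covers negative levels.\<close>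
    define \<rho> where "\<rho> = sqrt (max R 0 / c1)"
    have \<rho>: "0 \<le> \<rho>" using c1 by (simp add: \<rho>_def)
    obtain e where e: "0 < e" "\<And>x E. norm x \<le> \<rho> \<Longrightarrow> E \<in> sets borel \<Longrightarrow>
      ennreal e * emeasure lborel (E \<inter> cball 0 1) \<le> emeasure (transP M X 1 x) E"
      using minorization[OF kal \<rho>] by blast
    have "ennreal (e * m) * emeasure \<nu> E \<le> emeasure (transP M X 1 x) E" if x: "V x \<le> R" and E: "E \<in> sets borel" for x E
    proof -
      have "c1 * (norm x)\<^sup>2 \<le> max R 0" using c1(2)[of x] x by simp
      then have "(norm x)\<^sup>2 \<le> max R 0 / c1" using c1(1) by (simp add: field_simps)
      then have nx: "norm x \<le> \<rho>" unfolding \<rho>_def by (rule real_le_rsqrt)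
      have "emeasure \<nu> E = emeasure lborel (cball 0 1 \<inter> E) / ennreal m"
        unfolding \<nu>_def using E by (simp add: em)
      then have "ennreal (e * m) * emeasure \<nu> E = ennreal e * (ennreal m * (emeasure lborel (E \<inter> cball 0 1) / ennreal m))"
        using e(1) m by (simp add: ennreal_mult mult.assoc Int_commute)
      also have "ennreal m * (emeasure lborel (E \<inter> cball 0 1) / ennreal m) = emeasure lborel (E \<inter> cball 0 1)"
        using m by (metis ennreal_mult_divide_eq ennreal_neq_top ennreal_eq_0_iff ennreal_times_divide mult.commute not_le)
      finally show ?thesis using e(2)[OF nx E] by simp
    qed
    moreover have "prob_space \<nu>" unfolding \<nu>_def
      by (rule prob_space_uniform_measure) (use em m in auto)
    moreover have "sets \<nu> = sets borel" by (simp add: \<nu>_def)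
    ultimately show ?thesis using e(1) m by (intro exI[of _ "e * m"] conjI exI[of _ \<nu>]) auto
  qed
  interpret H: harris "transP M X" V k C
    by (rule harris.intro)
      (fact transP_measurable prob_space_transP transP_0 chapman_kolmogorov V_measurable V_nonneg kC minor)+
  show ?thesis by (rule H.exponential_ergodicity)
qed

end

theorem mainTheorem1:
  fixes A :: "real^'d \<Rightarrow> real^'d" and B :: "real^'n \<Rightarrow> real^'d"
    and F :: "real^'d \<Rightarrow> real^'d"
    and M :: "'w measure" and W :: "real \<Rightarrow> 'w \<Rightarrow> real^'n"
    and X :: "real \<Rightarrow> real^'d \<Rightarrow> 'w \<Rightarrow> real^'d"
  assumes dim: "CARD('n) \<le> CARD('d)"
    and linA: "linear A" and linB: "linear B"
    and smoothF: "smooth_field F"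
    and lipF: "\<exists>L. L-lipschitz_on UNIV F"
    and W: "wiener M W"
    and X: "\<And>x \<omega>. \<omega> \<in> space M \<Longrightarrow> continuous_on {0..} (\<lambda>t. X t x \<omega>) \<and>
              (\<forall>t\<ge>0. X t x \<omega> = x + integral {0..t} (\<lambda>s. A (X s x \<omega>) + F (X s x \<omega>)) + B (W t \<omega>))"
    and D: "hurwitz A"
    and K: "kalman A B"
    and G: "\<exists>a. 0 \<le> a \<and> a < 1 / (2 * real (dstar A B)) \<and>
              bdd_above (range (\<lambda>x. norm (F x) / (1 + norm x) powr a))"
    and H: "weak_hoermander A F B"
  shows "\<exists>\<mu>. invariant_measure M X \<mu> \<and> (\<forall>\<nu>. invariant_measure M X \<nu> \<longrightarrow> \<nu> = \<mu>) \<and>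
           integrable \<mu> (Vfun A) \<and>
           (\<exists>c>0. \<exists>C>0. \<forall>x t (f :: real^'d \<Rightarrow> real). 0 \<le> t \<longrightarrow> f \<in> borel_measurable borel \<longrightarrow>
              (\<forall>y. \<bar>f y\<bar> \<le> 1 + Vfun A y) \<longrightarrow>
              \<bar>(\<integral>y. f y \<partial>transP M X t x) - (\<integral>y. f y \<partial>\<mu>)\<bar> \<le> C * (1 + Vfun A x) * exp (- c * t))"
proof -
  obtain KA where KA: "1 \<le> KA" "\<And>x. norm (A x) \<le> KA * norm x" using linear_norm_bound[OF linA] by blast
  obtain C0 c0 where C0: "0 \<le> C0" "0 < c0" "\<forall>s\<ge>0. \<forall>x. norm (opexp A s x) \<le> C0 * exp (- c0 * s) * norm x"
    using hurwitz_imp_exp_decay[OF linA D] by blast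
  have st: "stable_linop A KA C0 c0"
    by (intro stable_linop.intro linop.intro stable_linop_axioms.intro) (use linA KA C0 in blast)+
  obtain L where L: "L-lipschitz_on UNIV F" using lipF by blast
  obtain a where a: "0 \<le> a" "a < 1 / (2 * real (dstar A B))"
    and bd: "bdd_above (range (\<lambda>x. norm (F x) / (1 + norm x) powr a))" using G by blast
  \<comment> \<open>\<open>1 / 0 = 0\<close> would leave no room for \<open>a\<close>\<close>
  have "dstar A B \<noteq> 0" using a by (intro notI) simp
  then have "1 / (2 * real (dstar A B)) \<le> 1 / 2" by (simp add: field_simps)
  then have a2: "a \<le> 1 / 2" using a(2) by linarith
  interpret sde A KA C0 c0 B F L M W X
    by (intro sde.intro euler_scheme.intro st euler_scheme_axioms.intro sde_axioms.intro linB L W X sublinear_growth[OF a2 bd])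
  have V: "Vfun A = V" by (rule Vfun_eq_V[OF st])
  obtain \<mu> where \<mu>: "prob_space \<mu>" "sets \<mu> = sets borel" "integrable \<mu> V"
    "\<forall>t\<ge>0. \<forall>E\<in>sets borel. (\<integral>x. measure (transP M X t x) E \<partial>\<mu>) = measure \<mu> E"
    and uniq: "\<forall>\<nu>. prob_space \<nu> \<longrightarrow> sets \<nu> = sets borel \<longrightarrow>
      (\<forall>t\<ge>0. \<forall>E\<in>sets borel. (\<integral>x. measure (transP M X t x) E \<partial>\<nu>) = measure \<nu> E) \<longrightarrow> \<nu> = \<mu>"
    and rate: "\<exists>c>0. \<exists>C>0. \<forall>x t f. 0 \<le> t \<longrightarrow> f \<in> borel_measurable borel \<longrightarrow> (\<forall>y. \<bar>f y\<bar> \<le> 1 + V y) \<longrightarrow>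
      \<bar>(\<integral>y. f y \<partial>transP M X t x) - (\<integral>y. f y \<partial>\<mu>)\<bar> \<le> C * (1 + V x) * exp (- c * t)"
    by (rule exE[OF exponential_ergodicity_sde[OF K]]) (elim conjE, rule that)
  show ?thesis
    unfolding V invariant_measure_def
  proof (rule exI[of _ \<mu>], intro conjI \<mu> rate allI impI, elim conjE)
    fix \<nu> assume "prob_space \<nu>" "sets \<nu> = sets borel"
      "\<forall>t\<ge>0. \<forall>E\<in>sets borel. (\<integral>x. measure (transP M X t x) E \<partial>\<nu>) = measure \<nu> E"
    then show "\<nu> = \<mu>" using uniq by simp
  qed
qed

end
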